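(* Let $T,T'\in cv(F)$. (1) \[ \inf_{g\in F\setminus\{1\}} \frac{\|g\|_T}{\|g\|_{T'}}\le \frac{h(T')}{h(T)}\le \sup_{g\in F\setminus\{1\}} \frac{\|g\|_T}{\|g\|_{T'}}. \] (2) Suppose that $[T]\ne [T']$. Then \[ \inf_{g\in F\setminus\{1\}} \frac{\|g\|_T}{\|g\|_{T'}}< \frac{h(T')}{h(T)}< \sup_{g\in F\setminus\{1\}} \frac{\|g\|_T}{\|g\|_{T'}}. \]
   Context: $F$ is a free group of finite rank $k\ge 2$. $cv(F)$ is the set of all minimal, free and discrete isometric actions of $F$ on $\mathbb R$-trees $T$, two trees being equal if there is an $F$-equivariant isometry between them. For $T\in cv(F)$, the projective class $[T]$ is the set of all $cT\in cv(F)$ with $c>0$ ($cT$ is $T$ with the metric multiplied by $c$). For $g\in F$, $\|g\|_T:=\inf_{x\in T}d_T(x,gx)$ is the translation length. The volume entropy of $T$ is $h(T)=\lim_{R\to\infty}\frac1R\log\#\{g\in F: d_T(x_0,gx_0)\le R\}$, where $x_0\in T$ is a base-point; the limit exists and is independent of $x_0$. *)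

theory Defs
  imports "HOL-Analysis.Analysis" "HOL-Algebra.Group_Action"
begin

section \<open>Free groups of finite rank\<close>

text \<open>A word is a list of letters; the letter \<open>(True, x)\<close> stands for \<open>x\<close> and
  \<open>(False, x)\<close> for the inverse of \<open>x\<close>.\<close>

definition letter_value :: "('g, 'm) monoid_scheme \<Rightarrow> bool \<times> 'g \<Rightarrow> 'g" where
  "letter_value G l = (if fst l then snd l else inv\<^bsub>G\<^esub> (snd l))"

definition word_value :: "('g, 'm) monoid_scheme \<Rightarrow> (bool \<times> 'g) list \<Rightarrow> 'g" where
  "word_value G w = foldr (\<lambda>l a. letter_value G l \<otimes>\<^bsub>G\<^esub> a) w \<one>\<^bsub>G\<^esub>"

definition reduced_word :: "(bool \<times> 'g) list \<Rightarrow> bool" where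
  "reduced_word w \<longleftrightarrow> successively (\<lambda>l l'. \<not> (snd l = snd l' \<and> fst l \<noteq> fst l')) w"

text \<open>\<open>X\<close> is a free basis if every group element is the value of exactly one reduced word
  over \<open>X\<close>.\<close>

definition free_basis :: "('g, 'm) monoid_scheme \<Rightarrow> 'g set \<Rightarrow> bool" where
  "free_basis G X \<longleftrightarrow> X \<subseteq> carrier G \<and>
     bij_betw (word_value G) {w \<in> lists (UNIV \<times> X). reduced_word w} (carrier G)"

definition free_group_of_rank :: "('g, 'm) monoid_scheme \<Rightarrow> nat \<Rightarrow> bool" where
  "free_group_of_rank G k \<longleftrightarrow>
     group G \<and> (\<exists>X. free_basis G X \<and> finite X \<and> card X = k)"

section \<open>Real trees\<close>

definition geodesic_from_to :: "'a metric \<Rightarrow> (real \<Rightarrow> 'a) \<Rightarrow> 'a \<Rightarrow> 'a \<Rightarrow> bool" where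
  "geodesic_from_to m \<gamma> x y \<longleftrightarrow>
     \<gamma> \<in> {0..mdist m x y} \<rightarrow> mspace m \<and> \<gamma> 0 = x \<and> \<gamma> (mdist m x y) = y \<and>
     (\<forall>s\<in>{0..mdist m x y}. \<forall>t\<in>{0..mdist m x y}. mdist m (\<gamma> s) (\<gamma> t) = \<bar>s - t\<bar>)"

text \<open>Any two points are joined by a geodesic segment, and that segment is the only arc
  between them. For \<open>x = y\<close> there is no injective path, so only \<open>x \<noteq> y\<close> is constrained by the
  second condition.\<close>

definition real_tree :: "'a metric \<Rightarrow> bool" where
  "real_tree m \<longleftrightarrow> mspace m \<noteq> {} \<and>
     (\<forall>x\<in>mspace m. \<forall>y\<in>mspace m. \<exists>\<gamma>. geodesic_from_to m \<gamma> x y \<and>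
        (\<forall>p. pathin (mtopology_of m) p \<and> inj_on p {0..1} \<and> p 0 = x \<and> p 1 = y
             \<longrightarrow> p ` {0..1} = \<gamma> ` {0..mdist m x y}))"

section \<open>Actions on real trees\<close>

record ('g, 'a) tree_action =
  tree :: "'a metric"
  act :: "'g \<Rightarrow> 'a \<Rightarrow> 'a"

abbreviation pts :: "('g, 'a) tree_action \<Rightarrow> 'a set" where
  "pts T \<equiv> mspace (tree T)"

definition isometric_action :: "('g, 'm) monoid_scheme \<Rightarrow> ('g, 'a) tree_action \<Rightarrow> bool" where
  "isometric_action G T \<longleftrightarrow> group_action G (pts T) (act T) \<and>
     (\<forall>g\<in>carrier G. \<forall>x\<in>pts T. \<forall>y\<in>pts T.
        mdist (tree T) (act T g x) (act T g y) = mdist (tree T) x y)"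

definition free_action :: "('g, 'm) monoid_scheme \<Rightarrow> ('g, 'a) tree_action \<Rightarrow> bool" where
  "free_action G T \<longleftrightarrow> (\<forall>x\<in>pts T. stabilizer G (act T) x = {\<one>\<^bsub>G\<^esub>})"

definition discrete_action :: "('g, 'm) monoid_scheme \<Rightarrow> ('g, 'a) tree_action \<Rightarrow> bool" where
  "discrete_action G T \<longleftrightarrow> (\<forall>x\<in>pts T.
     subtopology (mtopology_of (tree T)) (orbit G (act T) x) = discrete_topology (orbit G (act T) x))"

text \<open>Minimality: no proper invariant subtree (subtrees are non-empty, as \<open>real_tree\<close> is).\<close>

definition minimal_action :: "('g, 'm) monoid_scheme \<Rightarrow> ('g, 'a) tree_action \<Rightarrow> bool" where
  "minimal_action G T \<longleftrightarrow> (\<forall>S. S \<subseteq> pts T \<and> real_tree (submetric (tree T) S) \<and>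
     (\<forall>g\<in>carrier G. act T g ` S \<subseteq> S) \<longrightarrow> S = pts T)"

definition cv :: "('g, 'm) monoid_scheme \<Rightarrow> ('g, 'a) tree_action set" where
  "cv G = {T. real_tree (tree T) \<and> isometric_action G T \<and>
              minimal_action G T \<and> free_action G T \<and> discrete_action G T}"

text \<open>Elements of \<open>cv G\<close> are representatives: two of them are the same point of the outer space
  when they are related by the following relation.\<close>

definition equivariantly_isometric ::
    "('g, 'm) monoid_scheme \<Rightarrow> ('g, 'a) tree_action \<Rightarrow> ('g, 'b) tree_action \<Rightarrow> bool" where
  "equivariantly_isometric G T T' \<longleftrightarrow> (\<exists>f. f ` pts T = pts T' \<and>
     (\<forall>x\<in>pts T. \<forall>y\<in>pts T. mdist (tree T') (f x) (f y) = mdist (tree T) x y) \<and>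
     (\<forall>g\<in>carrier G. \<forall>x\<in>pts T. f (act T g x) = act T' g (f x)))"

definition rescale :: "real \<Rightarrow> ('g, 'a) tree_action \<Rightarrow> ('g, 'a) tree_action" where
  "rescale c T = T\<lparr>tree := metric (pts T, \<lambda>x y. c * mdist (tree T) x y)\<rparr>"

lemma rescale_simps:
  assumes "c > 0"
  shows "pts (rescale c T) = pts T"
    and "mdist (tree (rescale c T)) x y = c * mdist (tree T) x y"
    and "act (rescale c T) = act T"
proof -
  interpret Metric_space "pts T" "mdist (tree T)" by simp
  have *: "Metric_space (pts T) (\<lambda>x y. c * mdist (tree T) x y)"
  proof
    fix x y z assume "x \<in> pts T" "y \<in> pts T" "z \<in> pts T"
    then have "mdist (tree T) x z \<le> mdist (tree T) x y + mdist (tree T) y z"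
      by (rule triangle)
    with assms show "c * mdist (tree T) x z \<le> c * mdist (tree T) x y + c * mdist (tree T) y z"
      by (simp flip: distrib_left)
  qed (use assms in \<open>auto simp: commute\<close>)
  show "pts (rescale c T) = pts T" "mdist (tree (rescale c T)) x y = c * mdist (tree T) x y"
    using Metric_space.mspace_metric[OF *] Metric_space.mdist_metric[OF *]
    by (simp_all add: rescale_def)
  show "act (rescale c T) = act T" by (simp add: rescale_def)
qed

definition projective_class ::
    "('g, 'm) monoid_scheme \<Rightarrow> ('g, 'a) tree_action \<Rightarrow> ('g, 'a) tree_action set" where
  "projective_class G T = {S \<in> cv G. \<exists>c>0. equivariantly_isometric G S (rescale c T)}"

section \<open>Translation length and volume entropy\<close>

definition translation_length :: "('g, 'a) tree_action \<Rightarrow> 'g \<Rightarrow> real" where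
  "translation_length T g = (INF x\<in>pts T. mdist (tree T) x (act T g x))"

text \<open>The base point is an explicit argument.\<close>

definition volume_entropy :: "('g, 'm) monoid_scheme \<Rightarrow> ('g, 'a) tree_action \<Rightarrow> 'a \<Rightarrow> real" where
  "volume_entropy G T x\<^sub>0 =
     Lim at_top (\<lambda>R::real. 1 / R * ln (real (card {g \<in> carrier G. mdist (tree T) x\<^sub>0 (act T g x\<^sub>0) \<le> R})))"

end

theory Submission
  imports Defs
begin

text \<open>
  Put \<open>len x g = d(x, g x)\<close> for a base point \<open>x\<close> of a tree; the entropy is the exponential growth rate of
  this function on the free group. Both inequalities come down to one comparison
  (\<open>entropy_comparison\<close>): if \<open>\<parallel>g\<parallel>\<^sub>T \<le> c \<parallel>g\<parallel>\<^sub>T\<^sub>'\<close> for all \<open>g\<close>, then \<open>h(T') \<le> c h(T)\<close>, and equality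
  forces \<open>\<parallel>g\<parallel>\<^sub>T = c \<parallel>g\<parallel>\<^sub>T\<^sub>'\<close> for all \<open>g\<close>. For the upper bound \<open>c\<close> is the supremum of the ratios; for
  the lower bound the trees change places and \<open>1 / c\<close> is the infimum.

  \<^bold>\<open>From translation lengths to distances.\<close> There are three group elements \<open>u\<close>, the same for both
  trees, and a point \<open>y\<close> in each tree such that \<open>d(y, f y)\<close> is the maximum of \<open>\<parallel>f u\<parallel> - \<parallel>u\<parallel>\<close> over the
  three elements, for every \<open>f\<close> (\<open>marker_point\<close>). The axes of the three elements pass through \<open>y\<close> and
  leave it in such different directions that one of them prolongs the segment from \<open>y\<close> to \<open>f y\<close> and
  its inverse without backtracking. Consequently an inequality between translation lengths becomes an
  inequality \<open>len \<le> c len' + K\<close>, which gives \<open>h(T') \<le> c h(T)\<close>. Proportional translation lengths make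
  the two orbits of the points \<open>y\<close> homothetic, and by minimality the homothety of orbits extends to
  the trees (\<open>orbit_isometry_extends\<close>), so that the projective classes agree.

  \<^bold>\<open>Equality of the growth rates.\<close> Over reduced words in a free basis both \<open>len\<close> and \<open>len'\<close> are additive
  under concatenation up to a bounded error (\<open>bounded_cancellation\<close>). It remains to show
  (\<open>growth_rigidity\<close>) that two quasi-additive lengths with \<open>L \<le> L' + K\<close> and the same growth rate \<open>h\<close>
  differ by a bounded amount. Cut every reduced word after its successive occurrences of a fixed word
  \<open>w\<close>. The pieces form a prefix code. Since the series \<open>\<Sum> exp (-h L')\<close> over all words diverges, the sum
  of \<open>exp (-h L')\<close> over the pieces is bounded below by a constant that does not depend on \<open>w\<close>
  (\<open>block_mass\<close>). If \<open>L' w - L w\<close> were large, every piece would be shorter by a large amount with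
  respect to \<open>L\<close>, hence the sum of \<open>exp (-h L)\<close> over the pieces would exceed 1, and the free monoid
  that they generate would grow faster than \<open>exp (h R)\<close> with respect to \<open>L\<close>. Applied to large powers of
  an element, bounded difference of the lengths means equality of the translation lengths.

  The uniqueness of arcs in real trees yields the four-point inequality (\<open>real_tree_imp_rtree\<close>), on which
  all geometric arguments rest.
\<close>

section \<open>Arcs and medians in real trees\<close>

text \<open>The uniqueness of arcs speaks about continuous paths on the unit interval. It is applied to paths
  glued from geodesics, which are 1-Lipschitz on an interval of arbitrary length; rescaling the
  parameter bridges the gap.\<close>
lemma lipschitz_injective_path_image:
  assumes tree: "real_tree m" and D: "D > 0"
    and x: "x \<in> mspace m" and y: "y \<in> mspace m"
    and c: "\<And>t. t \<in> {0..D} \<Longrightarrow> c t \<in> mspace m" and "c 0 = x" "c D = y"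
    and lip: "\<And>s t. s \<in> {0..D} \<Longrightarrow> t \<in> {0..D} \<Longrightarrow> mdist m (c s) (c t) \<le> \<bar>s - t\<bar>"
    and inj: "inj_on c {0..D}" and g: "geodesic_from_to m g x y"
  shows "c ` {0..D} = g ` {0..mdist m x y}"
proof -
  have uniq: "\<exists>\<gamma>. geodesic_from_to m \<gamma> x y \<and>
        (\<forall>p. pathin (mtopology_of m) p \<and> inj_on p {0..1} \<and> p 0 = x \<and> p 1 = y
             \<longrightarrow> p ` {0..1} = \<gamma> ` {0..mdist m x y})"
    using tree[unfolded real_tree_def, THEN conjunct2, THEN bspec, OF x, THEN bspec, OF y] .
  then obtain \<gamma> where "\<forall>p. pathin (mtopology_of m) p \<and> inj_on p {0..1} \<and> p 0 = x \<and> p 1 = y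
             \<longrightarrow> p ` {0..1} = \<gamma> ` {0..mdist m x y}" by (elim exE conjE)
  note \<gamma> = this[THEN spec, THEN mp]
  have key: "c ` {0..D} = \<gamma> ` {0..mdist m x y}"
    if D: "D > 0" and c: "\<And>t. t \<in> {0..D} \<Longrightarrow> c t \<in> mspace m" and c0: "c 0 = x" and cD: "c D = y"
    and lip: "\<And>s t. s \<in> {0..D} \<Longrightarrow> t \<in> {0..D} \<Longrightarrow> mdist m (c s) (c t) \<le> \<bar>s - t\<bar>"
    and inj: "inj_on c {0..D}" for c :: "real \<Rightarrow> 'a" and D
  proof -
    define p where "p t = c (t * D)" for t :: real
    have mem: "t * D \<in> {0..D}" if "t \<in> {0..1}" for t
      using that D by (auto simp: mult_le_cancel_right1)
    have "Lipschitz_continuous_map (submetric euclidean_metric {0..1}) m p"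
      unfolding Lipschitz_continuous_map_def
    proof (intro conjI exI ballI)
      show "p \<in> mspace (submetric euclidean_metric {0..1}) \<rightarrow> mspace m"
        using c mem by (auto simp: p_def)
      fix s t :: real assume st: "s \<in> mspace (submetric euclidean_metric {0..1})"
        "t \<in> mspace (submetric euclidean_metric {0..1})"
      then have "mdist m (p s) (p t) \<le> \<bar>s * D - t * D\<bar>"
        unfolding p_def by (intro lip mem) auto
      also have "\<dots> = D * \<bar>s - t\<bar>"
        using D by (simp add: abs_mult left_diff_distrib [symmetric])
      finally show "mdist m (p s) (p t) \<le> D * mdist (submetric euclidean_metric {0..1}) s t"
        by (simp add: dist_real_def)
    qed
    then have "continuous_map (mtopology_of (submetric euclidean_metric {0..1})) (mtopology_of m) p"
      by (rule Lipschitz_continuous_imp_continuous_map)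
    then have "pathin (mtopology_of m) p"
      by (simp add: pathin_def mtopology_of_submetric)
    moreover have "inj_on p {0..1}"
    proof (rule inj_onI)
      fix s t assume "s \<in> {0..1}" "t \<in> {0..1}" "p s = p t"
      then have "s * D = t * D" using inj mem unfolding p_def inj_on_def by blast
      then show "s = t" using D by simp
    qed
    ultimately have "p ` {0..1} = \<gamma> ` {0..mdist m x y}"
      using c0 cD by (intro \<gamma>) (auto simp: p_def)
    moreover have "p ` {0..1} = c ` {0..D}"
    proof -
      have "(\<lambda>t. t * D) ` {0..1} = {0..D}"
        using image_mult_atLeastAtMost[OF D, of 0 1] by (simp add: mult.commute)
      then show ?thesis unfolding p_def by (metis image_image)
    qed
    ultimately show ?thesis by simp
  qed
  have "x \<noteq> y" using inj_onD[OF inj, of 0 D] D \<open>c 0 = x\<close> \<open>c D = y\<close> by auto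
  then have xy: "mdist m x y > 0" using x y by (metis less_eq_real_def mdist_nonneg mdist_zero)
  have "c ` {0..D} = \<gamma> ` {0..mdist m x y}" using assms by (intro key) auto
  moreover have "g ` {0..mdist m x y} = \<gamma> ` {0..mdist m x y}"
  proof (rule key[OF xy])
    show "inj_on g {0..mdist m x y}"
      using g mdist_zero unfolding geodesic_from_to_def inj_on_def
      by (metis Pi_mem abs_eq_0 eq_iff_diff_eq_0)
  qed (use g in \<open>auto simp: geodesic_from_to_def\<close>)
  ultimately show ?thesis by simp
qed

definition concat_path :: "real \<Rightarrow> (real \<Rightarrow> 'a) \<Rightarrow> (real \<Rightarrow> 'a) \<Rightarrow> real \<Rightarrow> 'a" where
  "concat_path A c e u = (if u \<le> A then c u else e (u - A))"

lemma concat_path_lipschitz: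
  assumes c: "\<And>u. u \<in> {0..A} \<Longrightarrow> c u \<in> mspace m" and e: "\<And>u. u \<in> {0..B} \<Longrightarrow> e u \<in> mspace m"
    and lip_c: "\<And>u v. u \<in> {0..A} \<Longrightarrow> v \<in> {0..A} \<Longrightarrow> mdist m (c u) (c v) \<le> \<bar>u - v\<bar>"
    and lip_e: "\<And>u v. u \<in> {0..B} \<Longrightarrow> v \<in> {0..B} \<Longrightarrow> mdist m (e u) (e v) \<le> \<bar>u - v\<bar>"
    and ce: "c A = e 0" and A: "0 \<le> A"
    and u: "u \<in> {0..A + B}" and v: "v \<in> {0..A + B}"
  shows "concat_path A c e u \<in> mspace m"
    and "mdist m (concat_path A c e u) (concat_path A c e v) \<le> \<bar>u - v\<bar>"
proof -
  let ?q = "concat_path A c e"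
  interpret Metric_space "mspace m" "mdist m" by simp
  have q_eq: "?q u = e (u - A)" if "u \<ge> A" for u
    using that ce by (cases "u = A") (auto simp: concat_path_def)
  have qM: "?q u \<in> mspace m" if "u \<in> {0..A + B}" for u
    using that c[of u] e[of "u - A"] by (auto simp: concat_path_def)
  have ordered: "mdist m (?q u) (?q v) \<le> v - u" if uv: "u \<in> {0..A + B}" "v \<in> {0..A + B}" "u \<le> v" for u v
  proof -
    consider "v \<le> A" | "A \<le> u" | "u < A" "A < v" by linarith
    then show ?thesis
    proof cases
      case 1 then show ?thesis using uv lip_c[of u v] by (auto simp: concat_path_def)
    next
      case 2 then show ?thesis using uv lip_e[of "u - A" "v - A"] by (auto simp: q_eq)
    next
      case 3
      then have "mdist m (?q u) (?q A) \<le> A - u" "mdist m (?q A) (?q v) \<le> v - A"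
        using uv lip_c[of u A] lip_e[of 0 "v - A"] by (auto simp: concat_path_def ce)
      then show ?thesis using triangle[of "?q u" "?q A" "?q v"] qM uv 3 by force
    qed
  qed
  show "?q u \<in> mspace m" by (rule qM[OF u])
  show "mdist m (?q u) (?q v) \<le> \<bar>u - v\<bar>"
    using ordered[OF u v] ordered[OF v u] by (cases "u \<le> v") (auto simp: commute)
qed

lemma geodesic_point:
  assumes "geodesic_from_to m g x y" "t \<in> {0..mdist m x y}"
  shows "g t \<in> mspace m" "mdist m x (g t) = t" "mdist m (g t) y = mdist m x y - t"
proof -
  have *: "\<And>s t. s\<in>{0..mdist m x y} \<Longrightarrow> t\<in>{0..mdist m x y} \<Longrightarrow> mdist m (g s) (g t) = \<bar>s - t\<bar>"
    and g: "g 0 = x" "g (mdist m x y) = y"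
    using assms by (auto simp: geodesic_from_to_def)
  show "g t \<in> mspace m" using assms by (auto simp: geodesic_from_to_def)
  show "mdist m x (g t) = t" using *[of 0 t] assms(2) g by auto
  show "mdist m (g t) y = mdist m x y - t" using *[of t "mdist m x y"] assms(2) g by auto
qed

lemma real_tree_geodesic:
  assumes "real_tree m" "x \<in> mspace m" "y \<in> mspace m"
  obtains g where "geodesic_from_to m g x y"
  using assms(1)[unfolded real_tree_def, THEN conjunct2, THEN bspec, OF assms(2), THEN bspec, OF assms(3)]
  by (elim exE conjE)

text \<open>Walk from \<open>a\<close> towards \<open>b\<close> up to the first point \<open>p\<close> of the segment from \<open>c\<close> to \<open>b\<close>, then along that
  segment to \<open>c\<close>. This path is injective because \<open>p\<close> is the first common point, so it runs through the
  arc from \<open>a\<close> to \<open>c\<close>, and \<open>p\<close> lies on all three sides of the triangle.\<close>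
lemma real_tree_median:
  assumes tree: "real_tree m" and a: "a \<in> mspace m" and b: "b \<in> mspace m" and c: "c \<in> mspace m"
  obtains p where "p \<in> mspace m" "mdist m a p + mdist m p b = mdist m a b"
    "mdist m b p + mdist m p c = mdist m b c" "mdist m a p + mdist m p c = mdist m a c"
proof -
  interpret Metric_space "mspace m" "mdist m" by simp
  obtain g where g: "geodesic_from_to m g a b" using real_tree_geodesic[OF tree a b] .
  obtain h where h: "geodesic_from_to m h c b" using real_tree_geodesic[OF tree c b] .
  define A where "A = mdist m a b"
  define B where "B = mdist m c b"
  note gp = geodesic_point[OF g, folded A_def] and hp = geodesic_point[OF h, folded B_def]
  have gd: "\<And>s t. s\<in>{0..A} \<Longrightarrow> t\<in>{0..A} \<Longrightarrow> mdist m (g s) (g t) = \<bar>s - t\<bar>"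
    and hd: "\<And>s t. s\<in>{0..B} \<Longrightarrow> t\<in>{0..B} \<Longrightarrow> mdist m (h s) (h t) = \<bar>s - t\<bar>"
    and g0: "g 0 = a" "g A = b" and h0: "h 0 = c" "h B = b"
    using g h by (auto simp: geodesic_from_to_def A_def B_def)
  have AB: "A \<ge> 0" "B \<ge> 0" by (auto simp: A_def B_def)
  define J where "J = {s \<in> {0..A}. \<exists>t \<in> {0..B}. g s = h t}"
  have "A \<in> J" using g0 h0 AB unfolding J_def by force
  \<comment> \<open>the parameter of the first common point; the infimum is attained by compactness\<close>
  define s0 where "s0 = Inf J"
  have bdd: "bdd_below J" unfolding J_def by (auto intro!: bdd_belowI[of _ 0])
  have s0A: "s0 \<in> {0..A}"
    using \<open>A \<in> J\<close> bdd by (auto simp: s0_def J_def intro!: cInf_greatest cInf_lower)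
  have before: "s \<notin> J" if "s < s0" for s
    using cInf_lower[OF _ bdd] that unfolding s0_def by force
  have "s0 \<in> J"
  proof -
    have "\<exists>s\<in>J. s < s0 + inverse (real (Suc n))" for n
      using cInf_lessD[of J "s0 + inverse (real (Suc n))"] \<open>A \<in> J\<close> unfolding s0_def by force
    then obtain s where s: "\<And>n. s n \<in> J" "\<And>n. s n < s0 + inverse (real (Suc n))" by metis
    then have "\<forall>n. \<exists>t. t \<in> {0..B} \<and> g (s n) = h t" using s(1) unfolding J_def by blast
    then obtain t where t: "\<And>n. t n \<in> {0..B}" "\<And>n. g (s n) = h (t n)" by metis
    have "compact {0..B}" by simp
    then obtain l r where l: "l \<in> {0..B}" "strict_mono r" "(t \<circ> r) \<longlonglongrightarrow> l"
      using t(1) unfolding compact_def by blast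
    have sge: "s n \<ge> s0" for n using s(1) before not_less by blast
    have slim: "s \<longlonglongrightarrow> s0"
    proof (rule tendsto_sandwich[of "\<lambda>n. s0" _ _ "\<lambda>n. s0 + inverse (real (Suc n))"])
      show "(\<lambda>n. s0 + inverse (real (Suc n))) \<longlonglongrightarrow> s0"
        using tendsto_add[OF tendsto_const LIMSEQ_inverse_real_of_nat, of s0] by simp
    qed (use s sge in \<open>auto intro!: always_eventually less_imp_le\<close>)
    have bound: "mdist m (g s0) (h l) \<le> \<bar>s0 - s (r n)\<bar> + \<bar>t (r n) - l\<bar>" for n
    proof -
      have "s (r n) \<in> {0..A}" using s(1) by (auto simp: J_def)
      then show ?thesis
        using triangle[of "g s0" "g (s (r n))" "h l"] gd[OF s0A, of "s (r n)"] hd[OF t(1) l(1), of "r n"]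
          gp(1)[OF s0A] gp(1)[of "s (r n)"] hp(1)[OF l(1)] t(2)[of "r n"] by auto
    qed
    have "(\<lambda>n. \<bar>s0 - s (r n)\<bar> + \<bar>t (r n) - l\<bar>) \<longlonglongrightarrow> \<bar>s0 - s0\<bar> + \<bar>l - l\<bar>"
      using LIMSEQ_subseq_LIMSEQ[OF slim l(2)] l(3) by (intro tendsto_intros) (auto simp: o_def)
    then have "mdist m (g s0) (h l) \<le> 0"
      using bound by (intro tendsto_lowerbound[of _ _ sequentially]) (auto intro: always_eventually)
    then have "g s0 = h l" using gp(1)[OF s0A] hp(1)[OF l(1)]
      mdist_nonneg[of m "g s0" "h l"] zero[of "g s0" "h l"]
      by simp
    then show ?thesis using s0A l(1) unfolding J_def by auto
  qed
  then obtain t0 where t0: "t0 \<in> {0..B}" "g s0 = h t0" unfolding J_def by auto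
  define p where "p = g s0"
  have p: "p \<in> mspace m" "mdist m a p + mdist m p b = mdist m a b"
    "mdist m c p + mdist m p b = mdist m c b" 
    using gp[OF s0A] hp[OF t0(1)] t0(2) unfolding p_def by (auto simp: A_def B_def)
  have "mdist m a p + mdist m p c = mdist m a c"
  proof (cases "s0 + t0 = 0")
    case True
    then have "s0 = 0" "t0 = 0" using s0A t0 by auto
    then show ?thesis using p g0 h0 t0 by (simp add: p_def)
  next
    case False
    define D where "D = s0 + t0"
    define q where "q = concat_path s0 g (\<lambda>u. h (t0 - u))"
    have D: "D > 0" using False s0A t0 by (auto simp: D_def)
    have glue: "g s0 = h (t0 - 0)" "0 \<le> s0" using t0 s0A by auto
    have sub: "u \<in> {0..A}" if "u \<in> {0..s0}" for u using that s0A by auto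
    have sub': "t0 - u \<in> {0..B}" if "u \<in> {0..t0}" for u using that t0 by auto
    note q_lip = concat_path_lipschitz[of s0 g m t0 "\<lambda>u. h (t0 - u)", OF gp(1)[OF sub] hp(1)[OF sub'] _ _ glue]
    have qM: "q u \<in> mspace m" if "u \<in> {0..D}" for u
      unfolding q_def by (rule q_lip(1)[where v = u]) (use that gd hd sub sub' in \<open>auto simp: D_def\<close>)
    have lip: "mdist m (q u) (q v) \<le> \<bar>u - v\<bar>" if "u \<in> {0..D}" "v \<in> {0..D}" for u v
      unfolding q_def by (rule q_lip(2)) (use that gd hd sub sub' in \<open>auto simp: D_def\<close>)
    have q_eq: "q u = h (D - u)" if "u \<ge> s0" for u
      using that t0(2) by (cases "u = s0") (auto simp: q_def concat_path_def D_def algebra_simps)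
    have q_eq': "q u = g u" if "u \<le> s0" for u using that by (simp add: q_def concat_path_def)
    have inj1: "q u \<noteq> q v" if uv: "u \<in> {0..D}" "v \<in> {0..D}" "u < v" for u v
    proof (cases "v \<le> s0 \<or> s0 \<le> u")
      case True
      then have "mdist m (q u) (q v) = v - u"
      proof
        assume "v \<le> s0" then show ?thesis using uv s0A gd[of u v] by (auto simp: q_eq')
      next
        assume "s0 \<le> u" then show ?thesis
          using uv t0 hd[of "D-u" "D-v"] by (auto simp: q_eq D_def)
      qed
      then show ?thesis using uv qM zero by (metis diff_gt_0_iff_gt order_less_irrefl)
    next
      case False
      then have "u \<notin> J" using before by auto
      then have "g u \<noteq> h (D - v)" using uv False s0A t0 by (auto simp: J_def D_def)
      then show ?thesis using False by (simp add: q_eq q_eq')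
    qed
    have inj: "inj_on q {0..D}"
      using inj1 by (metis (no_types, lifting) inj_on_def linorder_neqE_linordered_idom)
    obtain k where k: "geodesic_from_to m k a c" using real_tree_geodesic[OF tree a c] .
    have "q ` {0..D} = k ` {0..mdist m a c}"
      using s0A g0 h0 D t0
      by (intro lipschitz_injective_path_image[OF tree D a c qM _ _ lip inj k]) (auto simp: q_eq q_eq' D_def)
    moreover have "p = q s0" "s0 \<in> {0..D}" using s0A t0 by (auto simp: p_def q_eq' D_def)
    ultimately obtain t where "t \<in> {0..mdist m a c}" "p = k t" by blast
    then show ?thesis using geodesic_point[OF k] by auto
  qed
  then show ?thesis using p that by (simp add: commute)
qed

text \<open>Two geodesics glued at \<open>p\<close> form a geodesic from \<open>x\<close> to \<open>y\<close>, which covers the unique arc between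
  these points; so \<open>p\<close> is the point of the arc at distance \<open>d x p\<close> from \<open>x\<close>.\<close>
lemma real_tree_point_unique:
  assumes tree: "real_tree m" and x: "x \<in> mspace m" and y: "y \<in> mspace m"
    and p: "p \<in> mspace m" "mdist m x p + mdist m p y = mdist m x y"
    and q: "q \<in> mspace m" "mdist m x q + mdist m q y = mdist m x y"
    and pq: "mdist m x p = mdist m x q"
  shows "p = q"
proof (cases "x = y")
  case True
  have "mdist m x p = 0" "mdist m x q = 0"
    using True p(2) q(2) mdist_commute[of m p x] mdist_commute[of m q x] mdist_zero[OF x x] by simp_all
  then show ?thesis using mdist_zero[OF x p(1)] mdist_zero[OF x q(1)] by simp
next
  case False
  interpret Metric_space "mspace m" "mdist m" by simp
  define D where "D = mdist m x y"
  have D: "D > 0" using False x y by (simp add: D_def)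
  obtain k where k: "geodesic_from_to m k x y" using real_tree_geodesic[OF tree x y] .
  have on: "p = k (mdist m x p)"
    if p: "p \<in> mspace m" "mdist m x p + mdist m p y = mdist m x y" for p
  proof -
    obtain g where g: "geodesic_from_to m g x p" using real_tree_geodesic[OF tree x p(1)] .
    obtain h where h: "geodesic_from_to m h p y" using real_tree_geodesic[OF tree p(1) y] .
    define a where "a = mdist m x p"
    have py: "mdist m p y = D - a" using p by (auto simp: a_def D_def)
    have aD: "0 \<le> a" "a \<le> D" using mdist_nonneg[of m p y] py by (auto simp: a_def)
    note gp = geodesic_point[OF g, folded a_def] and hp = geodesic_point[OF h, unfolded py]
    define q where "q = concat_path a g h"
    have gd: "\<And>s t. s\<in>{0..a} \<Longrightarrow> t\<in>{0..a} \<Longrightarrow> mdist m (g s) (g t) = \<bar>s - t\<bar>"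
      and hd: "\<And>s t. s\<in>{0..D-a} \<Longrightarrow> t\<in>{0..D-a} \<Longrightarrow> mdist m (h s) (h t) = \<bar>s - t\<bar>"
      and g0: "g 0 = x" "g a = p" and h0: "h 0 = p" "h (D - a) = y"
      using g h py by (auto simp: geodesic_from_to_def a_def)
    have glue: "g a = h 0" using g0 h0 by simp
    note q_lip = concat_path_lipschitz[of a g m "D - a" h, OF gp(1) hp(1) _ _ glue aD(1)]
    have qM: "q u \<in> mspace m" if "u \<in> {0..D}" for u
      unfolding q_def by (rule q_lip(1)[where v = u]) (use that gd hd in auto)
    have lip1: "mdist m (q u) (q v) \<le> \<bar>u - v\<bar>" if "u \<in> {0..D}" "v \<in> {0..D}" for u v
      unfolding q_def by (rule q_lip(2)) (use that gd hd in auto)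
    have q0: "q 0 = x" "q D = y" "q a = p" using aD g0 h0 by (cases "a = D"; auto simp: q_def concat_path_def)+
    have eq1: "mdist m (q u) (q v) = v - u" if uv: "u \<in> {0..D}" "v \<in> {0..D}" "u \<le> v" for u v
    proof -
      have "D \<le> mdist m x (q u) + mdist m (q u) (q v) + mdist m (q v) y"
        using triangle[of x "q u" y] triangle[of "q u" "q v" y] qM uv x y by (force simp: D_def)
      moreover have "mdist m x (q u) \<le> u" "mdist m (q v) y \<le> D - v"
        using lip1[of 0 u] lip1[of v D] uv D q0 by auto
      ultimately show ?thesis using lip1[of u v] uv by linarith
    qed
    have lip: "mdist m (q u) (q v) = \<bar>u - v\<bar>" if uv: "u \<in> {0..D}" "v \<in> {0..D}" for u v
      using eq1[of u v] eq1[of v u] uv by (cases "u \<le> v") (auto simp: commute)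
    have inj: "inj_on q {0..D}"
      using lip qM by (metis (no_types, lifting) abs_eq_0 eq_iff_diff_eq_0 inj_onI zero)
    have "q ` {0..D} = k ` {0..mdist m x y}"
      using q0 lip
      by (intro lipschitz_injective_path_image[OF tree D x y qM _ _ _ inj k]) auto
    moreover have "p = q a" "a \<in> {0..D}" using aD q0 by auto
    ultimately obtain t where t: "t \<in> {0..mdist m x y}" "p = k t" by blast
    then have "mdist m x p = t" using geodesic_point[OF k] by auto
    then show ?thesis using t by simp
  qed
  show ?thesis using on[OF p] on[OF q] pq by simp
qed

section \<open>The four-point inequality\<close>

text \<open>These two properties of real trees reduce the geometry below to linear arithmetic with maxima.\<close>
locale rtree = Metric_space M d for M :: "'a set" and d :: "'a \<Rightarrow> 'a \<Rightarrow> real" +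
  assumes four_point: "\<lbrakk>x \<in> M; y \<in> M; z \<in> M; w \<in> M\<rbrakk>
      \<Longrightarrow> d x y + d z w \<le> max (d x z + d y w) (d x w + d y z)"
    and segment_point: "\<lbrakk>x \<in> M; y \<in> M; 0 \<le> t; t \<le> d x y\<rbrakk>
      \<Longrightarrow> \<exists>p\<in>M. d x p = t \<and> d p y = d x y - t"
begin

definition between :: "'a \<Rightarrow> 'a \<Rightarrow> 'a \<Rightarrow> bool" where
  "between x p y \<longleftrightarrow> d x p + d p y = d x y"

definition gromov :: "'a \<Rightarrow> 'a \<Rightarrow> 'a \<Rightarrow> real" where
  "gromov w x y = (d w x + d w y - d x y) / 2"

text \<open>The Gromov product is the length of the common initial part of the segments from \<open>w\<close> to \<open>x\<close> and to
  \<open>y\<close>; in this form the four-point inequality says that having the first \<open>t\<close> units of a segment in common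
  is a transitive relation.\<close>
lemma gromov_hyperbolic:
  assumes "w \<in> M" "x \<in> M" "y \<in> M" "z \<in> M"
  shows "min (gromov w x y) (gromov w y z) \<le> gromov w x z"
  using four_point[of x z w y] assms commute[of w x] commute[of w y] commute[of w z] commute[of z y]
  unfolding gromov_def by (simp add: min_def max_def field_simps split: if_splits)

lemma gromov_commute: "gromov w x y = gromov w y x"
  by (simp add: gromov_def commute)

lemma gromov_nonneg:
  "\<lbrakk>w \<in> M; x \<in> M; y \<in> M\<rbrakk> \<Longrightarrow> 0 \<le> gromov w x y"
  using triangle[of x w y] by (simp add: gromov_def commute)

lemma between_iff_gromov: "between x w y \<longleftrightarrow> gromov w x y = 0"
  by (auto simp: between_def gromov_def commute)

text \<open>Distances to a point of a segment are determined by distances to its end points. This is the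
  form in which the four-point inequality is used most often: it gives uniqueness and convexity
  statements, displacements of points on segments, and the extension of isometries.\<close>
lemma distance_to_segment_point:
  assumes "x \<in> M" "y \<in> M" "p \<in> M" "q \<in> M" "between x p y"
  shows "d q p = max (d q x - d x p) (d q y - d p y)"
proof -
  have "d q p + d x y \<le> max (d q x + d p y) (d q y + d p x)"
    using four_point[of q p x y] assms by simp
  moreover have "d q x \<le> d q p + d p x" "d q y \<le> d q p + d p y"
    using assms by (auto intro: triangle)
  ultimately show ?thesis
    using assms(5) commute[of p x] unfolding between_def by (simp add: max_def split: if_splits)
qed

lemma between_unique:
  assumes "x \<in> M" "y \<in> M" "p \<in> M" "q \<in> M" "between x p y" "between x q y" "d x p = d x q"
  shows "p = q"
proof -
  have "d q x - d x p = 0" "d q y - d p y = 0"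
    using assms commute[of q x] by (auto simp: between_def)
  then have "d q p = 0" using distance_to_segment_point[OF assms(1-5)] by simp
  then show ?thesis using assms by (metis zero)
qed

lemma between_split:
  assumes "x \<in> M" "y \<in> M" "z \<in> M" "p \<in> M" "between x p z"
  shows "between x p y \<or> between y p z"
proof -
  have "d y p = max (d y x - d x p) (d y z - d p z)"
    using distance_to_segment_point[of x z p y] assms by simp
  then show ?thesis
    using commute[of y x] commute[of p y] unfolding between_def
    by (cases "d y x - d x p \<le> d y z - d p z") (simp_all add: max_def)
qed

lemma between_sym: "between x p y \<longleftrightarrow> between y p x"
  by (auto simp: between_def commute)

end

text \<open>Let \<open>p\<close> and \<open>q\<close> be medians of \<open>w, x, z\<close> and of \<open>w, z, y\<close>. Both lie on the segment from \<open>w\<close> to \<open>z\<close>, and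
  the one closer to \<open>w\<close> lies on the segments from \<open>w\<close> to \<open>x\<close> and to \<open>y\<close> too; the path through this point
  bounds \<open>d x y\<close>.\<close>
lemma real_tree_imp_rtree:
  assumes tree: "real_tree m"
  shows "rtree (mspace m) (mdist m)"
proof -
  interpret Metric_space "mspace m" "mdist m" by simp
  let ?d = "mdist m" and ?M = "mspace m"
  have seg: "\<exists>p\<in>?M. ?d x p = t \<and> ?d p y = ?d x y - t"
    if "x \<in> ?M" "y \<in> ?M" "0 \<le> t" "t \<le> ?d x y" for x y t
  proof -
    obtain g where "geodesic_from_to m g x y" using real_tree_geodesic[OF tree \<open>x \<in> ?M\<close> \<open>y \<in> ?M\<close>] .
    then show ?thesis using geodesic_point[of m g x y t] that by auto
  qed
  have hyp: "?d x z \<le> ?d w x + ?d w z - 2 * ?d w p"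
    if w: "w \<in> ?M" and x: "x \<in> ?M" and y: "y \<in> ?M" and z: "z \<in> ?M" and p: "p \<in> ?M" and q: "q \<in> ?M"
      and wpx: "?d w p + ?d p x = ?d w x" and wpy: "?d w p + ?d p y = ?d w y"
      and wqy: "?d w q + ?d q y = ?d w y" and wqz: "?d w q + ?d q z = ?d w z"
      and le: "?d w p \<le> ?d w q" for w x y z p q
  proof -
    obtain r where r: "r \<in> ?M" "?d w r = ?d w p" "?d r q = ?d w q - ?d w p"
      using seg[OF w q, of "?d w p"] le nonneg[of w p] by auto
    have "?d r y \<le> ?d w y - ?d w p"
      using triangle[OF r(1) q y] r wqy by simp
    moreover have "?d w y \<le> ?d w r + ?d r y" using triangle[OF w r(1) y] .
    ultimately have "?d w r + ?d r y = ?d w y" using r(2) by simp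
    then have "p = r" using real_tree_point_unique[OF tree w y p wpy r(1)] r(2) by presburger
    then have "?d p z \<le> ?d w z - ?d w p" using triangle[OF p q z] r(3) wqz by simp
    then show ?thesis using triangle[OF x p z] wpx commute[of x p] by linarith
  qed
  have four: "?d x y + ?d z w \<le> max (?d x z + ?d y w) (?d x w + ?d y z)"
    if x: "x \<in> ?M" and y: "y \<in> ?M" and z: "z \<in> ?M" and w: "w \<in> ?M" for x y z w
  proof -
    obtain p where p: "p \<in> ?M" "?d w p + ?d p x = ?d w x" "?d x p + ?d p z = ?d x z"
        "?d w p + ?d p z = ?d w z"
      using real_tree_median[OF tree w x z] .
    obtain q where q: "q \<in> ?M" "?d w q + ?d q z = ?d w z" "?d z q + ?d q y = ?d z y"
        "?d w q + ?d q y = ?d w y"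
      using real_tree_median[OF tree w z y] .
    note c = commute[of x p] commute[of z q] commute[of z w] commute[of y w] commute[of x w]
      commute[of y z] commute[of x y]
    show ?thesis
    proof (cases "?d w p \<le> ?d w q")
      case True
      then have "?d x y \<le> ?d w x + ?d w y - 2 * ?d w p"
        using hyp[OF w x z y p(1) q(1)] p q by simp
      then show ?thesis using p q c by (simp add: max_def)
    next
      case False
      then have "?d y x \<le> ?d w y + ?d w x - 2 * ?d w q"
        using hyp[OF w y z x q(1) p(1)] p q by simp
      then show ?thesis using p q c by (simp add: max_def)
    qed
  qed
  show ?thesis by unfold_locales (use four seg in auto)
qed

text \<open>This turns minimality, a statement about subtrees, into a statement about convex subsets.\<close>
lemma convex_subset_real_tree:
  assumes tree: "real_tree m" and S: "S \<subseteq> mspace m" "S \<noteq> {}"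
    and convex: "\<And>x y p. \<lbrakk>x \<in> S; y \<in> S; p \<in> mspace m; mdist m x p + mdist m p y = mdist m x y\<rbrakk> \<Longrightarrow> p \<in> S"
  shows "real_tree (submetric m S)"
  unfolding real_tree_def
proof (intro conjI ballI)
  show "mspace (submetric m S) \<noteq> {}" using S by auto
  fix x y assume "x \<in> mspace (submetric m S)" "y \<in> mspace (submetric m S)"
  then have x: "x \<in> S" "x \<in> mspace m" and y: "y \<in> S" "y \<in> mspace m" by auto
  obtain g where g: "geodesic_from_to m g x y"
    and uniq: "\<forall>p. pathin (mtopology_of m) p \<and> inj_on p {0..1} \<and> p 0 = x \<and> p 1 = y
             \<longrightarrow> p ` {0..1} = g ` {0..mdist m x y}"
    using tree[unfolded real_tree_def, THEN conjunct2, THEN bspec, OF x(2), THEN bspec, OF y(2)]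
    by (elim exE conjE)
  have gS: "g t \<in> S" if "t \<in> {0..mdist m x y}" for t
    using convex[OF x(1) y(1)] geodesic_point[OF g that] by auto
  show "\<exists>\<gamma>. geodesic_from_to (submetric m S) \<gamma> x y \<and>
        (\<forall>p. pathin (mtopology_of (submetric m S)) p \<and> inj_on p {0..1} \<and> p 0 = x \<and> p 1 = y
             \<longrightarrow> p ` {0..1} = \<gamma> ` {0..mdist (submetric m S) x y})"
  proof (intro exI conjI allI impI)
    show "geodesic_from_to (submetric m S) g x y"
      using g gS unfolding geodesic_from_to_def by auto
    fix p assume p: "pathin (mtopology_of (submetric m S)) p \<and> inj_on p {0..1} \<and> p 0 = x \<and> p 1 = y"
    then have "pathin (mtopology_of m) p"
      by (simp add: mtopology_of_submetric pathin_subtopology)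
    then show "p ` {0..1} = g ` {0..mdist (submetric m S) x y}" using uniq p by simp
  qed
qed

section \<open>Translation lengths of free actions\<close>
locale free_tree_action = rtree M d + group G
  for M :: "'a set" and d :: "'a \<Rightarrow> 'a \<Rightarrow> real" and G :: "('g, 'm) monoid_scheme" (structure) +
  fixes a :: "'g \<Rightarrow> 'a \<Rightarrow> 'a"
  assumes a_closed [simp]: "\<lbrakk>g \<in> carrier G; x \<in> M\<rbrakk> \<Longrightarrow> a g x \<in> M"
    and a_mult: "\<lbrakk>g \<in> carrier G; h \<in> carrier G; x \<in> M\<rbrakk> \<Longrightarrow> a (g \<otimes> h) x = a g (a h x)"
    and a_one [simp]: "x \<in> M \<Longrightarrow> a \<one> x = x"
    and a_iso [simp]: "\<lbrakk>g \<in> carrier G; x \<in> M; y \<in> M\<rbrakk> \<Longrightarrow> d (a g x) (a g y) = d x y"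
    and a_free: "\<lbrakk>g \<in> carrier G; x \<in> M; a g x = x\<rbrakk> \<Longrightarrow> g = \<one>"
    and nonempty: "M \<noteq> {}"
begin

definition tlen :: "'g \<Rightarrow> real" where
  "tlen g = (INF x\<in>M. d x (a g x))"

lemma a_inv_cancel [simp]:
  assumes "g \<in> carrier G" "x \<in> M"
  shows "a g (a (inv g) x) = x" "a (inv g) (a g x) = x"
  using a_mult[of g "inv g" x] a_mult[of "inv g" g x] assms by simp_all

lemma dist_inv_left: "\<lbrakk>g \<in> carrier G; x \<in> M; y \<in> M\<rbrakk> \<Longrightarrow> d (a (inv g) x) y = d x (a g y)"
  using a_iso[of g "a (inv g) x" y] by simp

lemma dist_inv_right: "\<lbrakk>g \<in> carrier G; x \<in> M; y \<in> M\<rbrakk> \<Longrightarrow> d x (a (inv g) y) = d (a g x) y"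
  using a_iso[of g x "a (inv g) y"] by simp

lemma dist_inv_mult:
  "\<lbrakk>g \<in> carrier G; h \<in> carrier G; x \<in> M\<rbrakk> \<Longrightarrow> d x (a (inv g \<otimes> h) x) = d (a g x) (a h x)"
  by (simp add: a_mult dist_inv_right)

lemma dist_mult_le:
  assumes "g \<in> carrier G" "h \<in> carrier G" "x \<in> M"
  shows "d x (a (g \<otimes> h) x) \<le> d x (a g x) + d x (a h x)"
  using triangle[of x "a g x" "a g (a h x)"] assms by (simp add: a_mult)

lemma tlen_le: "x \<in> M \<Longrightarrow> tlen g \<le> d x (a g x)"
  unfolding tlen_def by (rule cINF_lower) (auto intro!: bdd_belowI[of _ 0])

lemma tlen_greatest: "(\<And>z. z \<in> M \<Longrightarrow> c \<le> d z (a g z)) \<Longrightarrow> c \<le> tlen g"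
  unfolding tlen_def using nonempty by (intro cINF_greatest) auto

lemma tlen_nonneg: "0 \<le> tlen g"
  by (rule tlen_greatest) simp

lemma tlen_approx:
  assumes "e > 0" obtains x where "x \<in> M" "d x (a g x) < tlen g + e"
  using tlen_greatest[of "tlen g + e" g] assms by (meson less_add_same_cancel1 not_le)

lemma pow_dist_le:
  assumes "g \<in> carrier G" "x \<in> M"
  shows "d x (a (g [^] n) x) \<le> real n * d x (a g x)"
proof (induction n)
  case 0 then show ?case using assms by simp
next
  case (Suc n)
  have "d x (a (g [^] Suc n) x) \<le> d x (a (g [^] n) x) + d x (a g x)"
    using dist_mult_le[of "g [^] n" g x] assms by simp
  then show ?case using Suc by (simp add: algebra_simps)
qed

text \<open>With \<open>D n = d x (g\<^sup>n x)\<close>, the four-point inequality for \<open>x\<close>, \<open>g x\<close>, \<open>g\<^sup>n x\<close>, \<open>g\<^sup>n\<^sup>+\<^sup>1 x\<close> bounds \<open>2 D n\<close> by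
  the maximum of \<open>2 D 1\<close> and \<open>D (n + 1) + D (n - 1)\<close>. Once \<open>D 2 > D 1\<close>, the first alternative never
  occurs, so the increments of \<open>D\<close> do not decrease.\<close>
lemma pow_dist_lower:
  assumes g: "g \<in> carrier G" and x: "x \<in> M" and lt: "d x (a g x) < d x (a (g \<otimes> g) x)"
  shows "d x (a g x) + real n * (d x (a (g \<otimes> g) x) - d x (a g x)) \<le> d x (a (g [^] Suc n) x)"
proof -
  define D where "D n = d x (a (g [^] n) x)" for n :: nat
  define t where "t = D 2 - D 1"
  have D12: "D 1 = d x (a g x)" "D 2 = d x (a (g \<otimes> g) x)"
    using g x by (simp_all add: D_def numeral_2_eq_2)
  have t: "t > 0" using lt unfolding t_def D12 by simp
  have rec: "2 * D (Suc n) \<le> max (2 * D 1) (D (Suc (Suc n)) + D n)" for n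
  proof -
    have shift: "a (g [^] Suc n) x = a g (a (g [^] n) x)" for n
      using g x by (metis a_mult nat_pow_Suc2 nat_pow_closed)
    have last: "a (g [^] Suc n) x = a (g [^] n) (a g x)" for n
      using g x by (simp add: a_mult)
    have "d x (a (g [^] Suc n) x) + d (a g x) (a (g [^] Suc (Suc n)) x)
      \<le> max (d x (a g x) + d (a (g [^] Suc n) x) (a (g [^] Suc (Suc n)) x))
            (d x (a (g [^] Suc (Suc n)) x) + d (a (g [^] Suc n) x) (a g x))"
      using g x by (intro four_point) auto
    moreover have "d (a g x) (a (g [^] Suc (Suc n)) x) = D (Suc n)"
      using g x unfolding D_def by (subst shift) simp
    moreover have "d (a (g [^] Suc n) x) (a (g [^] Suc (Suc n)) x) = D 1"
      using g x unfolding D12 by (subst (2) last) simp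
    moreover have "d (a (g [^] Suc n) x) (a g x) = D n"
      using g x unfolding D_def by (subst shift) (simp add: commute)
    ultimately show ?thesis unfolding D_def using g x by (simp add: commute)
  qed
  have "D (Suc (Suc n)) - D (Suc n) \<ge> t \<and> D (Suc n) \<ge> D 1" for n
  proof (induction n)
    case 0 then show ?case by (simp add: t_def numeral_2_eq_2)
  next
    case (Suc n)
    then have "D (Suc (Suc n)) > D 1" using t by simp
    then have "2 * D (Suc (Suc n)) \<le> D (Suc (Suc (Suc n))) + D (Suc n)"
      using rec[of "Suc n"] by (simp add: max_def split: if_splits)
    then show ?case using Suc t by simp
  qed
  then have inc: "D (Suc (Suc n)) \<ge> D (Suc n) + t" for n by (smt (verit))
  have "D 1 + real n * t \<le> D (Suc n)"
  proof (induction n)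
    case (Suc n) then show ?case using inc[of n] by (simp add: algebra_simps)
  qed simp
  then show ?thesis unfolding t_def D12 unfolding D_def .
qed

lemma tlen_ge_of_pow:
  assumes g: "g \<in> carrier G" and x: "x \<in> M"
    and low: "\<And>n. c * real n \<le> d x (a (g [^] n) x) + K"
  shows "c \<le> tlen g"
proof (rule tlen_greatest)
  fix z assume z: "z \<in> M"
  have bound: "(c - d z (a g z)) * real n \<le> 2 * d x z + K" for n
  proof -
    have "d x (a (g [^] n) x) \<le> d x z + d z (a (g [^] n) z) + d z x"
      using triangle[of x z "a (g [^] n) x"] triangle[of z "a (g [^] n) z" "a (g [^] n) x"] g x z
      by simp
    then show ?thesis using low[of n] pow_dist_le[OF g z, of n] commute[of x z]
      by (simp add: algebra_simps)
  qed
  show "c \<le> d z (a g z)"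
  proof (rule ccontr)
    assume "\<not> ?thesis"
    then have pos: "c - d z (a g z) > 0" by simp
    obtain n where "2 * d x z + K < real n * (c - d z (a g z))"
      using reals_Archimedean3[OF pos] by blast
    then show False using bound[of n] by (simp add: mult.commute)
  qed
qed

text \<open>A point whose orbit under \<open>g\<close> proceeds without backtracking lies on the axis of \<open>g\<close>.\<close>
lemma tlen_axis:
  assumes g: "g \<in> carrier G" and x: "x \<in> M" and dbl: "d x (a (g \<otimes> g) x) = 2 * d x (a g x)"
  shows "tlen g = d x (a g x)"
proof (cases "d x (a g x) = 0")
  case True then show ?thesis using tlen_le[OF x, of g] tlen_nonneg[of g] by simp
next
  case False
  then have lt: "d x (a g x) < d x (a (g \<otimes> g) x)" using dbl nonneg[of x "a g x"] by linarith
  have "d x (a g x) * real n \<le> d x (a (g [^] n) x) + 0" for n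
  proof (cases n)
    case (Suc k)
    then show ?thesis using pow_dist_lower[OF g x lt, of k] dbl by (simp add: algebra_simps)
  qed simp
  then have "d x (a g x) \<le> tlen g" by (rule tlen_ge_of_pow[OF g x])
  then show ?thesis using tlen_le[OF x, of g] by simp
qed

text \<open>The displacement of the point at distance \<open>s\<close> from \<open>x\<close> on the segment from \<open>x\<close> to \<open>g x\<close> is an explicit
  function of \<open>s\<close>, of \<open>D = d x (g x)\<close> and of \<open>E = d x (g\<^sup>2 x)\<close>. If \<open>E \<le> D\<close>, then the midpoint would be
  fixed. Otherwise the choice of \<open>s\<close> that removes the backtracking at \<open>g x\<close> gives the displacement \<open>E - D\<close>.\<close>
lemma hyperbolic:
  assumes g: "g \<in> carrier G" "g \<noteq> \<one>" and x: "x \<in> M"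
  shows "d x (a g x) < d x (a (g \<otimes> g) x)" "tlen g \<le> d x (a (g \<otimes> g) x) - d x (a g x)"
proof -
  define D E where "D = d x (a g x)" and "E = d x (a (g \<otimes> g) x)"
  have displ: "\<exists>p\<in>M. d p (a g p) = max (max (D - s) (E - D + s) - s) (2 * s - D)"
    if s: "0 \<le> s" "s \<le> D" for s
  proof -
    obtain p where p: "p \<in> M" "d x p = s" "d p (a g x) = D - s"
      using segment_point[of x "a g x" s] s g x by (auto simp: D_def)
    have b1: "between x p (a g x)" using p by (simp add: between_def D_def)
    have b2: "between (a g x) (a g p) (a (g \<otimes> g) x)"
      using p g x by (simp add: between_def D_def a_mult)
    have 1: "d x (a g p) = max (D - s) (E - (D - s))"
      using distance_to_segment_point[OF _ _ _ x b2] p g x by (simp add: a_mult D_def E_def)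
    have 2: "d (a g p) p = max (d (a g p) x - s) (s - (D - s))"
      using distance_to_segment_point[OF _ _ _ _ b1, of "a g p"] p g x by (simp add: commute)
    show ?thesis
      by (rule bexI[OF _ p(1)]) (use 1 2 in \<open>simp add: commute algebra_simps\<close>)
  qed
  have D0: "D > 0" using g x a_free[of g x] by (auto simp: D_def)
  have E2: "E \<le> 2 * D" using dist_mult_le[of g g x] g x by (simp add: D_def E_def)
  show lt: "d x (a g x) < d x (a (g \<otimes> g) x)"
  proof (rule ccontr)
    assume "\<not> ?thesis"
    then have ED: "E \<le> D" by (simp add: D_def E_def)
    obtain p where p: "p \<in> M" "d p (a g p) = max (max (D - D/2) (E - D + D/2) - D/2) (2 * (D/2) - D)"
      using displ[of "D/2"] D0 by auto
    then have "d p (a g p) = 0" using ED by (simp add: max_def split: if_splits)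
    then have "a g p = p" using p g by (metis zero a_closed)
    then show False using a_free p g by blast
  qed
  \<comment> \<open>\<open>D - E/2\<close> is the Gromov product of \<open>g\<^sup>-\<^sup>1 x\<close> and \<open>g x\<close> at \<open>x\<close>, the length of the backtracking\<close>
  obtain p where p: "p \<in> M" "d p (a g p) = max (max (D - (D - E/2)) (E - D + (D - E/2)) - (D-E/2)) (2 * (D - E/2) - D)"
    using displ[of "D - E/2"] D0 E2 lt nonneg[of x "a (g \<otimes> g) x"] by (auto simp: E_def)
  then have "d p (a g p) = E - D"
    using lt by (simp add: D_def E_def max_def split: if_splits)
  then show "tlen g \<le> d x (a (g \<otimes> g) x) - d x (a g x)" using tlen_le[OF p(1), of g] by (simp add: D_def E_def)
qed

lemma tlen_pow_le:
  assumes g: "g \<in> carrier G" and x: "x \<in> M"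
  shows "real n * tlen g \<le> d x (a (g [^] n) x)"
proof (cases "g = \<one> \<or> n = 0")
  case True
  then show ?thesis using tlen_le[OF x, of \<one>] x tlen_nonneg[of \<one>] by auto
next
  case False
  then obtain k where n: "n = Suc k" by (cases n) auto
  have g1: "g \<noteq> \<one>" using False by simp
  have "real k * tlen g \<le> real k * (d x (a (g \<otimes> g) x) - d x (a g x))"
    using hyperbolic(2)[OF g g1 x] by (intro mult_left_mono) auto
  then show ?thesis
    using pow_dist_lower[OF g x hyperbolic(1)[OF g g1 x], of k] tlen_le[OF x, of g]
    by (simp add: n algebra_simps)
qed

lemma tlen_pos:
  assumes g: "g \<in> carrier G" "g \<noteq> \<one>"
  shows "0 < tlen g"
proof -
  obtain x where x: "x \<in> M" using nonempty by blast
  define c where "c = d x (a (g \<otimes> g) x) - d x (a g x)"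
  have c: "c > 0" using hyperbolic(1)[OF g x] by (simp add: c_def)
  have "c * real n \<le> d x (a (g [^] n) x) + c" for n
  proof (cases n)
    case (Suc k)
    then show ?thesis
      using pow_dist_lower[OF g(1) x hyperbolic(1)[OF g x], of k] nonneg[of x "a g x"]
      unfolding Suc c_def[symmetric] by (simp add: algebra_simps del: nonneg)
  qed (use c in simp)
  then have "c \<le> tlen g" by (rule tlen_ge_of_pow[OF g(1) x])
  then show ?thesis using c by simp
qed

text \<open>The error \<open>e\<close> avoids the question whether the infimum of the displacements is attained.\<close>
lemma pow_dist_upper:
  assumes g: "g \<in> carrier G" and x: "x \<in> M" and e: "e > 0"
  obtains K where "\<And>n. d x (a (g [^] n) x) \<le> real n * (tlen g + e) + K"
proof -
  obtain z where z: "z \<in> M" "d z (a g z) < tlen g + e" using tlen_approx[OF e] .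
  have "d x (a (g [^] n) x) \<le> real n * (tlen g + e) + 2 * d x z" for n
  proof -
    have "d x (a (g [^] n) x) \<le> d x z + d z (a (g [^] n) z) + d z x"
      using triangle[of x z "a (g [^] n) x"] triangle[of z "a (g [^] n) z" "a (g [^] n) x"] g x z
      by simp
    moreover have "real n * d z (a g z) \<le> real n * (tlen g + e)" using z by (intro mult_left_mono) auto
    ultimately show ?thesis using pow_dist_le[OF g z(1), of n] commute[of x z] by simp
  qed
  then show ?thesis by (rule that)
qed

end

section \<open>Reduced words\<close>
definition inverse_letter :: "bool \<times> 'g \<Rightarrow> bool \<times> 'g" where
  "inverse_letter l = (\<not> fst l, snd l)"

definition inverse_word :: "(bool \<times> 'g) list \<Rightarrow> (bool \<times> 'g) list" where
  "inverse_word w = map inverse_letter (rev w)"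

definition reduced_words :: "'g set \<Rightarrow> (bool \<times> 'g) list set" where
  "reduced_words X = {w \<in> lists (UNIV \<times> X). reduced_word w}"

lemma reduced_word_alt: "reduced_word w \<longleftrightarrow> successively (\<lambda>l l'. l' \<noteq> inverse_letter l) w"
proof -
  have "(\<lambda>l l' :: bool \<times> 'a. \<not> (snd l = snd l' \<and> fst l \<noteq> fst l')) = (\<lambda>l l'. l' \<noteq> inverse_letter l)"
    by (intro ext) (auto simp: inverse_letter_def)
  then show ?thesis unfolding reduced_word_def by (rule arg_cong)
qed

lemma reduced_words_append:
  "u @ v \<in> reduced_words X \<longleftrightarrow> u \<in> reduced_words X \<and> v \<in> reduced_words X \<and>
     (u = [] \<or> v = [] \<or> hd v \<noteq> inverse_letter (last u))"
  by (auto simp: reduced_words_def reduced_word_alt successively_append_iff)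

lemma reduced_words_infix:
  "u @ v @ w \<in> reduced_words X \<Longrightarrow> v \<in> reduced_words X"
  by (simp add: reduced_words_append)

lemma Nil_in_reduced_words [simp]: "[] \<in> reduced_words X"
  by (simp add: reduced_words_def reduced_word_alt)

lemma singleton_in_reduced_words [simp]: "[l] \<in> reduced_words X \<longleftrightarrow> snd l \<in> X"
  by (cases l) (auto simp: reduced_words_def reduced_word_alt)

lemma inverse_letter_inverse [simp]: "inverse_letter (inverse_letter l) = l"
  by (simp add: inverse_letter_def)

lemma snd_inverse_letter [simp]: "snd (inverse_letter l) = snd l"
  by (simp add: inverse_letter_def)

lemma inverse_letter_eq_iff: "inverse_letter l = l' \<longleftrightarrow> l = inverse_letter l'"
  by (auto simp: inverse_letter_def prod_eq_iff)

lemma inverse_word_append: "inverse_word (u @ v) = inverse_word v @ inverse_word u"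
  by (simp add: inverse_word_def)

lemma inverse_word_inverse [simp]: "inverse_word (inverse_word w) = w"
  by (induction w) (auto simp: inverse_word_def)

lemma inverse_word_lists: "w \<in> lists (UNIV \<times> X) \<Longrightarrow> inverse_word w \<in> lists (UNIV \<times> X)"
  by (fastforce simp: inverse_word_def inverse_letter_def)

lemma (in group)
  assumes X: "X \<subseteq> carrier G"
  shows letter_value_closed: "l \<in> UNIV \<times> X \<Longrightarrow> letter_value G l \<in> carrier G"
    and letter_value_inverse: "l \<in> UNIV \<times> X \<Longrightarrow> letter_value G (inverse_letter l) = inv (letter_value G l)"
    and word_value_closed: "w \<in> lists (UNIV \<times> X) \<Longrightarrow> word_value G w \<in> carrier G"
    and word_value_append: "u \<in> lists (UNIV \<times> X) \<Longrightarrow> v \<in> lists (UNIV \<times> X)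
       \<Longrightarrow> word_value G (u @ v) = word_value G u \<otimes> word_value G v"
    and word_value_inverse: "w \<in> lists (UNIV \<times> X) \<Longrightarrow> word_value G (inverse_word w) = inv (word_value G w)"
proof -
  show l: "letter_value G l \<in> carrier G" if "l \<in> UNIV \<times> X" for l
    using that X by (auto simp: letter_value_def)
  show li: "letter_value G (inverse_letter l) = inv (letter_value G l)" if "l \<in> UNIV \<times> X" for l
    using that X by (auto simp: letter_value_def inverse_letter_def)
  show c: "word_value G w \<in> carrier G" if "w \<in> lists (UNIV \<times> X)" for w
    using that by (induction w) (auto simp: word_value_def intro!: m_closed l)
  show app: "word_value G (u @ v) = word_value G u \<otimes> word_value G v"
    if "u \<in> lists (UNIV \<times> X)" "v \<in> lists (UNIV \<times> X)" for u v
    using that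
  proof (induction u)
    case Nil then show ?case using c[of v] by (simp add: word_value_def)
  next
    case (Cons p u)
    have "word_value G (p # w) = letter_value G p \<otimes> word_value G w" for w
      by (simp add: word_value_def)
    then show ?case using Cons c[of u] c[of v] l[of p] by (simp add: m_assoc)
  qed
  show "word_value G (inverse_word w) = inv (word_value G w)" if "w \<in> lists (UNIV \<times> X)" for w
    using that
  proof (induction w)
    case Nil then show ?case by (simp add: word_value_def inverse_word_def)
  next
    case (Cons p w)
    have "word_value G (inverse_word (p # w)) = word_value G (inverse_word w @ [inverse_letter p])"
      by (simp add: inverse_word_def)
    also have "\<dots> = word_value G (inverse_word w) \<otimes> word_value G [inverse_letter p]"
      using Cons by (intro app inverse_word_lists) (auto simp: inverse_letter_def)
    also have "\<dots> = inv (word_value G w) \<otimes> inv (letter_value G p)"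
      using Cons l[of p] li[of p] by (simp add: word_value_def)
    also have "\<dots> = inv (letter_value G p \<otimes> word_value G w)"
      using Cons l[of p] c[of w] by (simp add: inv_mult_group)
    finally show ?case by (simp add: word_value_def)
  qed
qed

context rtree begin

lemma between_trans:
  assumes "x \<in> M" "r \<in> M" "p \<in> M" "y \<in> M" "between x r p" "between x p y"
  shows "between x r y"
  using triangle[of r p y] triangle[of x r y] assms unfolding between_def by simp

lemma dist_on_segment:
  assumes "x \<in> M" "y \<in> M" "p \<in> M" "q \<in> M" "between x p y" "between x q y"
  shows "d p q = \<bar>d x p - d x q\<bar>"
  using distance_to_segment_point[of x y p q] assms commute[of q x] commute[of q p]
  unfolding between_def by simp

text \<open>Compactness of segments, in the form of a finite cover by balls of prescribed radii \<open>\<rho> p\<close>.\<close>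
lemma segment_cover:
  assumes y: "y \<in> M" and z: "z \<in> M" and pos: "\<And>p. p \<in> M \<Longrightarrow> between y p z \<Longrightarrow> 0 < \<rho> p"
  shows "\<exists>E. finite E \<and> E \<subseteq> {p \<in> M. between y p z} \<and>
           (\<forall>p\<in>M. between y p z \<longrightarrow> (\<exists>e\<in>E. d p e < \<rho> e))"
proof -
  define D where "D = d y z"
  have "\<forall>t\<in>{0..D}. \<exists>p. p \<in> M \<and> d y p = t \<and> d p z = D - t"
    using segment_point[OF y z] unfolding D_def by force
  then obtain c where c: "\<And>t. t \<in> {0..D} \<Longrightarrow> c t \<in> M \<and> d y (c t) = t \<and> d (c t) z = D - t"
    by metis
  have cb: "between y (c t) z" if "t \<in> {0..D}" for t
    using c[OF that] by (simp add: between_def D_def)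
  have "compact {0..D}" by simp
  moreover have "{0..D} \<subseteq> (\<Union>t\<in>{0..D}. ball t (\<rho> (c t)))"
    using pos c cb by auto
  ultimately obtain C where C: "C \<subseteq> {0..D}" "finite C" "{0..D} \<subseteq> (\<Union>t\<in>C. ball t (\<rho> (c t)))"
    by (elim compactE_image) auto
  show ?thesis
  proof (intro exI[of _ "c ` C"] conjI ballI impI)
    show "finite (c ` C)" using C by simp
    show "c ` C \<subseteq> {p \<in> M. between y p z}" using C c cb by auto
    fix p assume p: "p \<in> M" "between y p z"
    then have "d y p \<in> {0..D}" using nonneg[of p z] nonneg[of y p]
      unfolding between_def D_def atLeastAtMost_iff by linarith
    then obtain t where t: "t \<in> C" "d y p \<in> ball t (\<rho> (c t))" using C(3) by blast
    have tD: "t \<in> {0..D}" using t C by auto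
    have "d p (c t) = \<bar>d y p - t\<bar>"
      using dist_on_segment[OF y z p(1) _ p(2) cb[OF tD]] c[OF tD] by simp
    then have "d p (c t) < \<rho> (c t)" using t by (simp add: dist_real_def)
    then show "\<exists>e\<in>c ` C. d p e < \<rho> e" using t by blast
  qed
qed

end

lemma (in free_tree_action) between_act:
  "\<lbrakk>g \<in> carrier G; x \<in> M; p \<in> M; y \<in> M\<rbrakk> \<Longrightarrow> between (a g x) (a g p) (a g y) \<longleftrightarrow> between x p y"
  by (simp add: between_def)

section \<open>Minimal discrete actions of free groups\<close>

text \<open>Minimality is stated for convex subsets, and discreteness as the isolation of every point in its
  orbit with a radius that may depend on the point.\<close>
locale free_group_action = free_tree_action M d G a
  for M :: "'a set" and d and G :: "('g, 'm) monoid_scheme" (structure) and a +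
  fixes X :: "'g set"
  assumes basis: "free_basis G X" and finite_basis: "finite X" and basis_card: "card X \<ge> 2"
    and minimal: "\<lbrakk>S \<subseteq> M; S \<noteq> {}; \<And>x y p. \<lbrakk>x \<in> S; y \<in> S; p \<in> M; between x p y\<rbrakk> \<Longrightarrow> p \<in> S;
        \<And>g. g \<in> carrier G \<Longrightarrow> a g ` S \<subseteq> S\<rbrakk> \<Longrightarrow> S = M"
    and discrete: "x \<in> M \<Longrightarrow> \<exists>r>0. \<forall>g\<in>carrier G. g \<noteq> \<one> \<longrightarrow> r \<le> d x (a g x)"
begin

abbreviation "val \<equiv> word_value G"

definition len :: "'a \<Rightarrow> (bool \<times> 'g) list \<Rightarrow> real" where
  "len x w = d x (a (val w) x)"

lemma X_carrier: "X \<subseteq> carrier G" using basis by (simp add: free_basis_def)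

lemma val_bij: "bij_betw val (reduced_words X) (carrier G)"
  using basis by (simp add: free_basis_def reduced_words_def)

lemma reduced_words_lists: "w \<in> reduced_words X \<Longrightarrow> w \<in> lists (UNIV \<times> X)"
  by (simp add: reduced_words_def)

lemmas letter_closed = letter_value_closed[OF X_carrier]
lemmas val_closed [simp] = word_value_closed[OF X_carrier]
lemmas val_append = word_value_append[OF X_carrier]
lemmas val_inverse = word_value_inverse[OF X_carrier]

lemma val_surj:
  assumes "g \<in> carrier G" obtains w where "w \<in> reduced_words X" "val w = g"
proof -
  have "g \<in> val ` reduced_words X" using val_bij assms by (simp add: bij_betw_def)
  then show ?thesis using that by auto
qed

lemma val_Nil [simp]: "val [] = \<one>" by (simp add: word_value_def)

lemma val_singleton: "l \<in> UNIV \<times> X \<Longrightarrow> val [l] = letter_value G l"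
  using letter_closed[of l] by (simp add: word_value_def)

text \<open>The union of the segments from \<open>x\<close> to the points of its orbit is convex, because a segment between
  two points is covered by the segments from these points to \<open>x\<close>, and invariant for the same reason.
  By minimality it is the whole tree.\<close>
lemma orbit_star_covers:
  assumes x: "x \<in> M" and p: "p \<in> M"
  shows "\<exists>g\<in>carrier G. between x p (a g x)"
proof -
  define S where "S = {p \<in> M. \<exists>g\<in>carrier G. between x p (a g x)}"
  have "S = M"
  proof (rule minimal)
    show "S \<subseteq> M" by (auto simp: S_def)
    have "x \<in> S" using x by (auto simp: S_def between_def intro!: bexI[of _ \<one>])
    then show "S \<noteq> {}" by auto
    show "r \<in> S" if pq: "p \<in> S" "q \<in> S" "r \<in> M" "between p r q" for p q r
    proof -
      obtain g h where g: "g \<in> carrier G" "between x p (a g x)" and h: "h \<in> carrier G" "between x q (a h x)"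
        and M: "p \<in> M" "q \<in> M"
        using pq by (auto simp: S_def)
      consider "between p r x" | "between x r q"
        using between_split[of p x q r] M x pq by auto
      then show ?thesis
      proof cases
        case 1
        then have "between x r p" by (simp add: between_sym)
        then have "between x r (a g x)" using between_trans[of x r p "a g x"] x M pq g by simp
        then show ?thesis using g pq by (auto simp: S_def)
      next
        case 2
        then have "between x r (a h x)" using between_trans[of x r q "a h x"] x M pq h by simp
        then show ?thesis using h pq by (auto simp: S_def)
      qed
    qed
    show "a h ` S \<subseteq> S" if h: "h \<in> carrier G" for h
    proof
      fix q assume "q \<in> a h ` S"
      then obtain p g where p: "p \<in> M" "q = a h p" and g: "g \<in> carrier G" "between x p (a g x)"
        by (auto simp: S_def)
      have "between (a h x) q (a (h \<otimes> g) x)"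
        using g p x h by (simp add: between_def a_mult)
      then have "between x q (a h x) \<or> between x q (a (h \<otimes> g) x)"
        using between_split[of "a h x" x "a (h \<otimes> g) x" q] h g x p by (auto simp: between_sym)
      then show "q \<in> S" using h g p by (auto simp: S_def)
    qed
  qed
  then show ?thesis using p by (auto simp: S_def)
qed

text \<open>In a tree the segment from \<open>x\<close> to \<open>val w x\<close> is covered by the path that applies the letters
  of \<open>w\<close> one after the other.\<close>
lemma between_letter:
  assumes w: "w \<in> lists (UNIV \<times> X)" "w \<noteq> []" and x: "x \<in> M" and p: "p \<in> M"
    and "between x p (a (val w) x)"
  shows "\<exists>u l v. w = u @ l # v \<and> between (a (val u) x) p (a (val (u @ [l])) x)"
  using w p assms(5)
proof (induction w arbitrary: p)
  case (Cons l w)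
  then have l: "l \<in> UNIV \<times> X" and wl: "w \<in> lists (UNIV \<times> X)" by auto
  define g where "g = letter_value G l"
  have g: "g \<in> carrier G" using letter_closed[OF l] by (simp add: g_def)
  have val: "val (l # v) = g \<otimes> val v" for v by (simp add: word_value_def g_def)
  have first: "?case" if "between x p (a g x)"
    using that x g by (intro exI[of _ "[]"] exI[of _ l] exI[of _ w]) (simp add: val)
  show ?case
  proof (cases "between x p (a g x)")
    case True then show ?thesis by (rule first)
  next
    case False
    then have b: "between (a g x) p (a (val (l # w)) x)"
      using between_split[of x "a g x" "a (val (l # w)) x" p] x g Cons.prems l wl by simp
    have wn: "w \<noteq> []"
    proof
      assume "w = []"
      then have "between x p (a g x)" using Cons.prems(3) val[of "[]"] g by simp
      then show False using False by simp
    qed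
    define p0 where "p0 = a (inv g) p"
    have p0: "p0 \<in> M" "p = a g p0" using g Cons.prems by (auto simp: p0_def)
    have val_l: "a (val (l # v)) x = a g (a (val v) x)" if "v \<in> lists (UNIV \<times> X)" for v
      using that g x by (simp add: val a_mult)
    have "between x p0 (a (val w) x)"
      using b between_act[OF g x p0(1), of "a (val w) x"] x wl by (simp add: p0(2) val_l)
    then obtain u l' v where w: "w = u @ l' # v"
      and b': "between (a (val u) x) p0 (a (val (u @ [l'])) x)"
      using Cons.IH[OF wn p0(1)] by auto
    have ul: "u \<in> lists (UNIV \<times> X)" "u @ [l'] \<in> lists (UNIV \<times> X)" using wl w by auto
    have "between (a (val (l # u)) x) p (a (val (l # u @ [l'])) x)"
      unfolding val_l[OF ul(1)] val_l[OF ul(2)] p0(2)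
      using b' g x p0(1) by (subst between_act) (simp_all add: val_closed[OF ul(1)] val_closed[OF ul(2)])
    then show ?thesis using w by (intro exI[of _ "l # u"] exI[of _ l'] exI[of _ v]) simp
  qed
qed simp

text \<open>The segments from \<open>x\<close> to its images under the letters form a compact set \<open>K\<close> whose translates cover the
  tree. Compactness makes the isolation radius of orbits uniform on \<open>K\<close>, and a sufficiently fine net of \<open>K\<close>
  then shows that only finitely many group elements move \<open>K\<close> to within \<open>\<epsilon>\<close> of itself. Points at distance
  at most \<open>n \<epsilon>\<close> from \<open>x\<close> are reached by \<open>n\<close> such moves.\<close>
lemma finite_orbit_ball:
  assumes x: "x \<in> M"
  shows "finite {g \<in> carrier G. d x (a g x) \<le> R}"
proof -
  define K where "K = {p \<in> M. \<exists>l\<in>UNIV \<times> X. between x p (a (letter_value G l) x)}"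
  obtain e where e: "e \<in> X" using basis_card by (metis card.empty ex_in_conv not_numeral_le_zero)
  have xK: "x \<in> K" using x e letter_closed[of "(True, e)"] by (auto simp: K_def between_def)
  have KM: "K \<subseteq> M" by (auto simp: K_def)
  have cover: "\<exists>h\<in>carrier G. \<exists>q\<in>K. p = a h q" if p: "p \<in> M" for p
  proof -
    obtain g where g: "g \<in> carrier G" "between x p (a g x)" using orbit_star_covers[OF x p] by auto
    obtain w where w: "w \<in> reduced_words X" "val w = g" using val_surj g by metis
    show ?thesis
    proof (cases "w = []")
      case True
      then have "g = \<one>" using w by simp
      then have "d x p = 0" using g(2) x p commute[of p x] by (simp add: between_def)
      then have "p = x" using zero[OF x p] by simp
      then show ?thesis using xK x by (intro bexI[of _ \<one>] bexI[of _ x]) auto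
    next
      case False
      then obtain u l v where u: "w = u @ l # v" "between (a (val u) x) p (a (val (u @ [l])) x)"
        using between_letter[OF _ False x p] g w reduced_words_lists by metis
      then have ul: "u \<in> lists (UNIV \<times> X)" "l \<in> UNIV \<times> X" using reduced_words_lists[OF w(1)] by auto
      define h where "h = val u"
      have h: "h \<in> carrier G" using ul by (simp add: h_def)
      have lc: "letter_value G l \<in> carrier G" using letter_closed ul by simp
      have "val (u @ [l]) = h \<otimes> letter_value G l"
        using ul val_append[of u "[l]"] val_singleton[of l] by (simp add: h_def)
      then have "between x (a (inv h) p) (a (letter_value G l) x)"
        using u(2) h lc x p by (simp add: between_def h_def[symmetric] dist_inv_right dist_inv_left a_mult)
      then have "a (inv h) p \<in> K" using ul h p unfolding K_def by auto
      then show ?thesis using h p by (intro bexI[of _ h] bexI[of _ "a (inv h) p"]) auto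
    qed
  qed
  have net: "\<exists>E. finite E \<and> E \<subseteq> K \<and> (\<forall>p\<in>K. \<exists>e\<in>E. d p e < \<rho> e)"
    if pos: "\<And>p. p \<in> M \<Longrightarrow> 0 < \<rho> p" for \<rho>
  proof -
    have "\<forall>l\<in>UNIV \<times> X. \<exists>E. finite E \<and> E \<subseteq> {p \<in> M. between x p (a (letter_value G l) x)} \<and>
           (\<forall>p\<in>M. between x p (a (letter_value G l) x) \<longrightarrow> (\<exists>e\<in>E. d p e < \<rho> e))"
      using segment_cover[of x _ \<rho>] pos x letter_closed by auto
    then obtain E where "\<forall>l\<in>UNIV \<times> X. finite (E l) \<and> E l \<subseteq> {p \<in> M. between x p (a (letter_value G l) x)} \<and>
           (\<forall>p\<in>M. between x p (a (letter_value G l) x) \<longrightarrow> (\<exists>e\<in>E l. d p e < \<rho> e))"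
      by (elim bchoice[THEN exE])
    note E = this[rule_format]
    show ?thesis
    proof (intro exI[of _ "\<Union>l\<in>UNIV \<times> X. E l"] conjI ballI)
      show "finite (\<Union>l\<in>UNIV \<times> X. E l)" using E finite_basis by (intro finite_UN_I) auto
      show "(\<Union>l\<in>UNIV \<times> X. E l) \<subseteq> K" using E unfolding K_def by blast
      fix p assume "p \<in> K"
      then obtain l where "l \<in> UNIV \<times> X" "p \<in> M" "between x p (a (letter_value G l) x)" by (auto simp: K_def)
      then obtain e where "e \<in> E l" "d p e < \<rho> e" using E[of l] by blast
      with \<open>l \<in> UNIV \<times> X\<close> show "\<exists>e\<in>\<Union>l\<in>UNIV \<times> X. E l. d p e < \<rho> e" by (intro bexI[of _ e] UN_I)
    qed
  qed
  obtain r where r: "\<And>p. p \<in> M \<Longrightarrow> r p > 0" "\<And>p g. \<lbrakk>p \<in> M; g \<in> carrier G; g \<noteq> \<one>\<rbrakk> \<Longrightarrow> r p \<le> d p (a g p)"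
    using discrete by metis
  obtain E where E: "finite E" "E \<subseteq> K" "\<And>p. p \<in> K \<Longrightarrow> \<exists>e\<in>E. d p e < r e / 4"
    using net[of "\<lambda>p. r p / 4"] r(1) by auto
  \<comment> \<open>passing from a point of the net to a point within \<open>r e / 4\<close> costs half of the radius\<close>
  define r0 where "r0 = Min (r ` E) / 2"
  have En: "E \<noteq> {}" using E(3)[OF xK] by auto
  have r0: "r0 > 0" using E r(1) En KM by (auto simp: r0_def)
  have sep: "r0 \<le> d p (a g p)" if p: "p \<in> K" and g: "g \<in> carrier G" "g \<noteq> \<one>" for p g
  proof -
    obtain e where e: "e \<in> E" "d p e < r e / 4" using E(3)[OF p] by auto
    have eM: "e \<in> M" "p \<in> M" using e E KM p by auto
    have "r e \<le> d e (a g e)" using r(2) eM g by auto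
    also have "\<dots> \<le> d e p + d p (a g p) + d p e"
      using triangle[of e p "a g e"] triangle[of p "a g p" "a g e"] eM g by simp
    finally have "r e / 2 \<le> d p (a g p)" using e commute[of e p] by simp
    moreover have "r0 \<le> r e / 2" using e E by (simp add: r0_def)
    ultimately show ?thesis by simp
  qed
  \<comment> \<open>elements with the same pair of net points move a point of \<open>K\<close> to points less than \<open>6 \<epsilon> < r0\<close> apart\<close>
  define \<epsilon> where "\<epsilon> = r0 / 8"
  have \<epsilon>: "\<epsilon> > 0" using r0 by (simp add: \<epsilon>_def)
  obtain N where N: "finite N" "N \<subseteq> K" "\<And>p. p \<in> K \<Longrightarrow> \<exists>e\<in>N. d p e < \<epsilon>"
    using net[of "\<lambda>p. \<epsilon>"] \<epsilon> by auto
  define S where "S = {g \<in> carrier G. \<exists>p\<in>K. \<exists>q\<in>K. d (a g p) q \<le> \<epsilon>}"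
  have "\<forall>g\<in>S. \<exists>c. c \<in> N \<times> N \<and> d (a g (fst c)) (snd c) < 3 * \<epsilon>"
  proof
    fix g assume "g \<in> S"
    then obtain p q where g: "g \<in> carrier G" and pq: "p \<in> K" "q \<in> K" "d (a g p) q \<le> \<epsilon>" by (auto simp: S_def)
    obtain e f where ef: "e \<in> N" "d p e < \<epsilon>" "f \<in> N" "d q f < \<epsilon>" using N(3) pq by metis
    have M: "p \<in> M" "q \<in> M" "e \<in> M" "f \<in> M" using pq ef N KM by auto
    have "d (a g e) f \<le> d (a g e) (a g p) + d (a g p) q + d q f"
      using triangle[of "a g e" "a g p" f] triangle[of "a g p" q f] M g by simp
    also have "\<dots> < 3 * \<epsilon>" using ef pq M g by (simp add: commute)
    finally show "\<exists>c. c \<in> N \<times> N \<and> d (a g (fst c)) (snd c) < 3 * \<epsilon>"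
      using ef by (intro exI[of _ "(e, f)"]) simp
  qed
  then obtain c where c: "\<And>g. g \<in> S \<Longrightarrow> c g \<in> N \<times> N \<and> d (a g (fst (c g))) (snd (c g)) < 3 * \<epsilon>" by metis
  have "inj_on c S"
  proof (rule inj_onI)
    fix g h assume gh: "g \<in> S" "h \<in> S" "c g = c h"
    obtain e f where ef: "c g = (e, f)" by (cases "c g")
    have G: "g \<in> carrier G" "h \<in> carrier G" using gh by (auto simp: S_def)
    have M: "e \<in> M" "f \<in> M" "e \<in> K" using c[OF gh(1)] ef N KM by auto
    have "d (a g e) f < 3 * \<epsilon>" "d (a h e) f < 3 * \<epsilon>" using c[OF gh(1)] c[OF gh(2)] gh(3) ef by auto
    then have "d (a g e) (a h e) < r0"
      using triangle[of "a g e" f "a h e"] M G commute[of f "a h e"] r0 by (simp add: \<epsilon>_def)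
    then have "d e (a (inv g \<otimes> h) e) < r0" using M G by (simp add: dist_inv_mult)
    then have "inv g \<otimes> h = \<one>" using sep[OF M(3), of "inv g \<otimes> h"] G by fastforce
    then show "g = h" using G by (metis inv_closed inv_equality inv_inv)
  qed
  moreover have "c ` S \<subseteq> N \<times> N" using c by (intro image_subsetI) blast
  ultimately have finS: "finite S" using N(1) by (meson finite_SigmaI finite_imageD finite_subset)
  define Q where "Q n = {h \<in> carrier G. \<exists>p\<in>K. d x (a h p) \<le> real n * \<epsilon>}" for n
  have finQ: "finite (Q n)" for n
  proof (induction n)
    case 0
    have "Q 0 \<subseteq> S"
    proof
      fix h assume "h \<in> Q 0"
      then obtain p where h: "h \<in> carrier G" "p \<in> K" "d x (a h p) \<le> 0" by (auto simp: Q_def)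
      then have "d (a h p) x \<le> \<epsilon>" using \<epsilon> commute[of x "a h p"] by linarith
      then show "h \<in> S" using xK h unfolding S_def by blast
    qed
    then show ?case using finS finite_subset by blast
  next
    case (Suc n)
    have "Q (Suc n) \<subseteq> (\<lambda>(h, k). h \<otimes> k) ` (Q n \<times> S)"
    proof
      fix h assume "h \<in> Q (Suc n)"
      then obtain p where h: "h \<in> carrier G" and p: "p \<in> K" "p \<in> M" "d x (a h p) \<le> real (Suc n) * \<epsilon>"
        using KM by (auto simp: Q_def)
      define t where "t = d x (a h p)"
      define s where "s = max (t - \<epsilon>) 0"
      obtain q where q: "q \<in> M" "d x q = s" "d q (a h p) = t - s"
        using segment_point[of x "a h p" s] x h p \<epsilon> by (auto simp: t_def s_def)
      have qn: "d x q \<le> real n * \<epsilon>" using p q \<epsilon> by (auto simp: s_def t_def algebra_simps)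
      have qe: "d q (a h p) \<le> \<epsilon>" using q by (auto simp: s_def)
      obtain h' p' where h': "h' \<in> carrier G" "p' \<in> K" "q = a h' p'" using cover[OF q(1)] by auto
      have p'M: "p' \<in> M" using h' KM by auto
      have "h' \<in> Q n" using h' qn by (auto simp: Q_def)
      moreover have "inv h' \<otimes> h \<in> S"
      proof -
        have "d (a (inv h' \<otimes> h) p) p' = d (a h p) q"
          using h h' p p'M by (simp add: a_mult dist_inv_left)
        then show ?thesis using qe h h' p commute[of q "a h p"] unfolding S_def by force
      qed
      moreover have "h = h' \<otimes> (inv h' \<otimes> h)" using h h' by (simp add: m_assoc[symmetric])
      ultimately show "h \<in> (\<lambda>(h, k). h \<otimes> k) ` (Q n \<times> S)" by force
    qed
    then show ?case using Suc finS by (meson finite_SigmaI finite_imageI finite_subset)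
  qed
  obtain n where n: "R < real n * \<epsilon>" using reals_Archimedean3[OF \<epsilon>] by blast
  have "{g \<in> carrier G. d x (a g x) \<le> R} \<subseteq> Q n" using xK n by (force simp: Q_def)
  then show ?thesis using finQ finite_subset by blast
qed

lemma finite_len_ball:
  assumes x: "x \<in> M"
  shows "finite {w \<in> reduced_words X. len x w \<le> R}"
proof (rule finite_imageD)
  have "val ` {w \<in> reduced_words X. len x w \<le> R} \<subseteq> {g \<in> carrier G. d x (a g x) \<le> R}"
    using val_bij by (auto simp: len_def bij_betw_def)
  then show "finite (val ` {w \<in> reduced_words X. len x w \<le> R})"
    using finite_orbit_ball[OF x] finite_subset by blast
  show "inj_on val {w \<in> reduced_words X. len x w \<le> R}"
    using val_bij by (auto simp: bij_betw_def inj_on_def)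
qed

lemma len_subadditive:
  assumes x: "x \<in> M" and u: "u \<in> lists (UNIV \<times> X)" and v: "v \<in> lists (UNIV \<times> X)"
  shows "len x (u @ v) \<le> len x u + len x v"
  using dist_mult_le[of "val u" "val v" x] assms by (simp add: len_def val_append)

lemma len_le_length:
  assumes x: "x \<in> M"
  obtains L where "L \<ge> 0" "\<And>w. w \<in> lists (UNIV \<times> X) \<Longrightarrow> len x w \<le> L * real (length w)"
proof -
  define L where "L = Max (insert 0 ((\<lambda>l. len x [l]) ` (UNIV \<times> X)))"
  have fin: "finite ((\<lambda>l. len x [l]) ` (UNIV \<times> X))" using finite_basis by simp
  have L0: "L \<ge> 0" and L: "\<And>l. l \<in> UNIV \<times> X \<Longrightarrow> len x [l] \<le> L"
    using fin unfolding L_def by (auto intro!: Max_ge)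
  have "len x w \<le> L * real (length w)" if "w \<in> lists (UNIV \<times> X)" for w
    using that
  proof (induction w)
    case Nil then show ?case using x by (simp add: len_def)
  next
    case (Cons l w)
    then have "len x (l # w) \<le> len x [l] + len x w" using len_subadditive[OF x, of "[l]" w] by simp
    then show ?case using Cons L[of l] by (simp add: algebra_simps)
  qed
  then show ?thesis using that L0 by blast
qed

text \<open>Let \<open>p\<close> be the point where the segments from \<open>x\<close> to \<open>u\<^sup>-\<^sup>1 x\<close> and to \<open>v x\<close> branch. The letter paths of both
  words pass close to \<open>p\<close>, after a suffix \<open>s\<close> of \<open>u\<close> and after a prefix \<open>v1\<close> of \<open>v\<close>. Hence \<open>s v1\<close> moves \<open>x\<close> by a
  bounded amount, and being reduced it has bounded word length by properness; so \<open>p\<close> is close to \<open>x\<close>.\<close>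
lemma bounded_cancellation:
  assumes x: "x \<in> M"
  obtains C where "C \<ge> 0" "\<And>u v. u @ v \<in> reduced_words X \<Longrightarrow> len x u + len x v \<le> len x (u @ v) + C"
proof -
  obtain L where L: "L \<ge> 0" "\<And>w. w \<in> lists (UNIV \<times> X) \<Longrightarrow> len x w \<le> L * real (length w)"
    using len_le_length[OF x] by blast
  define B where "B = Max (insert 0 (length ` {w \<in> reduced_words X. len x w \<le> 2 * L}))"
  have B: "length w \<le> B" if "w \<in> reduced_words X" "len x w \<le> 2 * L" for w
    unfolding B_def using that finite_len_ball[OF x, of "2 * L"] by (intro Max_ge) auto
  have near: "\<exists>u v. w = u @ v \<and> d p (a (val u) x) \<le> L"
    if w: "w \<in> lists (UNIV \<times> X)" and p: "p \<in> M" "between x p (a (val w) x)" for w p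
  proof (cases "w = []")
    case True
    then have "d x p = 0" using p x by (simp add: between_def commute)
    then have "d p (a (val []) x) \<le> L" using L(1) x p by (simp add: commute)
    then show ?thesis using True by blast
  next
    case False
    obtain u l v where u: "w = u @ l # v" "between (a (val u) x) p (a (val (u @ [l])) x)"
      using between_letter[OF w False x p] by blast
    have ul: "u \<in> lists (UNIV \<times> X)" "[l] \<in> lists (UNIV \<times> X)" using u w by auto
    have "d p (a (val u) x) \<le> d (a (val u) x) (a (val (u @ [l])) x)"
      using u(2) nonneg[of p "a (val (u @ [l])) x"] commute[of p "a (val u) x"] unfolding between_def by linarith
    also have "\<dots> = len x [l]" using ul x by (simp add: val_append a_mult len_def)
    also have "\<dots> \<le> L" using L(2)[OF ul(2)] by simp
    finally show ?thesis using u by blast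
  qed
  have "len x u + len x v \<le> len x (u @ v) + 2 * (L * real B + L)" if uv: "u @ v \<in> reduced_words X" for u v
  proof -
    have ul: "u \<in> lists (UNIV \<times> X)" "v \<in> lists (UNIV \<times> X)" using reduced_words_lists[OF uv] by auto
    define y z where "y = a (inv (val u)) x" and "z = a (val v) x"
    have M: "y \<in> M" "z \<in> M" using ul x by (auto simp: y_def z_def)
    define t where "t = gromov x y z"
    have dy: "d x y = len x u" using dist_inv_right[of "val u" x x] ul x by (simp add: y_def len_def commute)
    have dz: "d x z = len x v" by (simp add: z_def len_def)
    have dyz: "d y z = len x (u @ v)" using dist_inv_left[of "val u" x z] ul x M
      by (simp add: y_def z_def len_def val_append a_mult)
    have t: "2 * t = len x u + len x v - len x (u @ v)" by (simp add: t_def gromov_def dy dz dyz)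
    have t0: "t \<ge> 0" unfolding t_def using gromov_nonneg x M by simp
    have "t \<le> d x z" using triangle[of x z y] x M t commute[of y z] dy dz dyz by simp
    then obtain p where p: "p \<in> M" "d x p = t" "d p z = d x z - t"
      using segment_point[of x z t] x M t0 by auto
    have bz: "between x p z" using p by (simp add: between_def)
    have "d y p = max (d y x - t) (d y z - (d x z - t))"
      using distance_to_segment_point[OF x M(2) p(1) M(1) bz] p by simp
    then have "d y p = d x y - t" using t commute[of x y] by (simp add: dy dz dyz)
    then have b_y: "between x p y" using p by (simp add: between_def commute)
    obtain v1 v2 where v: "v = v1 @ v2" "d p (a (val v1) x) \<le> L"
      using near[OF ul(2) p(1)] bz by (auto simp: z_def)
    have iu: "inverse_word u \<in> lists (UNIV \<times> X)" using inverse_word_lists[OF ul(1)] .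
    obtain u1 u2 where u: "inverse_word u = u1 @ u2" "d p (a (val u1) x) \<le> L"
      using near[OF iu p(1)] b_y val_inverse[OF ul(1)] by (auto simp: y_def)
    define s where "s = inverse_word u1"
    have us: "u = inverse_word u2 @ s" using u(1) inverse_word_inverse[of u] by (simp add: inverse_word_append s_def)
    have sl: "s \<in> lists (UNIV \<times> X)" "v1 \<in> lists (UNIV \<times> X)" using ul us v by auto
    have sv: "s @ v1 \<in> reduced_words X"
      using uv reduced_words_infix[of "inverse_word u2" "s @ v1" v2] by (simp add: us v)
    have "val u1 = inv (val s)" using val_inverse[OF sl(1)] by (simp add: s_def)
    then have "d (a (val s) p) x \<le> L"
      using u(2) dist_inv_right[of "val s" p x] sl x p by simp
    moreover have "d (a (val s) p) (a (val (s @ v1)) x) \<le> L"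
      using v(2) sl x p by (simp add: val_append a_mult)
    ultimately have "len x (s @ v1) \<le> 2 * L"
      using triangle[of x "a (val s) p" "a (val (s @ v1)) x"] sl x p commute[of x "a (val s) p"]
      by (simp add: len_def)
    then have "length (s @ v1) \<le> B" using B[OF sv] by simp
    then have "len x v1 \<le> L * real B"
      using L(2)[OF sl(2)] mult_left_mono[of "real (length v1)" "real B" L] L(1) by simp
    moreover have "t \<le> len x v1 + L"
      using triangle[of x "a (val v1) x" p] p x sl v(2) commute[of p "a (val v1) x"] by (simp add: len_def)
    ultimately show ?thesis using t by simp
  qed
  then show ?thesis using that[of "2 * (L * real B + L)"] L(1) by simp
qed

end

section \<open>Growth of quasi-additive lengths\<close>

text \<open>Fekete's lemma for a monotone function of a real variable. The limit is the infimum of \<open>f R / R\<close>,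
  which gives the lower bound for \<open>f\<close> along with the convergence.\<close>
lemma fekete_real:
  fixes f :: "real \<Rightarrow> real"
  assumes nonneg: "\<And>R. R \<ge> 0 \<Longrightarrow> 0 \<le> f R"
    and mono: "\<And>R S. 0 \<le> R \<Longrightarrow> R \<le> S \<Longrightarrow> f R \<le> f S"
    and sub: "\<And>R S. R \<ge> 0 \<Longrightarrow> S \<ge> 0 \<Longrightarrow> f (R + S) \<le> f R + f S"
  obtains h where "((\<lambda>R. f R / R) \<longlongrightarrow> h) at_top" "\<And>R. R \<ge> 0 \<Longrightarrow> h * R \<le> f R"
proof -
  define h where "h = (INF R\<in>{0<..}. f R / R)"
  have bdd: "bdd_below ((\<lambda>R. f R / R) ` {0<..})"
    by (rule bdd_belowI2[of _ 0]) (simp add: nonneg)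
  have low: "h \<le> f R / R" if "R > 0" for R
    unfolding h_def using that by (intro cINF_lower[OF bdd]) auto
  have mult: "f (real n * R) \<le> real n * f R" if "R \<ge> 0" "n > 0" for n R
    using that(2)
  proof (induction n rule: nat_induct_non_zero)
    case (Suc n)
    then show ?case using sub[of "real n * R" R] that by (simp add: algebra_simps)
  qed simp
  have "((\<lambda>R. f R / R) \<longlongrightarrow> h) at_top"
  proof (rule order_tendstoI)
    fix c assume "c < h"
    show "\<forall>\<^sub>F R in at_top. c < f R / R"
      using eventually_gt_at_top[of 0] by eventually_elim (use low \<open>c < h\<close> in force)
  next
    fix c assume "h < c"
    then obtain Q where Q: "Q > 0" "f Q / Q < c"
      unfolding h_def using cInf_lessD[of "(\<lambda>R. f R / R) ` {0<..}" c] by auto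
    have bound: "f R / R \<le> f Q / Q + f Q / R" if R: "R > 0" for R
    proof -
      define n where "n = nat \<lfloor>R / Q\<rfloor>"
      have n: "real n \<le> R / Q" "R / Q \<le> real (Suc n)"
        using R Q by (auto simp: n_def) linarith
      have "f R \<le> f (real (Suc n) * Q)"
        using R Q n(2) by (intro mono) (auto simp: field_simps)
      also have "\<dots> \<le> real (Suc n) * f Q" using Q by (intro mult) auto
      also have "\<dots> \<le> (R / Q + 1) * f Q" using n(1) nonneg[of Q] Q by (intro mult_right_mono) auto
      finally show ?thesis using R Q by (simp add: field_simps)
    qed
    have "((\<lambda>R. f Q / Q + f Q / R) \<longlongrightarrow> f Q / Q + 0) at_top"
      by (intro tendsto_add tendsto_const tendsto_divide_0[OF tendsto_const] filterlim_at_top_imp_at_infinity filterlim_ident)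
    then have "\<forall>\<^sub>F R in at_top. f Q / Q + f Q / R < c" using Q by (intro order_tendstoD) auto
    then show "\<forall>\<^sub>F R in at_top. f R / R < c"
      using eventually_gt_at_top[of 0] by eventually_elim (use bound in force)
  qed
  moreover have "h * R \<le> f R" if "R \<ge> 0" for R
    using low[of R] nonneg[of R] that by (cases "R = 0") (auto simp: field_simps)
  ultimately show ?thesis by (rule that)
qed

text \<open>The length functions \<open>len x\<close> and their positive multiples are the intended instances. Nothing but
  words occurs here, so that the lengths of two different trees can be compared on one set of words.\<close>
locale quasi_length =
  fixes X :: "'g set" and L :: "(bool \<times> 'g) list \<Rightarrow> real" and C :: real
  assumes finite_X: "finite X" and card_X: "card X \<ge> 2"
    and L_nonneg: "w \<in> reduced_words X \<Longrightarrow> 0 \<le> L w"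
    and L_Nil: "L [] = 0"
    and L_sub: "u @ v \<in> reduced_words X \<Longrightarrow> L (u @ v) \<le> L u + L v"
    and L_quasi: "u @ v \<in> reduced_words X \<Longrightarrow> L u + L v \<le> L (u @ v) + C"
    and finite_ball: "finite {w \<in> reduced_words X. L w \<le> R}"
begin

abbreviation W where "W \<equiv> reduced_words X"

definition N :: "real \<Rightarrow> real" where
  "N R = real (card {w \<in> W. L w \<le> R})"

definition growth_rate :: "real \<Rightarrow> bool" where
  "growth_rate h \<longleftrightarrow> ((\<lambda>R. ln (N R) / R) \<longlongrightarrow> h) at_top"

abbreviation weight :: "real \<Rightarrow> (bool \<times> 'g) list set \<Rightarrow> real" where
  "weight s A \<equiv> (\<Sum>w\<in>A. exp (- s * L w))"

definition poincare_bounded :: "real \<Rightarrow> real \<Rightarrow> bool" where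
  "poincare_bounded s B \<longleftrightarrow> (\<forall>A. finite A \<and> A \<subseteq> W \<longrightarrow> weight s A \<le> B)"

lemma C_nonneg: "C \<ge> 0"
  using L_quasi[of "[]" "[]"] L_Nil by simp

lemma L_le_length:
  obtains K where "K > 0" "\<And>w. w \<in> W \<Longrightarrow> L w \<le> K * real (length w)"
proof -
  define K where "K = Max (insert 1 ((\<lambda>l. L [l]) ` (UNIV \<times> X)))"
  have fin: "finite (insert 1 ((\<lambda>l. L [l]) ` (UNIV \<times> X)))" using finite_X by simp
  have K: "1 \<le> K" "\<And>l. l \<in> UNIV \<times> X \<Longrightarrow> L [l] \<le> K"
    using fin unfolding K_def by (auto intro!: Max_ge)
  have "L w \<le> K * real (length w)" if "w \<in> W" for w
    using that
  proof (induction w)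
    case Nil then show ?case by (simp add: L_Nil)
  next
    case (Cons l w)
    have "w \<in> W" "[l] \<in> W" using Cons.prems reduced_words_append[of "[l]" w X] by auto
    then have "L (l # w) \<le> L [l] + L w" "l \<in> UNIV \<times> X"
      using L_sub[of "[l]" w] Cons.prems by (auto simp: mem_Times_iff)
    then show ?case using Cons.IH[OF \<open>w \<in> W\<close>] K(2)[of l] by (simp add: algebra_simps)
  qed
  then show ?thesis using that[of K] K(1) by simp
qed

lemma N_pos: "R \<ge> 0 \<Longrightarrow> N R \<ge> 1"
proof -
  assume "R \<ge> 0"
  then have "[] \<in> {w \<in> W. L w \<le> R}" by (simp add: L_Nil)
  then have "card {w \<in> W. L w \<le> R} \<noteq> 0" using finite_ball[of R] by (metis card_0_eq empty_iff)
  then show ?thesis by (simp add: N_def)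
qed

lemma N_mono: "R \<le> S \<Longrightarrow> N R \<le> N S"
  unfolding N_def using finite_ball[of S] by (intro of_nat_mono card_mono) auto

text \<open>Cut a word of length at most \<open>R + S\<close> after its longest prefix of length at most \<open>R\<close>; the next letter
  exceeds \<open>R\<close>, so quasi-additivity bounds the length of the rest.\<close>
lemma N_submultiplicative:
  obtains D where "D \<ge> 0" "\<And>R S. R \<ge> 0 \<Longrightarrow> S \<ge> 0 \<Longrightarrow> N (R + S) \<le> N R * N (S + D)"
proof -
  obtain K where K: "K > 0" "\<And>w. w \<in> W \<Longrightarrow> L w \<le> K * real (length w)" using L_le_length by blast
  define D where "D = K + C"
  have D: "D \<ge> 0" using K C_nonneg by (simp add: D_def)
  have "N (R + S) \<le> N R * N (S + D)" if RS: "R \<ge> 0" "S \<ge> 0" for R S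
  proof -
    have split: "\<exists>u v. w = u @ v \<and> u \<in> W \<and> L u \<le> R \<and> v \<in> W \<and> L v \<le> S + D"
      if w: "w \<in> W" "L w \<le> R + S" for w
    proof -
      define I where "I = {i. i \<le> length w \<and> L (take i w) \<le> R}"
      have I: "finite I" "0 \<in> I" using RS by (auto simp: I_def L_Nil)
      define i where "i = Max I"
      have i: "i \<in> I" unfolding i_def using I by (intro Max_in) auto
      have tw: "take i w @ drop i w \<in> W" using w by simp
      then have mem: "take i w \<in> W" "drop i w \<in> W" unfolding reduced_words_append by auto
      have "L (drop i w) \<le> S + D"
      proof (cases "i = length w")
        case True then show ?thesis using RS D by (simp add: L_Nil)
      next
        case False
        then have lt: "i < length w" using i by (auto simp: I_def)
        have "Suc i \<notin> I" using Max_ge[OF I(1), of "Suc i"] by (auto simp: i_def)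
        then have gt: "L (take (Suc i) w) > R" using lt by (auto simp: I_def)
        have "L (take (Suc i) w) + L (drop (Suc i) w) \<le> L w + C"
          using L_quasi[of "take (Suc i) w" "drop (Suc i) w"] w by simp
        then have 1: "L (drop (Suc i) w) \<le> S + C" using gt w by simp
        have dr: "drop i w = [w ! i] @ drop (Suc i) w" using lt by (simp add: Cons_nth_drop_Suc)
        have "L (drop i w) \<le> L [w ! i] + L (drop (Suc i) w)"
          using mem(2) L_sub[of "[w ! i]" "drop (Suc i) w"] unfolding dr by blast
        moreover have "[w ! i] \<in> W" using mem(2) unfolding dr reduced_words_append by blast
        then have "L [w ! i] \<le> K" using K(2)[of "[w ! i]"] by simp
        ultimately show ?thesis using 1 by (simp add: D_def)
      qed
      then show ?thesis using i mem by (intro exI[of _ "take i w"] exI[of _ "drop i w"]) (auto simp: I_def)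
    qed
    have "{w \<in> W. L w \<le> R + S} \<subseteq> (\<lambda>(u, v). u @ v) ` ({w \<in> W. L w \<le> R} \<times> {w \<in> W. L w \<le> S + D})"
      using split by force
    then have "card {w \<in> W. L w \<le> R + S} \<le> card ({w \<in> W. L w \<le> R} \<times> {w \<in> W. L w \<le> S + D})"
      using finite_ball by (intro surj_card_le) auto
    then show ?thesis by (simp add: N_def card_cartesian_product flip: of_nat_mult)
  qed
  then show ?thesis using that D by blast
qed

lemma growth_rate_exists:
  obtains h D where "growth_rate h" "D \<ge> 0" "\<And>R. R \<ge> 0 \<Longrightarrow> exp (h * R) \<le> N (R + D)"
proof -
  obtain D where D: "D \<ge> 0" "\<And>R S. R \<ge> 0 \<Longrightarrow> S \<ge> 0 \<Longrightarrow> N (R + S) \<le> N R * N (S + D)"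
    using N_submultiplicative by blast
  define f where "f R = ln (N (R + D))" for R
  have pos: "N (R + D) \<ge> 1" if "R \<ge> 0" for R using that D by (intro N_pos) auto
  obtain h where h: "((\<lambda>R. f R / R) \<longlongrightarrow> h) at_top" "\<And>R. R \<ge> 0 \<Longrightarrow> h * R \<le> f R"
  proof (rule fekete_real[of f])
    show "0 \<le> f R" if "R \<ge> 0" for R using pos[OF that] by (simp add: f_def)
    show "f R \<le> f S" if "0 \<le> R" "R \<le> S" for R S
      unfolding f_def using pos[of R] pos[of S] N_mono[of "R + D" "S + D"] that by (intro ln_mono) auto
    show "f (R + S) \<le> f R + f S" if RS: "R \<ge> 0" "S \<ge> 0" for R S
    proof -
      have "N ((R + D) + S) \<le> N (R + D) * N (S + D)" using D RS by simp
      moreover have "N (R + S + D) > 0" using pos[of "R + S"] RS by simp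
      ultimately have "f (R + S) \<le> ln (N (R + D) * N (S + D))"
        unfolding f_def by (intro ln_mono) (auto simp: algebra_simps)
      also have "\<dots> = f R + f S" unfolding f_def using pos[of R] pos[of S] RS by (intro ln_mult_pos) auto
      finally show ?thesis .
    qed
  qed blast
  have "((\<lambda>R. f (R - D) / (R - D) * ((R - D) / R)) \<longlongrightarrow> h * 1) at_top"
  proof (rule tendsto_mult)
    have "filterlim (\<lambda>R::real. R - D) at_top at_top"
      using filterlim_tendsto_add_at_top[OF tendsto_const[of "-D"] filterlim_ident] by simp
    then show "((\<lambda>R. f (R - D) / (R - D)) \<longlongrightarrow> h) at_top"
      using filterlim_compose[OF h(1)] by blast
    have "((\<lambda>R. 1 - D / R) \<longlongrightarrow> 1 - 0) at_top"
      by (intro tendsto_diff tendsto_const tendsto_divide_0[OF tendsto_const] filterlim_at_top_imp_at_infinity filterlim_ident)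
    moreover have "\<forall>\<^sub>F R in at_top. 1 - D / R = (R - D) / R"
      using eventually_gt_at_top[of 0] by eventually_elim (simp add: field_simps)
    ultimately show "((\<lambda>R. (R - D) / R) \<longlongrightarrow> 1) at_top" using Lim_transform_eventually by fastforce
  qed
  moreover have "\<forall>\<^sub>F R in at_top. f (R - D) / (R - D) * ((R - D) / R) = ln (N R) / R"
    using eventually_gt_at_top[of "max 0 D"] by eventually_elim (simp add: f_def)
  ultimately have "growth_rate h" unfolding growth_rate_def using Lim_transform_eventually by fastforce
  moreover have "exp (h * R) \<le> N (R + D)" if "R \<ge> 0" for R
    using h(2)[OF that] pos[OF that] unfolding f_def by (subst ln_ge_iff[symmetric]) auto
  ultimately show ?thesis using that D(1) by blast
qed

lemma growth_rate_unique: "growth_rate h \<Longrightarrow> growth_rate h' \<Longrightarrow> h = h'"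
  unfolding growth_rate_def by (rule tendsto_unique[rotated]) auto

text \<open>The positive words of \<open>n\<close> letters are reduced, there are at least \<open>2\<^sup>n\<close> of them, and their lengths grow at
  most linearly in \<open>n\<close>.\<close>
lemma growth_rate_pos:
  assumes h: "growth_rate h" shows "h > 0"
proof -
  obtain K where K: "K > 0" "\<And>w. w \<in> W \<Longrightarrow> L w \<le> K * real (length w)" using L_le_length by blast
  have low: "2 ^ n \<le> N (real n * K)" for n
  proof -
    have pos_word: "map (Pair True) xs \<in> W" if "set xs \<subseteq> X" for xs
      using that
    proof (induction xs)
      case (Cons x xs)
      have "[(True, x)] @ map (Pair True) xs \<in> W"
        unfolding reduced_words_append using Cons
        by (cases xs) (auto simp: inverse_letter_def)
      then show ?case by simp
    qed simp
    have "map (Pair True) ` {xs. set xs \<subseteq> X \<and> length xs = n} \<subseteq> {w \<in> W. L w \<le> real n * K}"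
      using pos_word K(2) by (force simp: mult.commute)
    then have "card (map (Pair True) ` {xs. set xs \<subseteq> X \<and> length xs = n}) \<le> card {w \<in> W. L w \<le> real n * K}"
      using finite_ball by (intro card_mono)
    moreover have "card (map (Pair True) ` {xs. set xs \<subseteq> X \<and> length xs = n}) = card X ^ n"
      using card_lists_length_eq[OF finite_X, of n] by (subst card_image) (auto simp: inj_on_def)
    ultimately have "card X ^ n \<le> card {w \<in> W. L w \<le> real n * K}" by simp
    moreover have "2 ^ n \<le> card X ^ n" using card_X by (intro power_mono) auto
    ultimately have "2 ^ n \<le> card {w \<in> W. L w \<le> real n * K}" by linarith
    then have "real (2 ^ n) \<le> N (real n * K)" unfolding N_def by (rule of_nat_mono)
    then show ?thesis by simp
  qed
  have "filterlim (\<lambda>n. real n * K) at_top sequentially"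
    using filterlim_tendsto_pos_mult_at_top[OF tendsto_const K(1) filterlim_real_sequentially]
    by (simp add: mult.commute)
  then have lim: "(\<lambda>n. ln (N (real n * K)) / (real n * K)) \<longlonglongrightarrow> h"
    using h filterlim_compose unfolding growth_rate_def by blast
  have "ln 2 / K \<le> h"
  proof (rule tendsto_lowerbound[OF lim])
    show "\<forall>\<^sub>F n in sequentially. ln 2 / K \<le> ln (N (real n * K)) / (real n * K)"
      using eventually_gt_at_top[of 0]
    proof eventually_elim
      case (elim n)
      have "real n * ln 2 = ln (2 ^ n)" by (simp add: ln_realpow)
      also have "\<dots> \<le> ln (N (real n * K))" using low[of n] by (intro ln_mono) auto
      finally show ?case using elim K by (simp add: field_simps)
    qed
  qed simp
  moreover have "ln 2 / K > 0" using K by simp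
  ultimately show ?thesis by linarith
qed

lemma N_le_of_bounded:
  assumes "poincare_bounded s B" "s \<ge> 0"
  shows "N R \<le> B * exp (s * R)"
proof -
  have "N R * exp (- s * R) = (\<Sum>w\<in>{w \<in> W. L w \<le> R}. exp (- s * R))" by (simp add: N_def)
  also have "\<dots> \<le> weight s {w \<in> W. L w \<le> R}"
    using assms(2) by (intro sum_mono) (auto intro: mult_left_mono)
  also have "\<dots> \<le> B" using assms(1) finite_ball unfolding poincare_bounded_def by blast
  finally show ?thesis by (simp add: exp_minus field_simps)
qed

lemma poincare_convergent:
  assumes h: "growth_rate h" and s: "h < s"
  obtains B where "poincare_bounded s B"
proof -
  \<comment> \<open>between \<open>h\<close> and \<open>s\<close>: \<open>N R\<close> is eventually below \<open>exp (t R)\<close>, and the gap to \<open>s\<close> makes the series geometric\<close>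
  define t where "t = (h + s) / 2"
  have t: "h < t" "t < s" using s by (auto simp: t_def)
  have t0: "t > 0" using growth_rate_pos[OF h] t by simp
  have "\<forall>\<^sub>F R in at_top. ln (N R) / R < t"
    using h t unfolding growth_rate_def by (intro order_tendstoD)
  then have "\<forall>\<^sub>F R in at_top. N R \<le> exp (t * R)"
    using eventually_gt_at_top[of 0]
  proof eventually_elim
    case (elim R)
    then have "ln (N R) \<le> t * R" by (simp add: field_simps)
    then show ?case using N_pos[of R] elim ln_ge_iff[of "N R"] by (metis exp_le_cancel_iff exp_ln less_le_trans order_less_imp_le zero_less_one)
  qed
  then obtain R0 where R0: "\<And>R. R \<ge> R0 \<Longrightarrow> N R \<le> exp (t * R)" by (auto simp: eventually_at_top_linorder)
  define K where "K = 1 + N R0"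
  have K1: "K \<ge> 1" by (simp add: K_def N_def)
  have NK: "N R \<le> K * exp (t * R)" if "R \<ge> 0" for R
  proof (cases "R \<ge> R0")
    case True
    then have "N R \<le> 1 * exp (t * R)" using R0 by simp
    also have "\<dots> \<le> K * exp (t * R)" using K1 by (intro mult_right_mono) auto
    finally show ?thesis .
  next
    case False
    then have "N R \<le> K * 1" using N_mono[of R R0] by (simp add: K_def)
    also have "\<dots> \<le> K * exp (t * R)" using K1 t0 that by (intro mult_left_mono) auto
    finally show ?thesis .
  qed
  define q where "q = exp (t - s)"
  have q: "0 < q" "q < 1" using t by (auto simp: q_def)
  have sumq: "summable (\<lambda>k. K * exp t * q ^ k)" using q by (intro summable_mult summable_geometric) auto
  have "poincare_bounded s (\<Sum>k. K * exp t * q ^ k)"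
    unfolding poincare_bounded_def
  proof (intro allI impI)
    fix A assume A: "finite A \<and> A \<subseteq> W"
    define k where "k w = nat \<lfloor>L w\<rfloor>" for w
    have k: "real (k w) \<le> L w" "L w \<le> real (k w) + 1" if "w \<in> W" for w
      using L_nonneg[OF that] by (auto simp: k_def)
    have "weight s A = (\<Sum>j\<in>k ` A. \<Sum>w\<in>{w\<in>A. k w = j}. exp (- s * L w))"
      using A by (intro sum.image_gen) auto
    also have "\<dots> \<le> (\<Sum>j\<in>k ` A. K * exp t * q ^ j)"
    proof (rule sum_mono)
      fix j assume "j \<in> k ` A"
      have "weight s {w\<in>A. k w = j} \<le> (\<Sum>w\<in>{w\<in>A. k w = j}. exp (- s * real j))"
        using k A t t0 by (intro sum_mono) (auto intro!: mult_left_mono)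
      also have "\<dots> = real (card {w\<in>A. k w = j}) * exp (- s * real j)" by simp
      also have "\<dots> \<le> N (real j + 1) * exp (- s * real j)"
        unfolding N_def using A k finite_ball by (intro mult_right_mono of_nat_mono card_mono) auto
      also have "\<dots> \<le> K * exp (t * (real j + 1)) * exp (- s * real j)"
        by (intro mult_right_mono NK) auto
      also have "\<dots> = K * exp t * q ^ j"
      proof -
        have "exp (t * (real j + 1)) * exp (- s * real j) = exp t * q ^ j"
          unfolding q_def exp_of_nat_mult[symmetric] mult_exp_exp by (simp add: algebra_simps)
        then show ?thesis by (simp only: mult.assoc)
      qed
      finally show "weight s {w\<in>A. k w = j} \<le> K * exp t * q ^ j" .
    qed
    also have "\<dots> \<le> (\<Sum>k. K * exp t * q ^ k)"
      using A K1 q by (intro sum_le_suminf sumq) auto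
    finally show "weight s A \<le> (\<Sum>k. K * exp t * q ^ k)" .
  qed
  then show ?thesis by (rule that)
qed

text \<open>By Fekete's lemma \<open>N\<close> is bounded below by a multiple of \<open>exp (h R)\<close>. If the series were bounded, then
  \<open>N\<close> would be bounded above by such a multiple too, so all sufficiently thick shells
  \<open>R < L w \<le> R + r\<close> would contribute a fixed positive amount, a contradiction.\<close>
lemma poincare_divergent:
  assumes h: "growth_rate h" shows "\<not> poincare_bounded h B"
proof
  assume B: "poincare_bounded h B"
  have h0: "h > 0" using growth_rate_pos[OF h] .
  obtain h' D where "growth_rate h'" "D \<ge> 0" "\<And>R. R \<ge> 0 \<Longrightarrow> exp (h' * R) \<le> N (R + D)"
    using growth_rate_exists by blast
  then have D: "D \<ge> 0" "\<And>R. R \<ge> 0 \<Longrightarrow> exp (h * R) \<le> N (R + D)" using growth_rate_unique[OF h] by auto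
  define c where "c = exp (- h * D)"
  have c: "c > 0" by (simp add: c_def)
  have low: "c * exp (h * R) \<le> N R" if "R \<ge> D" for R
    using D(2)[of "R - D"] that by (simp add: c_def exp_add[symmetric] algebra_simps)
  have "B \<ge> 0" using B unfolding poincare_bounded_def by force
  have "((\<lambda>r. B * exp (- h * r)) \<longlongrightarrow> B * 0) at_top"
  proof (intro tendsto_mult tendsto_const filterlim_compose[OF exp_at_bot])
    show "filterlim (\<lambda>r. - h * r) at_bot at_top"
      using h0 by (intro filterlim_tendsto_neg_mult_at_bot[OF tendsto_const] filterlim_ident) simp
  qed
  then have "\<forall>\<^sub>F r in at_top. B * exp (- h * r) < c / 2" using c by (intro order_tendstoD) auto
  then have "\<forall>\<^sub>F r in at_top. B * exp (- h * r) < c / 2 \<and> r \<ge> D"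
    using eventually_ge_at_top[of D] by (rule eventually_conj)
  then obtain r where r: "B * exp (- h * r) < c / 2" "r \<ge> D"
    by (metis (mono_tags, lifting) eventually_at_top_linorder order_refl)
  have r0: "r \<ge> 0" using r D by simp
  define S where "S k = weight h {w \<in> W. L w \<le> real k * r}" for k
  have "real k * (c / 2) \<le> S k" for k
  proof (induction k)
    case 0 then show ?case by (auto simp: S_def intro: sum_nonneg)
  next
    case (Suc k)
    define R where "R = real k * r"
    have RS: "real (Suc k) * r = R + r" by (simp add: R_def algebra_simps)
    have R0: "R \<ge> 0" using r0 by (simp add: R_def)
    define Sh where "Sh = {w \<in> W. L w \<le> R + r} - {w \<in> W. L w \<le> R}"
    have card: "real (card Sh) = N (R + r) - N R"
      unfolding Sh_def N_def using finite_ball r0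
      by (subst card_Diff_subset) (auto intro!: card_mono of_nat_diff)
    have e: "exp (- h * r) * exp (h * (R + r)) = exp (h * R)"
      by (simp add: mult_exp_exp algebra_simps)
    have "c / 2 * exp (h * (R + r)) \<le> (c - B * exp (- h * r)) * exp (h * (R + r))"
      using r by (intro mult_right_mono) auto
    also have "\<dots> = c * exp (h * (R + r)) - B * exp (h * R)"
      by (simp only: left_diff_distrib mult.assoc e)
    also have "\<dots> \<le> N (R + r) - N R"
      using low[of "R + r"] N_le_of_bounded[OF B, of R] r R0 h0 by auto
    finally have shell: "c / 2 * exp (h * (R + r)) \<le> real (card Sh)" using card by simp
    have "c / 2 = c / 2 * exp (h * (R + r)) * exp (- h * (R + r))"
      by (simp add: exp_minus)
    also have "\<dots> \<le> real (card Sh) * exp (- h * (R + r))" using shell by (intro mult_right_mono) auto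
    also have "\<dots> = (\<Sum>w\<in>Sh. exp (- h * (R + r)))" by simp
    also have "\<dots> \<le> weight h Sh"
      using h0 by (intro sum_mono) (auto simp: Sh_def)
    finally have "c / 2 \<le> weight h Sh" .
    moreover have "S (Suc k) = weight h Sh + S k"
      unfolding S_def RS Sh_def R_def[symmetric] using finite_ball r0 by (intro sum.subset_diff) auto
    ultimately show ?case using Suc by (simp add: algebra_simps)
  qed
  moreover have "S k \<le> B" for k using B finite_ball unfolding S_def poincare_bounded_def by blast
  ultimately have bnd: "real k * (c / 2) \<le> B" for k by (meson order_trans)
  obtain k where "B < real k * (c / 2)" using reals_Archimedean3[of "c / 2"] c by auto
  then show False using bnd[of k] by simp
qed

end

section \<open>Cutting words at the occurrences of a fixed word\<close>
definition ends_with :: "'b list \<Rightarrow> 'b list \<Rightarrow> bool" where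
  "ends_with w b \<longleftrightarrow> (\<exists>a. b = a @ w)"

definition follows :: "'g set \<Rightarrow> (bool \<times> 'g) \<Rightarrow> (bool \<times> 'g) list set" where
  "follows X z = {g. z # g \<in> reduced_words X}"

text \<open>The words in which \<open>w\<close> occurs as a suffix and nowhere else. The restriction on the first letter makes
  every concatenation of blocks reduced, since each block ends with the last letter of \<open>w\<close>.\<close>
definition blocks :: "'g set \<Rightarrow> (bool \<times> 'g) list \<Rightarrow> (bool \<times> 'g) list set" where
  "blocks X w = {b \<in> follows X (last w). ends_with w b \<and> (\<forall>i<length b. \<not> ends_with w (take i b))}"

lemma follows_reduced: "g \<in> follows X z \<Longrightarrow> g \<in> reduced_words X"
  using reduced_words_append[of "[z]" g X] by (simp add: follows_def)

lemma blocks_reduced: "b \<in> blocks X w \<Longrightarrow> b \<in> reduced_words X"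
  unfolding blocks_def using follows_reduced by blast

lemma last_letter_reduced: "w \<in> reduced_words X \<Longrightarrow> w \<noteq> [] \<Longrightarrow> [last w] \<in> reduced_words X"
  using reduced_words_append[of "butlast w" "[last w]" X] by simp

lemma blocks_not_Nil: "w \<noteq> [] \<Longrightarrow> b \<in> blocks X w \<Longrightarrow> b \<noteq> [] \<and> last b = last w"
  by (auto simp: blocks_def ends_with_def)

lemma block_append_follows:
  assumes "w \<noteq> []" "b \<in> blocks X w" "g \<in> follows X (last w)"
  shows "b @ g \<in> follows X (last w)"
proof -
  have "(last w # b) @ g \<in> reduced_words X"
    unfolding reduced_words_append
    using assms blocks_not_Nil[OF assms(1,2)] reduced_words_append[of "[last w]" g X] 
    by (auto simp: blocks_def follows_def)
  then show ?thesis by (simp add: follows_def)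
qed

lemma blocks_prefix_free:
  assumes "b \<in> blocks X w" "b' \<in> blocks X w" "b @ g = b' @ g'"
  shows "b = b' \<and> g = g'"
proof -
  have *: "\<not> length b < length b'"
    if "b \<in> blocks X w" "b' \<in> blocks X w" "b @ g = b' @ g'" for b b' g g' :: "(bool \<times> 'a) list"
  proof
    assume lt: "length b < length b'"
    have "take (length b) (b @ g) = take (length b) (b' @ g')" using that by simp
    then have "take (length b) b' = b" using lt by simp
    then show False using that lt unfolding blocks_def by auto
  qed
  have "length b = length b'" using *[OF assms] *[OF assms(2,1) assms(3)[symmetric]] by simp
  then show ?thesis using assms(3) by simp
qed

lemma first_block:
  assumes g: "g \<in> follows X (last w)" and i: "i \<le> length g" "ends_with w (take i g)" and w: "w \<noteq> []"
  obtains b g' where "g = b @ g'" "b \<in> blocks X w" "g' \<in> follows X (last w)" "length b \<le> i"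
proof -
  define j where "j = (LEAST j. ends_with w (take j g))"
  have j: "ends_with w (take j g)" unfolding j_def using i(2) by (rule LeastI)
  have ji: "j \<le> i" unfolding j_def using i(2) by (rule Least_le)
  have least: "\<not> ends_with w (take k g)" if "k < j" for k
    using not_less_Least that unfolding j_def by blast
  have len: "length (take j g) = j" using ji i by simp
  obtain a where a: "take j g = a @ w" using j by (auto simp: ends_with_def)
  have all: "(last w # a @ butlast w) @ (last w # drop j g) \<in> reduced_words X"
  proof -
    have "g = a @ w @ drop j g" using a by (metis append.assoc append_take_drop_id)
    moreover have "w = butlast w @ [last w]" using w by simp
    ultimately have "g = a @ butlast w @ last w # drop j g" by (metis append.assoc append_Cons append_Nil)
    then show ?thesis using g unfolding follows_def by simp
  qed
  have 1: "drop j g \<in> follows X (last w)"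
    using all unfolding reduced_words_append follows_def by blast
  have "(last w # take j g) @ drop j g \<in> reduced_words X" using g by (simp add: follows_def)
  then have 2: "take j g \<in> follows X (last w)" unfolding reduced_words_append follows_def by blast
  have "take j g \<in> blocks X w" unfolding blocks_def using 2 j least len by auto
  then show ?thesis using that[of "take j g" "drop j g"] 1 ji len by simp
qed

fun block_products :: "'b list set \<Rightarrow> nat \<Rightarrow> 'b list set" where
  "block_products B 0 = {[]}"
| "block_products B (Suc n) = (\<lambda>(b, g). b @ g) ` (B \<times> block_products B n)"

context quasi_length begin

text \<open>Blocks form a prefix code, so different sequences of blocks give different words, and subadditivity
  bounds the sum over products of \<open>n\<close> blocks from below by the \<open>n\<close>-th power of the sum over single blocks.\<close>
lemma block_products_diverge:
  assumes w: "w \<in> W" "w \<noteq> []" and B: "finite B" "B \<subseteq> blocks X w" and s: "s \<ge> 0"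
    and sum: "weight s B > 1"
  shows "\<not> poincare_bounded s K"
proof
  assume K: "poincare_bounded s K"
  define \<sigma> where "\<sigma> = weight s B"
  have sub: "block_products B n \<subseteq> follows X (last w) \<and> finite (block_products B n)" for n
  proof (induction n)
    case 0
    show ?case using last_letter_reduced[OF w] by (simp add: follows_def)
  next
    case (Suc n)
    have "b @ g \<in> follows X (last w)" if "b \<in> B" "g \<in> block_products B n" for b g
      using block_append_follows[OF w(2)] B(2) Suc that by blast
    then show ?case using B Suc by auto
  qed
  have "\<sigma> ^ n \<le> weight s (block_products B n)" for n
  proof (induction n)
    case 0 then show ?case by (simp add: L_Nil)
  next
    case (Suc n)
    let ?P = "block_products B n"
    have inj: "inj_on (\<lambda>(b, g). b @ g) (B \<times> ?P)"
    proof (rule inj_onI)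
      fix p q assume p: "p \<in> B \<times> ?P" and q: "q \<in> B \<times> ?P" and eq: "(case p of (b, g) \<Rightarrow> b @ g) = (case q of (b, g) \<Rightarrow> b @ g)"
      obtain b g c k where pq: "p = (b, g)" "q = (c, k)" by (cases p; cases q)
      have "b = c \<and> g = k" using p q eq B(2) pq by (intro blocks_prefix_free[of b X w c]) auto
      then show "p = q" using pq by simp
    qed
    have "\<sigma> ^ Suc n \<le> \<sigma> * weight s (?P)"
      using Suc sum by (auto simp: \<sigma>_def intro!: mult_left_mono)
    also have "\<dots> = (\<Sum>(b, g)\<in>B \<times> ?P. exp (- s * L b) * exp (- s * L g))"
      by (simp add: \<sigma>_def sum_product sum.cartesian_product)
    also have "\<dots> \<le> (\<Sum>(b, g)\<in>B \<times> ?P. exp (- s * L (b @ g)))"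
    proof (intro sum_mono, clarify)
      fix b g assume bg: "b \<in> B" "g \<in> ?P"
      then have "b @ g \<in> W" using block_append_follows[OF w(2)] B(2) sub follows_reduced by blast
      then have "s * L (b @ g) \<le> s * (L b + L g)" using L_sub s by (intro mult_left_mono) auto
      then show "exp (- s * L b) * exp (- s * L g) \<le> exp (- s * L (b @ g))"
        by (simp add: mult_exp_exp algebra_simps)
    qed
    also have "\<dots> = weight s (block_products B (Suc n))"
      unfolding block_products.simps by (subst sum.reindex[OF inj]) (simp add: o_def case_prod_beta)
    finally show ?case .
  qed
  moreover have "weight s (block_products B n) \<le> K" for n
    using K sub[of n] follows_reduced unfolding poincare_bounded_def by blast
  ultimately have "\<sigma> ^ n \<le> K" for n by (meson order_trans)
  moreover obtain n where "K < \<sigma> ^ n" using real_arch_pow[of \<sigma> K] sum by (auto simp: \<sigma>_def)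
  ultimately show False by (meson not_le)
qed

text \<open>A finite sum depends continuously on the exponent, so it exceeds 1 at a slightly larger exponent too,
  where the series over all words would be bounded if the growth rate were at most \<open>s\<close>.\<close>
lemma growth_rate_gt_of_blocks:
  assumes w: "w \<in> W" "w \<noteq> []" and B: "finite B" "B \<subseteq> blocks X w"
    and h: "growth_rate h" and sum: "weight s B > 1"
  shows "s < h"
proof (rule ccontr)
  assume "\<not> s < h"
  have BW: "B \<subseteq> W" using B(2) blocks_reduced by blast
  have "weight s B \<le> weight h B"
    using BW L_nonneg \<open>\<not> s < h\<close> by (intro sum_mono) (auto intro!: mult_right_mono)
  then have "weight h B > 1" using sum by simp
  moreover have "((\<lambda>t. \<Sum>b\<in>B. exp (- t * L b)) \<longlongrightarrow> weight h B) (at_right h)"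
    by (intro tendsto_intros)
  ultimately have "\<forall>\<^sub>F t in at_right h. 1 < weight t B"
    by (intro order_tendstoD)
  then have "\<forall>\<^sub>F t in at_right h. 1 < weight t B \<and> h < t"
    using eventually_at_right_less[of h] by (rule eventually_conj)
  then obtain t where t: "1 < weight t B" "h < t"
    using eventually_happens trivial_limit_at_right_real by blast
  obtain K where "poincare_bounded t K" using poincare_convergent[OF h t(2)] .
  then show False using block_products_diverge[OF w B _ t(1)] growth_rate_pos[OF h] t(2) by fastforce
qed

lemma finite_short_words: "finite {g \<in> W. length g \<le> n}"
proof -
  have "{g \<in> W. length g \<le> n} \<subseteq> {g. set g \<subseteq> UNIV \<times> X \<and> length g \<le> n}"
    by (auto simp: reduced_words_def)
  moreover have "finite {g. set g \<subseteq> (UNIV :: bool set) \<times> X \<and> length g \<le> n}"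
    using finite_X by (intro finite_lists_length_le) simp
  ultimately show ?thesis by (rule finite_subset)
qed

lemma fresh_letter:
  fixes l l' :: "bool \<times> 'g"
  obtains t where "snd t \<in> X" "t \<noteq> l" "t \<noteq> l'"
proof -
  have "card (UNIV \<times> X :: (bool \<times> 'g) set) \<ge> 4" using card_X by (simp add: card_cartesian_product)
  moreover have "card {l, l'} \<le> 2" by (simp add: card_insert_if)
  moreover have "card (UNIV \<times> X :: (bool \<times> 'g) set) \<le> card {l, l'}"
    if "(UNIV \<times> X :: (bool \<times> 'g) set) \<subseteq> {l, l'}"
    using card_mono[OF _ that] by simp
  ultimately have "\<not> (UNIV \<times> X :: (bool \<times> 'g) set) \<subseteq> {l, l'}" by linarith
  then obtain t where "t \<in> UNIV \<times> X" "t \<notin> {l, l'}" by blast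
  then show ?thesis using that[of t] by (auto simp: mem_Times_iff)
qed

text \<open>Appending a letter and \<open>w\<close> to a word without occurrences of \<open>w\<close> creates a block as a prefix. That block is
  longer than the word by at most \<open>m\<close> letters, so a block arises from at most \<open>m + 1\<close> words and its length
  differs from theirs by a bounded amount. The bound may depend on \<open>w\<close>.\<close>
lemma avoiding_sum_bounded:
  assumes w: "w \<in> W" "w \<noteq> []" and s: "s \<ge> 0"
    and blocks: "\<And>B. finite B \<Longrightarrow> B \<subseteq> blocks X w \<Longrightarrow> weight s B \<le> q"
  shows "\<exists>\<alpha>. \<forall>A. finite A \<and> A \<subseteq> follows X (last w) \<and>
      (\<forall>g\<in>A. \<forall>i\<le>length g. \<not> ends_with w (take i g)) \<longrightarrow> weight s A \<le> \<alpha>"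
proof -
  obtain K where K: "K > 0" "\<And>w. w \<in> W \<Longrightarrow> L w \<le> K * real (length w)" using L_le_length by blast
  define m where "m = length w + 1"
  have complete: "\<exists>b. b \<in> blocks X w \<and> take (length g) b = g \<and> length g \<le> length b \<and>
      length b \<le> length g + m \<and> L b \<le> L g + K * real m"
    if g: "g \<in> follows X (last w)" and av: "\<And>i. i \<le> length g \<Longrightarrow> \<not> ends_with w (take i g)" for g
  proof -
    obtain t where t: "snd t \<in> X" "t \<noteq> inverse_letter (last (last w # g))" "t \<noteq> inverse_letter (hd w)"
      using fresh_letter .
    have tw: "[t] @ w \<in> W"
      unfolding reduced_words_append using w t inverse_letter_eq_iff[of t "hd w"] by auto
    have "(last w # g) @ ([t] @ w) \<in> W"
      unfolding reduced_words_append[of "last w # g"] using g tw t by (simp add: follows_def)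
    then have gtw: "g @ [t] @ w \<in> follows X (last w)" by (simp add: follows_def)
    have "ends_with w (take (length (g @ [t] @ w)) (g @ [t] @ w))"
      unfolding ends_with_def by (intro exI[of _ "g @ [t]"]) simp
    then obtain b r where b: "g @ [t] @ w = b @ r" "b \<in> blocks X w"
      using first_block[OF gtw order_refl _ w(2)] by blast
    have "\<not> length b \<le> length g"
    proof
      assume le: "length b \<le> length g"
      have "take (length b) (g @ [t] @ w) = b" using b(1) by simp
      then have "take (length b) g = b" using le by simp
      then show False using av[OF le] b(2) by (simp add: blocks_def)
    qed
    then have lt: "length g < length b" by simp
    have "take (length g) (g @ [t] @ w) = take (length g) (b @ r)" using b(1) by simp
    then have tk: "take (length g) b = g" using lt by simp
    have len: "length b \<le> length g + m" using arg_cong[OF b(1), of length] by (simp add: m_def)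
    define v where "v = drop (length g) b"
    have bv: "b = g @ v" using tk unfolding v_def by (metis append_take_drop_id)
    have bW: "b \<in> W" using b(2) blocks_reduced by blast
    then have vW: "v \<in> W" unfolding bv reduced_words_append by blast
    have "L b \<le> L g + L v" using L_sub[of g v] bW bv by simp
    also have "L v \<le> K * real (length v)" using K(2)[OF vW] .
    also have "\<dots> \<le> K * real m" using len K(1) by (intro mult_left_mono) (auto simp: v_def)
    finally have "L b \<le> L g + K * real m" by simp
    then show ?thesis using b tk lt len by auto
  qed
  define \<alpha> where "\<alpha> = exp (s * (K * real m)) * (real (m + 1) * q)"
  show ?thesis
  proof (intro exI allI impI)
    fix A assume "finite A \<and> A \<subseteq> follows X (last w) \<and> (\<forall>g\<in>A. \<forall>i\<le>length g. \<not> ends_with w (take i g))"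
    then have A: "finite A" "A \<subseteq> follows X (last w)"
      and av: "\<And>g i. g \<in> A \<Longrightarrow> i \<le> length g \<Longrightarrow> \<not> ends_with w (take i g)" by auto
    obtain b where b: "\<And>g. g \<in> A \<Longrightarrow> b g \<in> blocks X w \<and> take (length g) (b g) = g \<and> length g \<le> length (b g) \<and>
      length (b g) \<le> length g + m \<and> L (b g) \<le> L g + K * real m"
      using complete A(2) av by (metis subsetD)
    have "weight s A \<le> (\<Sum>g\<in>A. exp (s * (K * real m)) * exp (- s * L (b g)))"
    proof (rule sum_mono)
      fix g assume "g \<in> A"
      then have "s * L (b g) \<le> s * (L g + K * real m)" using b s by (intro mult_left_mono) auto
      then show "exp (- s * L g) \<le> exp (s * (K * real m)) * exp (- s * L (b g))"
        by (simp add: mult_exp_exp algebra_simps)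
    qed
    also have "\<dots> = exp (s * (K * real m)) * (\<Sum>g\<in>A. exp (- s * L (b g)))" by (simp add: sum_distrib_left)
    also have "(\<Sum>g\<in>A. exp (- s * L (b g))) = (\<Sum>c\<in>b ` A. \<Sum>g\<in>{g\<in>A. b g = c}. exp (- s * L (b g)))"
      using A(1) by (rule sum.image_gen)
    also have "\<dots> \<le> (\<Sum>c\<in>b ` A. real (m + 1) * exp (- s * L c))"
    proof (rule sum_mono)
      fix c assume "c \<in> b ` A"
      have "{g\<in>A. b g = c} \<subseteq> (\<lambda>i. take (length c - i) c) ` {..m}"
      proof
        fix g assume g: "g \<in> {g\<in>A. b g = c}"
        have "length c - (length c - length g) = length g" "length c - length g \<le> m" "take (length g) c = g"
          using b[of g] g by auto
        then show "g \<in> (\<lambda>i. take (length c - i) c) ` {..m}"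
          by (intro image_eqI[of _ _ "length c - length g"]) auto
      qed
      then have "card {g\<in>A. b g = c} \<le> card ((\<lambda>i. take (length c - i) c) ` {..m})" by (intro card_mono) auto
      also have "\<dots> \<le> m + 1" using card_image_le[of "{..m}"] by simp
      finally have "real (card {g\<in>A. b g = c}) \<le> real (m + 1)" by (rule of_nat_mono)
      moreover have "(\<Sum>g\<in>{g\<in>A. b g = c}. exp (- s * L (b g))) = real (card {g\<in>A. b g = c}) * exp (- s * L c)" by simp
      ultimately show "(\<Sum>g\<in>{g\<in>A. b g = c}. exp (- s * L (b g))) \<le> real (m + 1) * exp (- s * L c)"
        by (simp only: mult_right_mono exp_ge_zero)
    qed
    also have "\<dots> = real (m + 1) * weight s (b ` A)" by (simp add: sum_distrib_left)
    also have "\<dots> \<le> real (m + 1) * q" using A(1) b by (intro mult_left_mono blocks) auto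
    finally show "weight s A \<le> \<alpha>" by (simp add: \<alpha>_def)
  qed
qed

text \<open>A word either avoids \<open>w\<close> or is a block followed by a shorter word. If the blocks had mass at most \<open>1/2\<close>
  after correction for the error \<open>C\<close>, the sum over all words with at most \<open>n\<close> letters would be bounded by the
  sum over avoiding words plus half of itself, uniformly in \<open>n\<close>; but the series diverges at the growth
  rate. The bound obtained does not depend on \<open>w\<close>.\<close>
lemma block_mass:
  assumes w: "w \<in> W" "w \<noteq> []" and h: "growth_rate h"
  obtains B where "finite B" "B \<subseteq> blocks X w" "exp (h * C) * weight h B > 1 / 2"
proof (rule ccontr)
  assume "\<not> thesis"
  then have "\<nexists>B. finite B \<and> B \<subseteq> blocks X w \<and> exp (h * C) * weight h B > 1 / 2"
    using that by blast
  then have small: "exp (h * C) * weight h B \<le> 1 / 2"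
    if "finite B" "B \<subseteq> blocks X w" for B
    using that by (meson not_le)
  have h0: "h > 0" using growth_rate_pos[OF h] .
  define Z where "Z = follows X (last w)"
  have ZW: "Z \<subseteq> W" unfolding Z_def using follows_reduced by blast
  have small': "weight h B \<le> 1 / 2 * exp (- (h * C))" if "finite B" "B \<subseteq> blocks X w" for B
  proof -
    define S where "S = weight h B"
    have "exp (- (h * C)) * exp (h * C) = 1" unfolding mult_exp_exp by simp
    then have "S = exp (- (h * C)) * (exp (h * C) * S)" by (subst mult.assoc[symmetric]) simp
    also have "\<dots> \<le> exp (- (h * C)) * (1 / 2)"
      unfolding S_def by (intro mult_left_mono small that) simp
    finally show ?thesis by (simp add: S_def)
  qed
  obtain \<alpha> where \<alpha>: "\<forall>A. finite A \<and> A \<subseteq> follows X (last w) \<and>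
      (\<forall>g\<in>A. \<forall>i\<le>length g. \<not> ends_with w (take i g)) \<longrightarrow> weight h A \<le> \<alpha>"
    using avoiding_sum_bounded[OF w less_imp_le[OF h0], of "1 / 2 * exp (- (h * C))"] small' by metis
  have Zbound: "weight h {g \<in> Z. length g \<le> n} \<le> 2 * \<alpha>" for n
  proof -
    define Zn where "Zn = {g \<in> Z. length g \<le> n}"
    define A where "A = {g \<in> Zn. \<forall>i\<le>length g. \<not> ends_with w (take i g)}"
    define Bn where "Bn = {b \<in> blocks X w. length b \<le> n}"
    have fZ: "finite Zn" unfolding Zn_def
      by (rule rev_finite_subset[OF finite_short_words[of n]]) (use ZW in auto)
    have fB: "finite Bn" by (rule rev_finite_subset[OF fZ]) (auto simp: blocks_def Bn_def Zn_def Z_def)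
    have AZ: "A \<subseteq> Zn" by (auto simp: A_def)
    have parse: "Zn - A \<subseteq> (\<lambda>(b, g). b @ g) ` (Bn \<times> Zn)"
    proof
      fix g assume g: "g \<in> Zn - A"
      then obtain i where i: "i \<le> length g" "ends_with w (take i g)" by (auto simp: A_def)
      have "g \<in> follows X (last w)" using g by (auto simp: Zn_def Z_def)
      then obtain b g' where b: "g = b @ g'" "b \<in> blocks X w" "g' \<in> follows X (last w)"
        using first_block[OF _ i w(2)] by metis
      then have "(b, g') \<in> Bn \<times> Zn" using g by (auto simp: Bn_def Zn_def Z_def)
      then show "g \<in> (\<lambda>(b, g). b @ g) ` (Bn \<times> Zn)" using b(1) by force
    qed
    define S where "S = weight h Zn"
    have S0: "S \<ge> 0" unfolding S_def by (intro sum_nonneg) auto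
    have "weight h (Zn - A) \<le> weight h ((\<lambda>(b, g). b @ g) ` (Bn \<times> Zn))"
      using parse fB fZ by (intro sum_mono2) auto
    also have "\<dots> \<le> (\<Sum>(b, g)\<in>Bn \<times> Zn. exp (- h * L (b @ g)))"
      using sum_image_le[of "Bn \<times> Zn" "\<lambda>g. exp (- h * L g)" "\<lambda>(b, g). b @ g"] fB fZ
      by (simp add: o_def case_prod_beta)
    also have "\<dots> \<le> (\<Sum>(b, g)\<in>Bn \<times> Zn. exp (h * C) * exp (- h * L b) * exp (- h * L g))"
    proof (intro sum_mono, clarify)
      fix b g assume bg: "b \<in> Bn" "g \<in> Zn"
      then have "b @ g \<in> W" using block_append_follows[OF w(2)] follows_reduced
        unfolding Bn_def Zn_def Z_def by blast
      then have "h * (L b + L g) \<le> h * (L (b @ g) + C)" using L_quasi h0 by (intro mult_left_mono) auto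
      then show "exp (- h * L (b @ g)) \<le> exp (h * C) * exp (- h * L b) * exp (- h * L g)"
        by (simp add: mult_exp_exp algebra_simps)
    qed
    also have "\<dots> = exp (h * C) * weight h Bn * S"
      unfolding S_def sum_distrib_left[of "exp (h * C)"] sum_product sum.cartesian_product ..
    also have "\<dots> \<le> 1 / 2 * S"
      using S0 fB by (intro mult_right_mono small) (auto simp: Bn_def)
    finally have "weight h (Zn - A) \<le> S / 2" by simp
    moreover have "weight h A \<le> \<alpha>"
      using AZ fZ finite_subset[OF AZ fZ] by (intro \<alpha>[rule_format]) (auto simp: A_def Zn_def Z_def)
    moreover have "S = weight h (Zn - A) + weight h A"
      unfolding S_def using AZ fZ by (rule sum.subset_diff)
    ultimately show ?thesis unfolding Zn_def[symmetric] S_def[symmetric] by simp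
  qed
  obtain K where K: "K > 0" "\<And>w. w \<in> W \<Longrightarrow> L w \<le> K * real (length w)" using L_le_length by blast
  \<comment> \<open>a letter in front repairs words that cannot follow the last letter of \<open>w\<close>\<close>
  obtain t where t: "snd t \<in> X" "t \<noteq> inverse_letter (last w)" "t \<noteq> last w" using fresh_letter .
  have lw: "[last w] \<in> W" using last_letter_reduced[OF w] .
  have extend: "t # g \<in> Z" if "g \<in> W" "g \<notin> Z" for g
  proof -
    have "g \<noteq> []" "hd g = inverse_letter (last w)"
      using that lw reduced_words_append[of "[last w]" g X] by (auto simp: Z_def follows_def)
    then have "[t] @ g \<in> W" unfolding reduced_words_append using that t
      by (auto dest: arg_cong[of _ _ inverse_letter])
    then have "[last w] @ ([t] @ g) \<in> W" unfolding reduced_words_append[of "[last w]"] using lw t by simp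
    then show ?thesis by (simp add: Z_def follows_def)
  qed
  have "poincare_bounded h (2 * \<alpha> + exp (h * K) * (2 * \<alpha>))"
    unfolding poincare_bounded_def
  proof (intro allI impI)
    fix A assume A: "finite A \<and> A \<subseteq> W"
    have Zfin: "weight h A' \<le> 2 * \<alpha>" if "finite A'" "A' \<subseteq> Z" for A'
    proof -
      define n where "n = Max (insert 0 (length ` A'))"
      have "finite {g \<in> Z. length g \<le> n}"
        by (rule rev_finite_subset[OF finite_short_words[of n]]) (use ZW in auto)
      then have "weight h A' \<le> weight h {g \<in> Z. length g \<le> n}"
        using that unfolding n_def by (intro sum_mono2) auto
      then show ?thesis using Zbound[of n] by simp
    qed
    have "weight h (A - Z) \<le> (\<Sum>g\<in>A - Z. exp (h * K) * exp (- h * L (t # g)))"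
    proof (rule sum_mono)
      fix g assume g: "g \<in> A - Z"
      then have "[t] @ g \<in> W" using extend A ZW by auto
      then have "L (t # g) \<le> L [t] + L g" using L_sub[of "[t]" g] by simp
      also have "L [t] \<le> K" using K(2)[of "[t]"] t by simp
      finally have "h * L (t # g) \<le> h * (K + L g)" using h0 by (intro mult_left_mono) auto
      then show "exp (- h * L g) \<le> exp (h * K) * exp (- h * L (t # g))"
        by (simp add: mult_exp_exp algebra_simps)
    qed
    also have "\<dots> = exp (h * K) * weight h ((#) t ` (A - Z))"
      by (subst sum.reindex) (auto simp: sum_distrib_left)
    also have "\<dots> \<le> exp (h * K) * (2 * \<alpha>)"
      using A extend by (intro mult_left_mono Zfin) auto
    finally have 1: "weight h (A - Z) \<le> exp (h * K) * (2 * \<alpha>)" .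
    have "weight h A = weight h (A - Z) + weight h (A \<inter> Z)"
      using A by (subst sum.subset_diff[of "A \<inter> Z" A]) (auto simp: Diff_Int)
    then show "weight h A \<le> 2 * \<alpha> + exp (h * K) * (2 * \<alpha>)"
      using 1 Zfin[of "A \<inter> Z"] A by simp
  qed
  then show False using poincare_divergent[OF h] by blast
qed

end

text \<open>If \<open>L'\<close> exceeds \<open>L\<close> at \<open>w\<close> by \<open>D\<close>, then it does so at every block of \<open>w\<close> up to a constant that does not
  depend on \<open>w\<close>. For large \<open>D\<close> this raises the mass of the blocks from the lower bound for \<open>L'\<close> to more than 1
  for \<open>L\<close>, and \<open>L\<close> grows strictly faster than \<open>L'\<close>.\<close>
theorem growth_rigidity:
  assumes "quasi_length X L C" and "quasi_length X L' C'"
    and le: "\<And>w. w \<in> reduced_words X \<Longrightarrow> L w \<le> L' w + K"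
    and h: "quasi_length.growth_rate X L h" and h': "quasi_length.growth_rate X L' h'" and "h \<le> h'"
  obtains K' where "\<And>w. w \<in> reduced_words X \<Longrightarrow> L' w \<le> L w + K'"
proof -
  interpret A: quasi_length X L C by fact
  interpret B: quasi_length X L' C' by fact
  have h0: "h' > 0" using B.growth_rate_pos[OF h'] .
  have K0: "K \<ge> 0" using le[of "[]"] A.L_Nil B.L_Nil by simp
  \<comment> \<open>chosen so that the factor gained, \<open>exp (h' (D - C' - K))\<close>, is four times \<open>exp (h' C')\<close>\<close>
  define D where "D = 2 * C' + K + ln 4 / h'"
  have D0: "D \<ge> 0" using K0 B.C_nonneg h0 by (simp add: D_def)
  have "L' w \<le> L w + D" if wW: "w \<in> reduced_words X" for w
  proof (rule ccontr)
    assume "\<not> ?thesis"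
    then have gap: "L w < L' w - D" by simp
    have w: "w \<noteq> []" using gap D0 A.L_Nil B.L_Nil by auto
    obtain B where B: "finite B" "B \<subseteq> blocks X w"
      and mass: "exp (h' * C') * (\<Sum>b\<in>B. exp (- h' * L' b)) > 1 / 2"
      using B.block_mass[OF wW w h'] .
    have Lb: "L b \<le> L' b - (D - C' - K)" if "b \<in> B" for b
    proof -
      have bW: "b \<in> reduced_words X" using that B(2) blocks_reduced by blast
      have "ends_with w b" using that B(2) by (auto simp: blocks_def)
      then obtain c where c: "b = c @ w" by (auto simp: ends_with_def)
      have cW: "c \<in> reduced_words X" using bW unfolding c reduced_words_append by blast
      show ?thesis
        using A.L_sub[of c w] B.L_quasi[of c w] le[OF cW] gap bW unfolding c by simp
    qed
    have "exp (h' * (D - C' - K)) * exp (- (h' * C')) = 4"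
    proof -
      have "h' * (D - C' - K) - h' * C' = ln 4" using h0 by (simp add: D_def field_simps)
      then have "h' * (D - C' - K) + - (h' * C') = ln 4" by simp
      then show ?thesis unfolding mult_exp_exp by (simp only: exp_ln zero_less_numeral)
    qed
    moreover have "exp (- (h' * C')) / 2 < (\<Sum>b\<in>B. exp (- h' * L' b))"
      using mass by (simp add: exp_minus field_simps)
    then have "exp (h' * (D - C' - K)) * (exp (- (h' * C')) / 2) < exp (h' * (D - C' - K)) * (\<Sum>b\<in>B. exp (- h' * L' b))"
      by (intro mult_strict_left_mono) auto
    ultimately have "2 < exp (h' * (D - C' - K)) * (\<Sum>b\<in>B. exp (- h' * L' b))" by simp
    also have "\<dots> = (\<Sum>b\<in>B. exp (h' * (D - C' - K)) * exp (- h' * L' b))" by (simp add: sum_distrib_left)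
    also have "\<dots> \<le> (\<Sum>b\<in>B. exp (- h' * L b))"
    proof (rule sum_mono)
      fix b assume "b \<in> B"
      then have "h' * L b \<le> h' * (L' b - (D - C' - K))" using Lb h0 by (intro mult_left_mono) auto
      then show "exp (h' * (D - C' - K)) * exp (- h' * L' b) \<le> exp (- h' * L b)"
        by (simp add: mult_exp_exp algebra_simps)
    qed
    finally have "(\<Sum>b\<in>B. exp (- h' * L b)) > 1" by simp
    then have "h' < h" using A.growth_rate_gt_of_blocks[OF wW w B h] by simp
    then show False using \<open>h \<le> h'\<close> by simp
  qed
  then show ?thesis by (rule that)
qed

context rtree begin

section \<open>Points determined by translation lengths\<close>

text \<open>Having a positive Gromov product at \<open>w\<close> means leaving \<open>w\<close> in the same direction.\<close>
lemma gromov_pos_trans: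
  assumes "w \<in> M" "x \<in> M" "y \<in> M" "z \<in> M" "0 < gromov w x y" "0 < gromov w y z"
  shows "0 < gromov w x z"
  using gromov_hyperbolic[OF assms(1-4)] assms(5,6) by (simp add: min_def split: if_splits)

lemma gromov_zero_iff:
  "\<lbrakk>w \<in> M; x \<in> M; y \<in> M\<rbrakk> \<Longrightarrow> gromov w x y = 0 \<longleftrightarrow> \<not> 0 < gromov w x y"
  using gromov_nonneg[of w x y] by auto

lemma median:
  assumes "x \<in> M" "y \<in> M" "z \<in> M"
  obtains p where "p \<in> M" "between x p y" "between y p z" "between x p z"
proof -
  define t where "t = gromov x y z"
  have t: "0 \<le> t" "t \<le> d x y"
    using gromov_nonneg[of x y z] triangle[of x y z] assms by (auto simp: t_def gromov_def)
  obtain p where p: "p \<in> M" "d x p = t" "d p y = d x y - t" using segment_point[OF assms(1,2) t] by auto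
  have b: "between x p y" using p by (simp add: between_def)
  have "d z p = max (d z x - t) (d z y - (d x y - t))"
    using distance_to_segment_point[OF assms(1,2) p(1) assms(3) b] p by simp
  then have "d z p = d x z - t"
    using commute[of x z] commute[of y z] by (simp add: t_def gromov_def field_simps)
  then have zp: "d p z = d x z - t" "d y p = d x y - t" using p commute[of p z] commute[of y p] by simp_all
  have "between y p z" "between x p z"
    using p(2) zp commute[of x y] unfolding between_def t_def gromov_def by (simp_all add: field_simps)
  then show ?thesis using that[OF p(1) b] by simp
qed

text \<open>Among three points with median \<open>y\<close>, two are reached from \<open>x\<close> through \<open>y\<close>.\<close>
lemma dist_median_le:
  fixes e :: "nat \<Rightarrow> 'a"
  assumes e: "\<And>i. i < 3 \<Longrightarrow> e i \<in> M" and x: "x \<in> M" and y: "y \<in> M"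
    and med: "\<And>i j. i < 3 \<Longrightarrow> j < 3 \<Longrightarrow> i \<noteq> j \<Longrightarrow> between (e i) y (e j)"
    and gp: "\<And>i j. i < 3 \<Longrightarrow> j < 3 \<Longrightarrow> i \<noteq> j \<Longrightarrow> gromov x (e i) (e j) \<le> c"
  shows "d x y \<le> c"
proof -
  define v where "v i = d x (e i) - d (e i) y" for i :: nat
  have v: "d x y = max (v i) (v j)" if "i < 3" "j < 3" "i \<noteq> j" for i j
    using distance_to_segment_point[OF e[OF that(1)] e[OF that(2)] y x med[OF that]] commute[of y "e j"]
    by (simp add: v_def)
  have "\<exists>i j. i < 3 \<and> j < 3 \<and> i \<noteq> j \<and> v i = d x y \<and> v j = d x y"
  proof (cases "v 0 = d x y")
    case True
    have "v 1 = d x y \<or> v 2 = d x y" using v[of 1 2] by (auto simp: max_def split: if_splits)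
    then show ?thesis
    proof
      assume "v 1 = d x y" then show ?thesis using True by (intro exI[of _ 0] exI[of _ 1]) auto
    next
      assume "v 2 = d x y" then show ?thesis using True by (intro exI[of _ 0] exI[of _ 2]) auto
    qed
  next
    case False
    then have "v 1 = d x y" "v 2 = d x y" using v[of 0 1] v[of 0 2] by (auto simp: max_def split: if_splits)
    then show ?thesis by (intro exI[of _ 1] exI[of _ 2]) auto
  qed
  then obtain i j where ij: "i < 3" "j < 3" "i \<noteq> j" "v i = d x y" "v j = d x y" by blast
  then have "2 * d x y = d x (e i) + d x (e j) - d (e i) (e j)"
    using med[of i j] commute[of y "e j"] unfolding between_def v_def by simp
  then show ?thesis using gp[OF ij(1-3)] by (simp add: gromov_def)
qed

end

context free_tree_action begin

lemma tlen_one: "tlen \<one> = 0"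
proof -
  obtain x where "x \<in> M" using nonempty by blast
  then show ?thesis using tlen_le[of x \<one>] tlen_nonneg[of \<one>] by simp
qed

lemma tlen_eq_dist:
  assumes g: "g \<in> carrier G" and y: "y \<in> M" and gp: "gromov y (a (inv g) y) (a g y) = 0"
  shows "tlen g = d y (a g y)"
proof (rule tlen_axis[OF g y])
  have "d (a (inv g) y) (a g y) = d y (a (g \<otimes> g) y)" using g y by (simp add: a_mult dist_inv_left)
  moreover have "d y (a (inv g) y) = d y (a g y)" using dist_inv_right[OF g y y] by (simp add: commute)
  ultimately show "d y (a (g \<otimes> g) y) = 2 * d y (a g y)" using gp by (simp add: gromov_def)
qed

text \<open>The displacement of \<open>y\<close> by \<open>f\<close> is the maximum of three differences of translation lengths.\<close>
definition marks :: "(nat \<Rightarrow> 'g) \<Rightarrow> 'a \<Rightarrow> bool" where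
  "marks u y \<longleftrightarrow> y \<in> M \<and> (\<forall>f\<in>carrier G.
     (\<forall>i<3. tlen (f \<otimes> u i) \<le> d y (a f y) + tlen (u i)) \<and>
     (\<exists>i<3. d y (a f y) = tlen (f \<otimes> u i) - tlen (u i)))"

lemma marks_le: "\<lbrakk>marks u y; f \<in> carrier G; i < 3\<rbrakk> \<Longrightarrow> tlen (f \<otimes> u i) \<le> d y (a f y) + tlen (u i)"
  by (simp add: marks_def)

lemma marks_eq:
  assumes "marks u y" "f \<in> carrier G"
  obtains i where "i < 3" "d y (a f y) = tlen (f \<otimes> u i) - tlen (u i)"
  using assms unfolding marks_def by blast

text \<open>The axes of three elements pass through \<open>y\<close>, with pairwise different outgoing and pairwise different
  incoming directions. At most one element leaves \<open>y\<close> in the direction of \<open>f\<^sup>-\<^sup>1 y\<close>, and at most one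
  arrives from the direction of \<open>f y\<close>. For the remaining element \<open>v\<close>, the point \<open>y\<close> lies on the axis of \<open>f v\<close>,
  whose translation length therefore is \<open>d y (f y) + \<parallel>v\<parallel>\<close>.\<close>
lemma rich_point:
  assumes y: "y \<in> M" and u: "\<And>i. i < 3 \<Longrightarrow> u i \<in> carrier G" "\<And>i. i < 3 \<Longrightarrow> u i \<noteq> \<one>"
    and axis: "\<And>i. i < 3 \<Longrightarrow> tlen (u i) = d y (a (u i) y)"
    and out: "\<And>i j. i < 3 \<Longrightarrow> j < 3 \<Longrightarrow> i \<noteq> j \<Longrightarrow> gromov y (a (u i) y) (a (u j) y) = 0"
    and inc: "\<And>i j. i < 3 \<Longrightarrow> j < 3 \<Longrightarrow> i \<noteq> j \<Longrightarrow> gromov y (a (inv (u i)) y) (a (inv (u j)) y) = 0"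
  shows "marks u y"
  unfolding marks_def
proof (intro conjI ballI allI impI)
  show "y \<in> M" by (rule y)
next
  fix f i assume f: "f \<in> carrier G" and i: "i < (3 :: nat)"
  have "tlen (f \<otimes> u i) \<le> d y (a (f \<otimes> u i) y)" using y by (rule tlen_le)
  also have "\<dots> \<le> d y (a f y) + d y (a (u i) y)" using dist_mult_le f u i y by simp
  finally show "tlen (f \<otimes> u i) \<le> d y (a f y) + tlen (u i)" using axis[OF i] by simp
next
  fix f assume f: "f \<in> carrier G"
  show "\<exists>i<3. d y (a f y) = tlen (f \<otimes> u i) - tlen (u i)"
  proof (cases "f = \<one>")
    case True
    then show ?thesis using u y by (intro exI[of _ 0]) simp
  next
    case False
    define P where "P i \<longleftrightarrow> 0 < gromov y (a (inv f) y) (a (u i) y)" for i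
    define Q where "Q i \<longleftrightarrow> 0 < gromov y (a f y) (a (inv (u i)) y)" for i
    have P: "\<not> (P i \<and> P j)" if "i < 3" "j < 3" "i \<noteq> j" for i j
    proof
      assume "P i \<and> P j"
      then have "0 < gromov y (a (u i) y) (a (u j) y)"
        using gromov_pos_trans[of y "a (u i) y" "a (inv f) y" "a (u j) y"] y f u that
        by (simp add: P_def gromov_commute)
      then show False using out[OF that] by simp
    qed
    have Q: "\<not> (Q i \<and> Q j)" if "i < 3" "j < 3" "i \<noteq> j" for i j
    proof
      assume "Q i \<and> Q j"
      then have "0 < gromov y (a (inv (u i)) y) (a (inv (u j)) y)"
        using gromov_pos_trans[of y "a (inv (u i)) y" "a f y" "a (inv (u j)) y"] y f u that
        by (simp add: Q_def gromov_commute)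
      then show False using inc[OF that] by simp
    qed
    have "(0::nat) < 3" "(1::nat) < 3" "(2::nat) < 3" by auto
    then have "\<exists>i<3. \<not> P i \<and> \<not> Q i"
      using P[of 0 1] P[of 0 2] P[of 1 2] Q[of 0 1] Q[of 0 2] Q[of 1 2] by (metis one_neq_zero zero_neq_numeral one_eq_numeral_iff semiring_norm(85))
    then obtain i where i: "i < 3" "\<not> P i" "\<not> Q i" by blast
    define v where "v = u i"
    have v: "v \<in> carrier G" using u i by (simp add: v_def)
    define g where "g = f \<otimes> v"
    have g: "g \<in> carrier G" using f v by (simp add: g_def)
    have f0: "0 < d y (a f y)" using a_free[OF f y] False y f by auto
    have v0: "0 < d y (a v y)" using a_free[OF v y] u(2)[OF i(1)] y v by (auto simp: v_def)
    have dinv: "d y (a (inv k) y) = d y (a k y)" if "k \<in> carrier G" for k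
      using dist_inv_right[OF that y y] by (simp add: commute)
    have "gromov y (a (inv f) y) (a v y) = 0"
      using i(2) y f v gromov_zero_iff by (simp add: P_def v_def)
    then have dg: "d y (a g y) = d y (a f y) + d y (a v y)"
      using f v y dinv[OF f] by (simp add: g_def gromov_def a_mult dist_inv_left)
    have ginv: "a (inv g) y = a (inv v) (a (inv f) y)"
      using f v y by (simp add: g_def inv_mult_group a_mult)
    have 1: "0 < gromov y (a f y) (a g y)"
      using dg f0 f v y by (simp add: gromov_def g_def a_mult)
    have 2: "0 < gromov y (a (inv g) y) (a (inv v) y)"
    proof -
      have "d (a (inv g) y) (a (inv v) y) = d y (a f y)"
        using f v y dinv[OF f] by (simp add: ginv commute)
      then show ?thesis using dg v0 dinv[OF g] dinv[OF v] by (simp add: gromov_def)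
    qed
    have "\<not> 0 < gromov y (a (inv g) y) (a g y)"
    proof
      assume 3: "0 < gromov y (a (inv g) y) (a g y)"
      have "0 < gromov y (a f y) (a (inv g) y)"
        using gromov_pos_trans[of y "a f y" "a g y" "a (inv g) y"] 1 3 f g y
        by (simp add: gromov_commute)
      then have "0 < gromov y (a f y) (a (inv v) y)"
        using gromov_pos_trans[of y "a f y" "a (inv g) y" "a (inv v) y"] 2 f g v y by simp
      then show False using i(3) by (simp add: Q_def v_def)
    qed
    then have "tlen g = d y (a g y)" using tlen_eq_dist[OF g y] gromov_zero_iff g y by simp
    then have "d y (a f y) = tlen (f \<otimes> u i) - tlen (u i)" using dg axis[OF i(1)] by (simp add: g_def v_def)
    then show ?thesis using i(1) by blast
  qed
qed

end

text \<open>For large \<open>n\<close> the \<open>n\<close>-th powers of three letters span a tripod with long legs. The \<open>i\<close>-th marker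
  travels from the leg after the \<open>i\<close>-th, in cyclic order, to the \<open>i\<close>-th leg. The definition does
  not mention a tree, so one choice serves both trees.\<close>
definition marker :: "('g, 'm) monoid_scheme \<Rightarrow> (nat \<Rightarrow> bool \<times> 'g) \<Rightarrow> nat \<Rightarrow> nat \<Rightarrow> 'g" where
  "marker G l n i = word_value G (replicate n (l i)) \<otimes>\<^bsub>G\<^esub>
     inv\<^bsub>G\<^esub> (word_value G (replicate n (l ((i + 1) mod 3))))"

lemma replicate_reduced: "snd l \<in> X \<Longrightarrow> replicate n l \<in> reduced_words X"
proof (induction n)
  case (Suc n)
  have "l \<noteq> inverse_letter l" by (simp add: inverse_letter_def prod_eq_iff)
  then have "[l] @ replicate n l \<in> reduced_words X"
    unfolding reduced_words_append using Suc by (cases n) auto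
  then show ?case by simp
qed simp

lemma replicate_append_reduced:
  assumes "snd l \<in> X" "snd l' \<in> X" "l' \<noteq> inverse_letter l"
  shows "replicate n l @ replicate n l' \<in> reduced_words X"
  unfolding reduced_words_append using assms replicate_reduced[of l X n] replicate_reduced[of l' X n]
  by (cases n) (auto simp del: replicate_Suc simp: replicate_append_same[symmetric] hd_replicate last_replicate)

lemma inverse_word_replicate: "inverse_word (replicate n l) = replicate n (inverse_letter l)"
  by (simp add: inverse_word_def)

context free_group_action begin

lemma len_inverse:
  assumes "w \<in> lists (UNIV \<times> X)" "x \<in> M" shows "len x (inverse_word w) = len x w"
  using assms dist_inv_right[of "val w" x x] by (simp add: len_def val_inverse commute)

lemma long_powers:
  assumes x: "x \<in> M"
  obtains n0 where "\<And>n l. n \<ge> n0 \<Longrightarrow> l \<in> UNIV \<times> X \<Longrightarrow> R < len x (replicate n l)"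
proof -
  define B where "B = Max (insert 0 (length ` {w \<in> reduced_words X. len x w \<le> R}))"
  have B: "length w \<le> B" if "w \<in> reduced_words X" "len x w \<le> R" for w
    unfolding B_def using that finite_len_ball[OF x, of R] by (intro Max_ge) auto
  have "R < len x (replicate n l)" if "n \<ge> Suc B" "l \<in> UNIV \<times> X" for n l
  proof (rule ccontr)
    assume "\<not> ?thesis"
    then have "length (replicate n l) \<le> B" using that by (intro B replicate_reduced) (auto simp: mem_Times_iff)
    then show False using that by simp
  qed
  then show ?thesis by (rule that)
qed

text \<open>Let \<open>y\<close> be the centre of the tripod \<open>e 0, e 1, e 2\<close>. Bounded cancellation keeps \<open>y\<close> close to the base point
  and makes the image of \<open>y\<close> under \<open>E i (E j)\<^sup>-\<^sup>1\<close> leave \<open>y\<close> in the direction of \<open>e i\<close>. As the three directions at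
  the centre differ, the hypotheses of \<open>rich_point\<close> hold.\<close>
lemma marker_point:
  assumes inj: "inj_on l {..<3}" and l: "\<And>i. i < 3 \<Longrightarrow> l i \<in> UNIV \<times> X"
  obtains n0 where "\<And>n. n \<ge> n0 \<Longrightarrow> \<exists>y. marks (marker G l n) y"
proof -
  obtain x where x: "x \<in> M" using nonempty by blast
  obtain C where C: "C \<ge> 0" "\<And>u v. u @ v \<in> reduced_words X \<Longrightarrow> len x u + len x v \<le> len x (u @ v) + C"
    using bounded_cancellation[OF x] by blast
  \<comment> \<open>the argument needs legs longer than \<open>C / 2 + 2 d x y\<close>, and \<open>d x y \<le> C / 2\<close>\<close>
  obtain n0 where n0: "\<And>n l. n \<ge> n0 \<Longrightarrow> l \<in> UNIV \<times> X \<Longrightarrow> 2 * C + 1 < len x (replicate n l)"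
    using long_powers[OF x, of "2 * C + 1"] by blast
  show ?thesis
  proof (rule that)
    fix n assume n: "n \<ge> n0"
    define w where "w i = replicate n (l i)" for i
    define E where "E i = val (w i)" for i
    define e where "e i = a (E i) x" for i
    have wl: "w i \<in> lists (UNIV \<times> X)" if "i < 3" for i using l[OF that] by (auto simp: w_def)
    have Ec: "E i \<in> carrier G" if "i < 3" for i using wl[OF that] by (simp add: E_def)
    have eM: "e i \<in> M" if "i < 3" for i using Ec[OF that] x by (simp add: e_def)
    have dxe: "d x (e i) = len x (w i)" for i by (simp add: e_def E_def len_def)
    have red: "w i @ inverse_word (w j) \<in> reduced_words X" "inverse_word (w i) @ w j \<in> reduced_words X"
      if "i < 3" "j < 3" "i \<noteq> j" for i j
    proof -
      have ne: "l i \<noteq> l j" using inj that by (auto simp: inj_on_def)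
      then have "inverse_letter (l j) \<noteq> inverse_letter (l i)" by (metis inverse_letter_inverse)
      then show "w i @ inverse_word (w j) \<in> reduced_words X" "inverse_word (w i) @ w j \<in> reduced_words X"
        unfolding w_def inverse_word_replicate using l that ne
        by (auto intro!: replicate_append_reduced simp: mem_Times_iff)
    qed
    have dee: "d (e i) (e j) = len x (inverse_word (w i) @ w j)" if "i < 3" "j < 3" for i j
      using that wl x inverse_word_lists[OF wl[OF that(1)]] dist_inv_mult[OF Ec[OF that(1)] Ec[OF that(2)] x]
      by (simp add: len_def val_append val_inverse e_def E_def)
    have gpx: "gromov x (e i) (e j) \<le> C / 2" if "i < 3" "j < 3" "i \<noteq> j" for i j
      using C(2)[OF red(2)[OF that]] len_inverse[OF wl[OF that(1)] x]
      by (simp add: gromov_def dxe dee that)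
    obtain y where y: "y \<in> M" "between (e 0) y (e 1)" "between (e 1) y (e 2)" "between (e 0) y (e 2)"
      using median[of "e 0" "e 1" "e 2"] eM by auto
    have med: "between (e i) y (e j)" if "i < 3" "j < 3" "i \<noteq> j" for i j
    proof -
      have "i \<in> {0,1,2}" "j \<in> {0,1,2}" using that by auto
      then show ?thesis using y that(3) by (auto simp: between_sym)
    qed
    have \<delta>: "d x y \<le> C / 2" by (rule dist_median_le[OF eM x y(1) med gpx])
    have far: "0 < gromov y (a (E i \<otimes> inv (E j)) y) (e i)" if ij: "i < 3" "j < 3" "i \<noteq> j" for i j
    proof -
      define v where "v = E i \<otimes> inv (E j)"
      have v: "v \<in> carrier G" using Ec ij by (simp add: v_def)
      have "val (w i @ inverse_word (w j)) = v"
        using wl ij inverse_word_lists[OF wl[OF ij(2)]] by (simp add: v_def E_def val_append val_inverse)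
      then have dv: "d x (a v x) \<ge> len x (w i) + len x (w j) - C"
        using C(2)[OF red(1)[OF ij]] len_inverse[OF wl[OF ij(2)] x] by (simp add: len_def)
      have "d (a v x) (e i) = d (a (inv (E j)) x) x"
        using Ec ij x by (simp add: v_def e_def a_mult)
      also have "\<dots> = len x (w j)" using dist_inv_left[OF Ec[OF ij(2)] x x] dxe by (simp add: e_def)
      finally have ve: "d (a v x) (e i) = len x (w j)" .
      have "d x (a v x) \<le> d x y + d y (a v y) + d y x"
        using triangle[of x y "a v x"] triangle[of y "a v y" "a v x"] x y v by simp
      moreover have "d x (e i) \<le> d x y + d y (e i)" using x y eM ij by (intro triangle) auto
      moreover have "d (a v y) (e i) \<le> d y x + d (a v x) (e i)"
        using triangle[of "a v y" "a v x" "e i"] x y v eM ij by simp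
      moreover have "2 * C + 1 < len x (w i)" unfolding w_def by (intro n0 n l ij)
      ultimately have "0 < d y (a v y) + d y (e i) - d (a v y) (e i)"
        using dv ve \<delta> commute[of y x] dxe[of i] C(1) by linarith
      then show ?thesis by (simp add: gromov_def v_def)
    qed
    define nx where "nx i = (i + 1) mod 3" for i :: nat
    have nx: "nx i < 3" "nx i \<noteq> i" if "i < 3" for i
      using that unfolding nx_def by presburger+
    have nxinj: "nx i \<noteq> nx j" if "i < 3" "j < 3" "i \<noteq> j" for i j
      using that unfolding nx_def by presburger
    define u where "u i = marker G l n i" for i
    have u_eq: "u i = E i \<otimes> inv (E (nx i))" for i by (simp add: u_def marker_def E_def w_def nx_def)
    have uc: "u i \<in> carrier G" if "i < 3" for i using Ec that nx by (simp add: u_eq)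
    have out: "0 < gromov y (a (u i) y) (e i)" if "i < 3" for i
      unfolding u_eq using far[OF that nx(1)[OF that]] nx(2)[OF that] by metis
    have inc: "0 < gromov y (a (inv (u i)) y) (e (nx i))" if "i < 3" for i
    proof -
      have "inv (u i) = E (nx i) \<otimes> inv (E i)" using Ec that nx by (simp add: u_eq inv_mult_group)
      then show ?thesis using far[of "nx i" i] that nx by metis
    qed
    have med0: "\<not> 0 < gromov y (e i) (e j)" if "i < 3" "j < 3" "i \<noteq> j" for i j
      using med[OF that] by (simp add: between_iff_gromov)
    have transfer: "gromov y p q = 0"
      if "p \<in> M" "q \<in> M" "0 < gromov y p (e i)" "0 < gromov y q (e j)" "i < 3" "j < 3" "i \<noteq> j" for p q i j
    proof (rule ccontr)
      assume "\<not> ?thesis"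
      then have pq: "0 < gromov y p q" using gromov_zero_iff that y by simp
      have "0 < gromov y (e i) q"
        using gromov_pos_trans[of y "e i" p q] that pq y eM by (simp add: gromov_commute)
      then have "0 < gromov y (e i) (e j)"
        using gromov_pos_trans[of y "e i" q "e j"] that y eM by simp
      then show False using med0 that by simp
    qed
    have ax: "gromov y (a (inv (u i)) y) (a (u i) y) = 0" if "i < 3" for i
      using transfer[OF _ _ inc[OF that] out[OF that]] that nx uc y by simp
    have u1: "u i \<noteq> \<one>" if "i < 3" for i
    proof
      assume "u i = \<one>"
      then have "0 < gromov y y (e i)" using out[OF that] y by simp
      then show False using y by (simp add: gromov_def)
    qed
    have "marks u y"
    proof (rule rich_point[OF y(1) uc u1])
      show "tlen (u i) = d y (a (u i) y)" if "i < 3" for i using tlen_eq_dist[OF uc y(1) ax] that by simp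
      show "gromov y (a (u i) y) (a (u j) y) = 0" if "i < 3" "j < 3" "i \<noteq> j" for i j
        using transfer[OF _ _ out out] that uc y by simp
      show "gromov y (a (inv (u i)) y) (a (inv (u j)) y) = 0" if "i < 3" "j < 3" "i \<noteq> j" for i j
        using transfer[OF _ _ inc inc] that uc y nx nxinj by simp
    qed
    moreover have "u = marker G l n" by (simp add: u_def fun_eq_iff)
    ultimately show "\<exists>y. marks (marker G l n) y" by blast
  qed
qed

lemma quasi_length_len:
  assumes x: "x \<in> M" obtains C where "quasi_length X (len x) C"
proof -
  obtain C where C: "C \<ge> 0" "\<And>u v. u @ v \<in> reduced_words X \<Longrightarrow> len x u + len x v \<le> len x (u @ v) + C"
    using bounded_cancellation[OF x] by blast
  have "quasi_length X (len x) C"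
  proof
    show "len x (u @ v) \<le> len x u + len x v" if "u @ v \<in> reduced_words X" for u v
      using len_subadditive[OF x] reduced_words_lists[OF that] by simp
  qed (use finite_basis basis_card finite_len_ball[OF x] C x in \<open>auto simp: len_def\<close>)
  then show ?thesis by (rule that)
qed

lemma orbit_count:
  assumes x: "x \<in> M"
  shows "card {g \<in> carrier G. d x (a g x) \<le> R} = card {w \<in> reduced_words X. len x w \<le> R}"
proof -
  have "val ` {w \<in> reduced_words X. len x w \<le> R} = {g \<in> val ` reduced_words X. d x (a g x) \<le> R}"
    by (auto simp: len_def)
  moreover have "inj_on val {w \<in> reduced_words X. len x w \<le> R}"
    by (rule inj_on_subset[OF bij_betw_imp_inj_on[OF val_bij]]) blast
  ultimately have "bij_betw val {w \<in> reduced_words X. len x w \<le> R} {g \<in> carrier G. d x (a g x) \<le> R}"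
    unfolding bij_betw_def bij_betw_imp_surj_on[OF val_bij] by (intro conjI)
  then show ?thesis by (rule bij_betw_same_card[symmetric])
qed

end

context quasi_length begin

lemma scale:
  assumes "c > 0" shows "quasi_length X (\<lambda>w. c * L w) (c * C)"
proof
  fix u v assume "u @ v \<in> W"
  then show "c * L (u @ v) \<le> c * L u + c * L v"
    using mult_left_mono[OF L_sub[of u v], of c] assms by (simp add: distrib_left)
next
  fix u v assume "u @ v \<in> W"
  then show "c * L u + c * L v \<le> c * L (u @ v) + c * C"
    using mult_left_mono[OF L_quasi[of u v], of c] assms by (simp add: distrib_left)
next
  fix R
  have "{w \<in> W. c * L w \<le> R} = {w \<in> W. L w \<le> R / c}" using assms by (auto simp: field_simps)
  then show "finite {w \<in> W. c * L w \<le> R}" using finite_ball by simp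
qed (use assms finite_X card_X L_Nil L_nonneg in auto)

lemma growth_rate_scale:
  assumes c: "c > 0" and h: "growth_rate h"
  shows "quasi_length.growth_rate X (\<lambda>w. c * L w) (h / c)"
proof -
  interpret S: quasi_length X "\<lambda>w. c * L w" "c * C" using scale[OF c] .
  have N: "S.N R = N (R / c)" for R
  proof -
    have "{w \<in> W. c * L w \<le> R} = {w \<in> W. L w \<le> R / c}" using c by (auto simp: field_simps)
    then show ?thesis by (simp add: S.N_def N_def)
  qed
  have "filterlim (\<lambda>R. R / c) at_top at_top"
    using filterlim_tendsto_pos_mult_at_top[OF tendsto_const, of "1 / c" "\<lambda>R. R" at_top] c
    by (simp add: filterlim_ident)
  then have "((\<lambda>R. ln (N (R / c)) / (R / c)) \<longlongrightarrow> h) at_top"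
    using filterlim_compose h unfolding growth_rate_def by blast
  then have "((\<lambda>R. ln (N (R / c)) / (R / c) / c) \<longlongrightarrow> h / c) at_top"
    using c by (intro tendsto_divide tendsto_const) auto
  then show ?thesis unfolding S.growth_rate_def N using c by simp
qed

end

text \<open>If \<open>h < h'\<close>, the series for \<open>L\<close> would be bounded at the exponent \<open>h'\<close>, and with it the series for \<open>L'\<close>,
  which diverges there.\<close>
lemma growth_rate_mono:
  assumes "quasi_length X L C" and "quasi_length X L' C'"
    and le: "\<And>w. w \<in> reduced_words X \<Longrightarrow> L w \<le> L' w + K"
    and h: "quasi_length.growth_rate X L h" and h': "quasi_length.growth_rate X L' h'"
  shows "h' \<le> h"
proof (rule ccontr)
  interpret A: quasi_length X L C by fact
  interpret B: quasi_length X L' C' by fact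
  assume "\<not> ?thesis"
  then obtain Q where Q: "A.poincare_bounded h' Q" using A.poincare_convergent[OF h, of h'] by auto
  have h0: "h' > 0" using B.growth_rate_pos[OF h'] .
  have "B.poincare_bounded h' (exp (h' * K) * Q)"
    unfolding B.poincare_bounded_def
  proof (intro allI impI)
    fix A assume A: "finite A \<and> A \<subseteq> reduced_words X"
    have "(\<Sum>w\<in>A. exp (- h' * L' w)) \<le> (\<Sum>w\<in>A. exp (h' * K) * exp (- h' * L w))"
    proof (rule sum_mono)
      fix w assume "w \<in> A"
      then have "h' * L w \<le> h' * (L' w + K)" using le A h0 by (intro mult_left_mono) auto
      then show "exp (- h' * L' w) \<le> exp (h' * K) * exp (- h' * L w)"
        by (simp add: mult_exp_exp algebra_simps)
    qed
    also have "\<dots> = exp (h' * K) * (\<Sum>w\<in>A. exp (- h' * L w))" by (simp add: sum_distrib_left)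
    also have "\<dots> \<le> exp (h' * K) * Q"
      using Q A unfolding A.poincare_bounded_def by (intro mult_left_mono) auto
    finally show "(\<Sum>w\<in>A. exp (- h' * L' w)) \<le> exp (h' * K) * Q" .
  qed
  then show False using B.poincare_divergent[OF h'] by blast
qed

section \<open>Comparison of two actions\<close>
locale two_actions = A: free_group_action M d G a X + B: free_group_action M' d' G a' X
  for M :: "'a set" and d and G :: "('g, 'm) monoid_scheme" (structure) and a and X
    and M' :: "'b set" and d' and a'
begin

lemma common_marker:
  obtains u y y' where "\<And>i. u i \<in> carrier G" "A.marks u y" "B.marks u y'"
proof -
  obtain p q where pq: "p \<in> X" "q \<in> X" "p \<noteq> q"
    using A.basis_card card_le_Suc0_iff_eq[OF A.finite_basis] by (metis not_less_eq_eq numeral_2_eq_2)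
  define l where "l i = (if i = 0 then (True, p) else if i = 1 then (True, q) else (False, p))" for i :: nat
  have inj: "inj_on l {..<3}" using pq by (auto simp: inj_on_def l_def)
  have lX: "l i \<in> UNIV \<times> X" for i using pq by (auto simp: l_def)
  obtain n1 where n1: "\<And>n. n \<ge> n1 \<Longrightarrow> \<exists>y. A.marks (marker G l n) y"
    using A.marker_point[OF inj lX] by blast
  obtain n2 where n2: "\<And>n. n \<ge> n2 \<Longrightarrow> \<exists>y. B.marks (marker G l n) y"
    using B.marker_point[OF inj lX] by blast
  define u where "u = marker G l (max n1 n2)"
  have uc: "u i \<in> carrier G" for i
  proof -
    have "replicate n (l j) \<in> lists (UNIV \<times> X)" for n j
      by (rule in_listsI) (metis in_set_replicate lX)
    then show ?thesis unfolding u_def marker_def by (intro A.m_closed A.inv_closed A.val_closed)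
  qed
  show ?thesis
    using that[OF uc] n1[of "max n1 n2"] n2[of "max n1 n2"] unfolding u_def by auto
qed

text \<open>At a marker point the distance is at most one of the three translation lengths \<open>\<parallel>g u\<parallel>\<close>, and in the other
  tree \<open>\<parallel>g u\<parallel>\<close> is at most the displacement of any base point by \<open>g u\<close>.\<close>
lemma dist_le_of_tlen_le:
  assumes le: "\<And>g. g \<in> carrier G \<Longrightarrow> A.tlen g \<le> c * B.tlen g" and c: "c \<ge> 0"
    and x: "x \<in> M" and x': "x' \<in> M'"
  obtains K where "\<And>g. g \<in> carrier G \<Longrightarrow> d x (a g x) \<le> c * d' x' (a' g x') + K"
proof -
  obtain u y y' where uc: "\<And>i. u i \<in> carrier G" and m: "A.marks u y" "B.marks u y'"
    using common_marker by blast
  have y: "y \<in> M" using m(1) by (simp add: A.marks_def)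
  define U where "U = (\<Sum>i<3. d' x' (a' (u i) x'))"
  have "d x (a g x) \<le> c * d' x' (a' g x') + (2 * d x y + c * U)" if g: "g \<in> carrier G" for g
  proof -
    obtain i where i: "i < 3" "d y (a g y) = A.tlen (g \<otimes> u i) - A.tlen (u i)" using A.marks_eq[OF m(1) g] .
    have gu: "g \<otimes> u i \<in> carrier G" using g uc i by simp
    have "d y (a g y) \<le> A.tlen (g \<otimes> u i)" using i A.tlen_nonneg[of "u i"] by simp
    also have "\<dots> \<le> c * B.tlen (g \<otimes> u i)" using le gu by simp
    also have "\<dots> \<le> c * (d' x' (a' g x') + d' x' (a' (u i) x'))"
      using B.tlen_le[OF x', of "g \<otimes> u i"] B.dist_mult_le[OF g uc[of i] x'] c
      by (intro mult_left_mono) auto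
    also have "\<dots> \<le> c * (d' x' (a' g x') + U)"
      using member_le_sum[of i "{..<3}" "\<lambda>i. d' x' (a' (u i) x')"] i c by (intro mult_left_mono) (auto simp: U_def)
    finally have "d y (a g y) \<le> c * (d' x' (a' g x') + U)" .
    moreover have "d x (a g x) \<le> d x y + d y (a g y) + d y x"
      using A.triangle[of x y "a g x"] A.triangle[of y "a g y" "a g x"] x y g by simp
    ultimately show ?thesis using A.commute[of x y] by (simp add: distrib_left)
  qed
  then show ?thesis by (rule that)
qed

text \<open>Additive constants disappear on dividing the displacement by \<open>g\<^sup>n\<close> by \<open>n\<close>.\<close>
lemma tlen_le_of_dist_le:
  assumes le: "\<And>g. g \<in> carrier G \<Longrightarrow> c * d' x' (a' g x') \<le> d x (a g x) + K" and c: "c \<ge> 0"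
    and x: "x \<in> M" and x': "x' \<in> M'" and g: "g \<in> carrier G"
  shows "c * B.tlen g \<le> A.tlen g"
proof (rule field_le_epsilon)
  fix e :: real assume "e > 0"
  obtain Q where Q: "\<And>n. d x (a (g [^] n) x) \<le> real n * (A.tlen g + e) + Q"
    using A.pow_dist_upper[OF g x \<open>e > 0\<close>] by blast
  have bnd: "real n * (c * B.tlen g - (A.tlen g + e)) \<le> K + Q" for n
  proof -
    have "real n * B.tlen g \<le> d' x' (a' (g [^] n) x')" by (rule B.tlen_pow_le[OF g x'])
    then have "c * (real n * B.tlen g) \<le> c * d' x' (a' (g [^] n) x')" using c by (rule mult_left_mono)
    also have "\<dots> \<le> d x (a (g [^] n) x) + K" using g by (intro le) simp
    finally show ?thesis using Q[of n] by (simp add: algebra_simps)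
  qed
  show "c * B.tlen g \<le> A.tlen g + e"
  proof (rule ccontr)
    assume "\<not> ?thesis"
    then have "c * B.tlen g - (A.tlen g + e) > 0" by simp
    then obtain n where "K + Q < real n * (c * B.tlen g - (A.tlen g + e))" using reals_Archimedean3 by blast
    then show False using bnd[of n] by simp
  qed
qed

theorem entropy_comparison:
  assumes le: "\<And>g. g \<in> carrier G \<Longrightarrow> A.tlen g \<le> c * B.tlen g" and c: "c > 0"
    and x: "x \<in> M" and x': "x' \<in> M'"
    and h: "quasi_length.growth_rate X (A.len x) h" and h': "quasi_length.growth_rate X (B.len x') h'"
  shows "h' \<le> c * h" and "h' = c * h \<Longrightarrow> g \<in> carrier G \<Longrightarrow> A.tlen g = c * B.tlen g"
proof -
  obtain C where C: "quasi_length X (A.len x) C" using A.quasi_length_len[OF x] .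
  obtain C' where C': "quasi_length X (B.len x') C'" using B.quasi_length_len[OF x'] .
  note S = quasi_length.scale[OF C' c] and hS = quasi_length.growth_rate_scale[OF C' c h']
  obtain K where K: "\<And>g. g \<in> carrier G \<Longrightarrow> d x (a g x) \<le> c * d' x' (a' g x') + K"
    using dist_le_of_tlen_le[OF le less_imp_le[OF c] x x'] by blast
  have len: "A.len x w \<le> c * B.len x' w + K" if "w \<in> reduced_words X" for w
    unfolding A.len_def B.len_def using A.reduced_words_lists[OF that] by (intro K) simp
  have "h' / c \<le> h" by (rule growth_rate_mono[OF C S len h hS])
  then show "h' \<le> c * h" using c by (simp add: field_simps)
  assume eq: "h' = c * h" and g: "g \<in> carrier G"
  then have "h \<le> h' / c" using c by simp
  then obtain K' where K': "\<And>w. w \<in> reduced_words X \<Longrightarrow> c * B.len x' w \<le> A.len x w + K'"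
    using growth_rigidity[OF C S len h hS] by blast
  have "c * d' x' (a' g x') \<le> d x (a g x) + K'" if "g \<in> carrier G" for g
  proof -
    obtain w where "w \<in> reduced_words X" "A.val w = g" using A.val_surj \<open>g \<in> carrier G\<close> by metis
    then show ?thesis using K'[of w] by (simp add: A.len_def B.len_def)
  qed
  then have "c * B.tlen g \<le> A.tlen g" using tlen_le_of_dist_le[OF _ less_imp_le[OF c] x x' g] by blast
  then show "A.tlen g = c * B.tlen g" using le[OF g] by simp
qed

text \<open>Subwords of a fixed number \<open>m\<close> of letters have length at least \<open>C' + 1\<close>, so each contributes at least 1
  and the length of a word in one tree bounds its number of letters, hence its length in the other
  tree. This makes the supremum of the ratios finite.\<close>
lemma translation_lengths_comparable:
  obtains c where "c > 0" "\<And>g. g \<in> carrier G \<Longrightarrow> A.tlen g \<le> c * B.tlen g"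
proof -
  obtain x where x: "x \<in> M" using A.nonempty by blast
  obtain x' where x': "x' \<in> M'" using B.nonempty by blast
  obtain C' where C': "quasi_length X (B.len x') C'" using B.quasi_length_len[OF x'] .
  interpret Q: quasi_length X "B.len x'" C' by fact
  obtain K where K: "K \<ge> 0" "\<And>w. w \<in> lists (UNIV \<times> X) \<Longrightarrow> A.len x w \<le> K * real (length w)"
    using A.len_le_length[OF x] by blast
  define b where "b = Max (insert 0 (length ` {w \<in> reduced_words X. B.len x' w \<le> C' + 1}))"
  define m where "m = Suc b"
  have long: "B.len x' w \<ge> C' + 1" if "w \<in> reduced_words X" "length w = m" for w
  proof (rule ccontr)
    assume "\<not> ?thesis"
    then have "length w \<le> b" unfolding b_def using that Q.finite_ball[of "C' + 1"] by (intro Max_ge) auto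
    then show False using that by (simp add: m_def)
  qed
  have lower: "real (length w) \<le> real m * (B.len x' w + 1)" if "w \<in> reduced_words X" for w
    using that
  proof (induction w rule: length_induct)
    case (1 w)
    show ?case
    proof (cases "length w \<le> m")
      case True
      then have "real (length w) \<le> real m * 1" by simp
      also have "\<dots> \<le> real m * (B.len x' w + 1)" using Q.L_nonneg[OF 1(2)] by (intro mult_left_mono) auto
      finally show ?thesis .
    next
      case False
      have w: "take m w @ drop m w \<in> reduced_words X" using 1(2) by simp
      then have td: "take m w \<in> reduced_words X" "drop m w \<in> reduced_words X"
        unfolding reduced_words_append by auto
      have shorter: "length (drop m w) < length w" using False by (simp add: m_def)
      have "real (length (drop m w)) \<le> real m * (B.len x' (drop m w) + 1)"
        using 1(1)[rule_format, OF shorter td(2)] .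
      also have "\<dots> \<le> real m * (B.len x' w + C' - B.len x' (take m w) + 1)"
        using Q.L_quasi[OF w] by (intro mult_left_mono) auto
      also have "\<dots> \<le> real m * B.len x' w"
        using long[OF td(1)] False by (intro mult_left_mono) auto
      finally show ?thesis using False by (simp add: algebra_simps)
    qed
  qed
  define c where "c = K * real m + 1"
  have c: "c > 0" using K by (simp add: c_def add_nonneg_pos)
  have dist: "d x (a g x) \<le> c * d' x' (a' g x') + c" if "g \<in> carrier G" for g
  proof -
    obtain w where w: "w \<in> reduced_words X" "A.val w = g" using A.val_surj \<open>g \<in> carrier G\<close> by metis
    have "A.len x w \<le> K * real (length w)" using K A.reduced_words_lists[OF w(1)] by simp
    also have "\<dots> \<le> K * (real m * (B.len x' w + 1))" using lower[OF w(1)] K by (intro mult_left_mono) auto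
    also have "\<dots> \<le> c * (B.len x' w + 1)"
      using Q.L_nonneg[OF w(1)] unfolding c_def by (simp add: algebra_simps)
    finally show ?thesis using w by (simp add: A.len_def B.len_def distrib_left)
  qed
  have "A.tlen g \<le> c * B.tlen g" if g: "g \<in> carrier G" for g
  proof -
    interpret R: two_actions M' d' G a' X M d a by unfold_locales
    have "(1 / c) * d x (a g x) \<le> d' x' (a' g x') + 1" if "g \<in> carrier G" for g
      using dist[OF that] c by (simp add: field_simps)
    then have "(1 / c) * A.tlen g \<le> B.tlen g" using R.tlen_le_of_dist_le[of "1 / c" x x' 1 g] c x x' g by simp
    then show ?thesis using c by (simp add: field_simps)
  qed
  then show ?thesis using that c by blast
qed

end

context free_group_action begin

section \<open>Extending a homothety of orbits\<close>
lemma determined_by_orbit_distances: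
  assumes y: "y \<in> M" and p: "p \<in> M" and q: "q \<in> M"
    and eq: "\<And>g. g \<in> carrier G \<Longrightarrow> d p (a g y) = d q (a g y)"
  shows "p = q"
proof -
  obtain f where f: "f \<in> carrier G" "between y p (a f y)" using orbit_star_covers[OF y p] by blast
  have yq: "d y p = d y q" using eq[of \<one>] y commute[of y p] commute[of y q] by simp
  then have "between y q (a f y)" using f eq[of f] by (simp add: between_def)
  then show ?thesis using between_unique[OF y _ p q f(2)] yq y f by simp
qed

lemma ex_nontrivial: "carrier G - {\<one>} \<noteq> {}"
proof -
  obtain e where e: "e \<in> X" using basis_card by (metis card.empty ex_in_conv not_numeral_le_zero)
  have "[(True, e)] \<in> reduced_words X" using e by simp
  then have "val [(True, e)] \<noteq> val []"
    using inj_onD[OF bij_betw_imp_inj_on[OF val_bij], of "[(True, e)]" "[]"] by auto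
  moreover have "val [(True, e)] \<in> carrier G" using e by (intro val_closed) auto
  ultimately show ?thesis by auto
qed

end

context two_actions begin

text \<open>A point of the tree is determined by its distances to the orbit of \<open>y\<close>. Every point lies on a segment
  from \<open>y\<close> to a point of the orbit, and its distances to all other points of the orbit follow from
  \<open>distance_to_segment_point\<close>; the same formula in the other tree yields a point with proportional distances.
  Mapping the one to the other is equivariant by uniqueness, and a homothety by the same formula.\<close>
lemma orbit_isometry_extends:
  assumes c: "c > 0" and y: "y \<in> M" and y': "y' \<in> M'"
    and eq: "\<And>f. f \<in> carrier G \<Longrightarrow> d y (a f y) = c * d' y' (a' f y')"
  shows "\<exists>\<phi>. \<phi> ` M = M' \<and> (\<forall>p\<in>M. \<forall>q\<in>M. c * d' (\<phi> p) (\<phi> q) = d p q) \<and>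
    (\<forall>g\<in>carrier G. \<forall>p\<in>M. \<phi> (a g p) = a' g (\<phi> p))"
proof -
  have orb: "d (a f y) (a g y) = c * d' (a' f y') (a' g y')" if "f \<in> carrier G" "g \<in> carrier G" for f g
    using that eq[of "inv f \<otimes> g"] y y' by (simp add: A.dist_inv_mult B.dist_inv_mult)
  have orb1: "d (a f y) y = c * d' (a' f y') y'" if "f \<in> carrier G" for f
    using orb[OF that A.one_closed] y y' by simp
  have ex: "\<exists>p'. p' \<in> M' \<and> (\<forall>g\<in>carrier G. d p (a g y) = c * d' p' (a' g y'))" if p: "p \<in> M" for p
  proof -
    obtain f where f: "f \<in> carrier G" "A.between y p (a f y)" using A.orbit_star_covers[OF y p] by blast
    have D: "d y p + d p (a f y) = c * d' y' (a' f y')" using f eq[OF f(1)] by (simp add: A.between_def)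
    have "d y p / c \<le> d' y' (a' f y')" using D c A.nonneg[of p "a f y"] by (simp add: field_simps del: A.nonneg)
    then obtain p' where p': "p' \<in> M'" "d' y' p' = d y p / c" "d' p' (a' f y') = d' y' (a' f y') - d y p / c"
      using B.segment_point[of y' "a' f y'" "d y p / c"] y' f c by auto
    then have cp: "d y p = c * d' y' p'" "d p (a f y) = c * d' p' (a' f y')"
      using D c by (simp_all add: field_simps)
    have b': "B.between y' p' (a' f y')" using p' by (simp add: B.between_def)
    have "d p (a g y) = c * d' p' (a' g y')" if g: "g \<in> carrier G" for g
    proof -
      have "d (a g y) p = max (d (a g y) y - d y p) (d (a g y) (a f y) - d p (a f y))"
        using f g y p by (intro A.distance_to_segment_point) auto
      also have "\<dots> = max (c * (d' (a' g y') y' - d' y' p')) (c * (d' (a' g y') (a' f y') - d' p' (a' f y')))"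
        using orb[OF g f(1)] orb1[OF g] cp by (simp add: right_diff_distrib)
      also have "\<dots> = c * max (d' (a' g y') y' - d' y' p') (d' (a' g y') (a' f y') - d' p' (a' f y'))"
        using c by (simp add: max_mult_distrib_left)
      also have "\<dots> = c * d' (a' g y') p'"
        using f g y' p' b' by (subst B.distance_to_segment_point[of y' "a' f y'" p' "a' g y'"]) auto
      finally show ?thesis by (simp add: A.commute B.commute)
    qed
    then show ?thesis using p'(1) by blast
  qed
  then obtain \<phi> where \<phi>: "\<And>p. p \<in> M \<Longrightarrow> \<phi> p \<in> M'"
    "\<And>p g. p \<in> M \<Longrightarrow> g \<in> carrier G \<Longrightarrow> d p (a g y) = c * d' (\<phi> p) (a' g y')" by metis
  have \<phi>1: "d p y = c * d' (\<phi> p) y'" if "p \<in> M" for p using \<phi>(2)[OF that A.one_closed] y y' by simp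
  have isom: "c * d' (\<phi> p) (\<phi> q) = d p q" if p: "p \<in> M" and q: "q \<in> M" for p q
  proof -
    obtain f where f: "f \<in> carrier G" "A.between y p (a f y)" using A.orbit_star_covers[OF y p] by blast
    have "c * (d' y' (\<phi> p) + d' (\<phi> p) (a' f y')) = c * d' y' (a' f y')"
      using f(2) \<phi>(2)[OF p f(1)] \<phi>1[OF p] eq[OF f(1)] A.commute[of y p] B.commute[of y' "\<phi> p"]
      by (simp add: A.between_def distrib_left)
    then have b': "B.between y' (\<phi> p) (a' f y')" using c by (simp add: B.between_def)
    have "d q p = max (d q y - d y p) (d q (a f y) - d p (a f y))"
      using f y p q by (intro A.distance_to_segment_point) auto
    also have "\<dots> = max (c * (d' (\<phi> q) y' - d' y' (\<phi> p))) (c * (d' (\<phi> q) (a' f y') - d' (\<phi> p) (a' f y')))"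
      using \<phi>(2)[OF p f(1)] \<phi>(2)[OF q f(1)] \<phi>1[OF p] \<phi>1[OF q] A.commute[of y p] B.commute[of y' "\<phi> p"]
      by (simp add: right_diff_distrib)
    also have "\<dots> = c * max (d' (\<phi> q) y' - d' y' (\<phi> p)) (d' (\<phi> q) (a' f y') - d' (\<phi> p) (a' f y'))"
      using c by (simp add: max_mult_distrib_left)
    also have "\<dots> = c * d' (\<phi> q) (\<phi> p)"
      using f y' \<phi>(1) p q b' by (subst B.distance_to_segment_point[of y' "a' f y'" "\<phi> p" "\<phi> q"]) auto
    finally show ?thesis by (simp add: A.commute B.commute)
  qed
  have equivar: "\<phi> (a g p) = a' g (\<phi> p)" if g: "g \<in> carrier G" and p: "p \<in> M" for g p
  proof (rule B.determined_by_orbit_distances[OF y'])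
    fix h assume h: "h \<in> carrier G"
    have gh: "inv g \<otimes> h \<in> carrier G" using g h by simp
    have "c * d' (\<phi> (a g p)) (a' h y') = d (a g p) (a h y)" using \<phi>(2)[of "a g p" h] g p h by simp
    also have "\<dots> = d p (a (inv g \<otimes> h) y)" using g p h y by (simp add: A.a_mult A.dist_inv_right)
    also have "\<dots> = c * d' (\<phi> p) (a' (inv g \<otimes> h) y')" using \<phi>(2)[OF p gh] .
    also have "\<dots> = c * d' (a' g (\<phi> p)) (a' h y')" using g p h y' \<phi>(1) by (simp add: B.a_mult B.dist_inv_right)
    finally show "d' (\<phi> (a g p)) (a' h y') = d' (a' g (\<phi> p)) (a' h y')" using c by simp
  qed (use g p \<phi> in auto)
  have "M' \<subseteq> \<phi> ` M"
  proof
    fix p' assume p': "p' \<in> M'"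
    obtain f where f: "f \<in> carrier G" "B.between y' p' (a' f y')" using B.orbit_star_covers[OF y' p'] by blast
    have D: "c * d' y' p' + c * d' p' (a' f y') = d y (a f y)"
      using f eq[OF f(1)] by (simp add: B.between_def flip: distrib_left)
    have "c * d' y' p' \<le> d y (a f y)" using D c mult_nonneg_nonneg[of c "d' p' (a' f y')"] by (simp del: mult_nonneg_nonneg)
    then obtain p where p: "p \<in> M" "d y p = c * d' y' p'" "d p (a f y) = d y (a f y) - c * d' y' p'"
      using A.segment_point[of y "a f y" "c * d' y' p'"] y f c by auto
    have "d' y' p' = d' y' (\<phi> p)"
      using p(2) \<phi>1[OF p(1)] c A.commute[of y p] B.commute[of y' "\<phi> p"] by simp
    moreover have "B.between y' (\<phi> p) (a' f y')"
    proof -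
      have "c * (d' y' (\<phi> p) + d' (\<phi> p) (a' f y')) = c * d' y' (a' f y')"
        using p(3) \<phi>(2)[OF p(1) f(1)] eq[OF f(1)] \<open>d' y' p' = d' y' (\<phi> p)\<close> by (simp add: distrib_left)
      then show ?thesis using c by (simp add: B.between_def)
    qed
    ultimately have "p' = \<phi> p" using B.between_unique[OF y' _ p' \<phi>(1)[OF p(1)] f(2)] y' f by simp
    then show "p' \<in> \<phi> ` M" using p by blast
  qed
  then have "\<phi> ` M = M'" using \<phi>(1) by blast
  then show ?thesis using isom equivar by blast
qed

lemma marker_orbits_homothetic:
  assumes c: "c > 0" and proportional: "\<And>g. g \<in> carrier G \<Longrightarrow> A.tlen g = c * B.tlen g"
  obtains y y' where "y \<in> M" "y' \<in> M'" "\<And>f. f \<in> carrier G \<Longrightarrow> d y (a f y) = c * d' y' (a' f y')"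
proof -
  obtain u y y' where uc: "\<And>i. u i \<in> carrier G" and m: "A.marks u y" "B.marks u y'"
    using common_marker by blast
  have y: "y \<in> M" "y' \<in> M'" using m by (auto simp: A.marks_def B.marks_def)
  have "d y (a f y) = c * d' y' (a' f y')" if f: "f \<in> carrier G" for f
  proof (rule antisym)
    obtain i where i: "i < 3" "d y (a f y) = A.tlen (f \<otimes> u i) - A.tlen (u i)" using A.marks_eq[OF m(1) f] .
    then have "d y (a f y) = c * (B.tlen (f \<otimes> u i) - B.tlen (u i))"
      using proportional uc f by (simp add: right_diff_distrib)
    also have "\<dots> \<le> c * d' y' (a' f y')" using B.marks_le[OF m(2) f i(1)] c by (intro mult_left_mono) auto
    finally show "d y (a f y) \<le> c * d' y' (a' f y')" .
    obtain j where j: "j < 3" "d' y' (a' f y') = B.tlen (f \<otimes> u j) - B.tlen (u j)" using B.marks_eq[OF m(2) f] .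
    then have "c * d' y' (a' f y') = A.tlen (f \<otimes> u j) - A.tlen (u j)"
      using proportional uc f by (simp add: right_diff_distrib)
    also have "\<dots> \<le> d y (a f y)" using A.marks_le[OF m(1) f j(1)] by simp
    finally show "c * d' y' (a' f y') \<le> d y (a f y)" .
  qed
  then show ?thesis using that y by blast
qed

end

section \<open>Points of outer space\<close>
lemma cv_free_group_action:
  fixes T :: "('g, 'a) tree_action"
  assumes grp: "group F" and X: "free_basis F X" "finite X" "card X \<ge> 2" and T: "T \<in> cv F"
  shows "free_group_action (pts T) (mdist (tree T)) F (act T) X"
proof -
  have tree: "real_tree (tree T)" and iso: "isometric_action F T" and min: "minimal_action F T"
    and free: "free_action F T" and disc: "discrete_action F T"
    using T by (auto simp: cv_def)
  interpret rtree "pts T" "mdist (tree T)" using real_tree_imp_rtree[OF tree] .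
  interpret group F by fact
  interpret ga: group_action F "pts T" "act T" using iso by (simp add: isometric_action_def)
  interpret fa: free_tree_action "pts T" "mdist (tree T)" F "act T"
  proof
    show "act T g x \<in> pts T" if "g \<in> carrier F" "x \<in> pts T" for g x
      using ga.element_image that by blast
    show "act T (g \<otimes>\<^bsub>F\<^esub> h) x = act T g (act T h x)" if "g \<in> carrier F" "h \<in> carrier F" "x \<in> pts T" for g h x
      using ga.composition_rule that by blast
    show "act T \<one>\<^bsub>F\<^esub> x = x" if "x \<in> pts T" for x
      using ga.id_eq_one that by (metis restrict_apply)
    show "mdist (tree T) (act T g x) (act T g y) = mdist (tree T) x y"
      if "g \<in> carrier F" "x \<in> pts T" "y \<in> pts T" for g x y
      using iso that by (simp add: isometric_action_def)
    show "g = \<one>\<^bsub>F\<^esub>" if "g \<in> carrier F" "x \<in> pts T" "act T g x = x" for g x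
      using free that by (auto simp: free_action_def stabilizer_def)
    show "pts T \<noteq> {}" using tree by (simp add: real_tree_def)
  qed
  show ?thesis
  proof
    show "S = pts T"
      if S: "S \<subseteq> pts T" "S \<noteq> {}" "\<And>x y p. \<lbrakk>x \<in> S; y \<in> S; p \<in> pts T; between x p y\<rbrakk> \<Longrightarrow> p \<in> S"
        and inv: "\<And>g. g \<in> carrier F \<Longrightarrow> act T g ` S \<subseteq> S" for S
    proof -
      have "real_tree (submetric (tree T) S)"
        by (rule convex_subset_real_tree[OF tree S(1,2)]) (rule S(3), simp_all add: between_def)
      then show ?thesis
        by (intro min[unfolded minimal_action_def, THEN spec, THEN mp]) (simp add: S(1) inv)
    qed
    show "\<exists>r>0. \<forall>g\<in>carrier F. g \<noteq> \<one>\<^bsub>F\<^esub> \<longrightarrow> r \<le> mdist (tree T) x (act T g x)" if x: "x \<in> pts T" for x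
    proof -
      define Orb where "Orb = orbit F (act T) x"
      have eq: "subtopology (mtopology_of (tree T)) Orb = discrete_topology Orb"
        using disc x by (simp add: discrete_action_def Orb_def)
      have "x \<in> Orb" unfolding Orb_def orbit_def using x fa.a_one[OF x] one_closed by force
      then have "openin (subtopology (mtopology_of (tree T)) Orb) {x}" unfolding eq by simp
      then obtain U where U: "openin (mtopology_of (tree T)) U" "{x} = U \<inter> Orb"
        by (auto simp: openin_subtopology)
      then have "openin mtopology U" by (simp add: mtopology_of_def)
      then obtain r where r: "r > 0" "mball x r \<subseteq> U" using U(2) unfolding openin_mtopology by blast
      have "r \<le> mdist (tree T) x (act T g x)" if g: "g \<in> carrier F" "g \<noteq> \<one>\<^bsub>F\<^esub>" for g
      proof (rule ccontr)
        assume "\<not> ?thesis"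
        then have "act T g x \<in> U" using r x g by auto
        moreover have "act T g x \<in> Orb" using g by (auto simp: Orb_def orbit_def)
        ultimately have "act T g x = x" using U(2) by blast
        then show False using fa.a_free g x by blast
      qed
      then show ?thesis using r by blast
    qed
  qed (use X in auto)
qed

lemma equivariantly_isometric_rescale_trans:
  assumes "equivariantly_isometric G S (rescale e T)" "equivariantly_isometric G T (rescale c U)"
    and "e > 0" "c > 0"
  shows "equivariantly_isometric G S (rescale (e * c) U)"
proof -
  obtain f where f: "f ` pts S = pts T" "\<forall>x\<in>pts S. \<forall>y\<in>pts S. e * mdist (tree T) (f x) (f y) = mdist (tree S) x y"
     "\<forall>g\<in>carrier G. \<forall>x\<in>pts S. f (act S g x) = act T g (f x)"
    using assms(1) unfolding equivariantly_isometric_def rescale_simps[OF assms(3)] by blast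
  obtain k where k: "k ` pts T = pts U" "\<forall>x\<in>pts T. \<forall>y\<in>pts T. c * mdist (tree U) (k x) (k y) = mdist (tree T) x y"
     "\<forall>g\<in>carrier G. \<forall>x\<in>pts T. k (act T g x) = act U g (k x)"
    using assms(2) unfolding equivariantly_isometric_def rescale_simps[OF assms(4)] by blast
  have ec: "e * c > 0" using assms by simp
  have fT: "f x \<in> pts T" if "x \<in> pts S" for x using f(1) that by blast
  show ?thesis
    unfolding equivariantly_isometric_def rescale_simps[OF ec]
  proof (intro exI[of _ "k \<circ> f"] conjI ballI)
    show "(k \<circ> f) ` pts S = pts U" unfolding image_comp[symmetric] f(1) k(1) ..
    show "e * c * mdist (tree U) ((k \<circ> f) x) ((k \<circ> f) y) = mdist (tree S) x y"
      if "x \<in> pts S" "y \<in> pts S" for x y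
      using f(2) k(2) fT that by (simp add: mult.assoc)
    show "(k \<circ> f) (act S g x) = act U g ((k \<circ> f) x)" if "g \<in> carrier G" "x \<in> pts S" for g x
      using f(3) k(3) fT that by simp
  qed
qed

lemma projective_class_subset:
  assumes "equivariantly_isometric G T (rescale c T')" "c > 0"
  shows "projective_class G T \<subseteq> projective_class G T'"
proof
  fix S assume "S \<in> projective_class G T"
  then obtain e where e: "S \<in> cv G" "e > 0" "equivariantly_isometric G S (rescale e T)"
    by (auto simp: projective_class_def)
  then have "equivariantly_isometric G S (rescale (e * c) T')"
    using equivariantly_isometric_rescale_trans assms by blast
  moreover have "e * c > 0" using e assms by simp
  ultimately show "S \<in> projective_class G T'" using e(1) unfolding projective_class_def by blast
qed

locale outer_space_pair =
  fixes F :: "('g, 'm) monoid_scheme" and X :: "'g set" and T T' :: "('g, 'a) tree_action"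
  assumes grp: "group F" and X: "free_basis F X" "finite X" "card X \<ge> 2"
    and T: "T \<in> cv F" and T': "T' \<in> cv F"

sublocale outer_space_pair \<subseteq> two_actions "pts T" "mdist (tree T)" F "act T" X "pts T'" "mdist (tree T')" "act T'"
proof -
  interpret A: free_group_action "pts T" "mdist (tree T)" F "act T" X
    by (rule cv_free_group_action[OF grp X T])
  interpret B: free_group_action "pts T'" "mdist (tree T')" F "act T'" X
    by (rule cv_free_group_action[OF grp X T'])
  show "two_actions (pts T) (mdist (tree T)) F (act T) X (pts T') (mdist (tree T')) (act T')"
    by unfold_locales
qed

context outer_space_pair begin

lemma A_tlen: "A.tlen g = translation_length T g"
  by (simp add: A.tlen_def translation_length_def)

lemma B_tlen: "B.tlen g = translation_length T' g"
  by (simp add: B.tlen_def translation_length_def)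

lemma A_growth_rate:
  assumes x: "x \<in> pts T"
  shows "quasi_length.growth_rate X (A.len x) (volume_entropy F T x)" "volume_entropy F T x > 0"
proof -
  obtain C where C: "quasi_length X (A.len x) C" using A.quasi_length_len[OF x] .
  interpret Q: quasi_length X "A.len x" C by fact
  obtain h where h: "Q.growth_rate h" using Q.growth_rate_exists by blast
  then have "((\<lambda>R. 1 / R * ln (real (card {g \<in> carrier F. mdist (tree T) x (act T g x) \<le> R}))) \<longlongrightarrow> h) at_top"
    unfolding Q.growth_rate_def Q.N_def A.orbit_count[OF x] by simp
  then have "volume_entropy F T x = h" unfolding volume_entropy_def by (intro tendsto_Lim) auto
  then show "Q.growth_rate (volume_entropy F T x)" "volume_entropy F T x > 0"
    using h Q.growth_rate_pos by auto
qed

lemma equivariantly_isometric_of_proportional: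
  assumes c: "c > 0" and proportional: "\<And>g. g \<in> carrier F \<Longrightarrow> A.tlen g = c * B.tlen g"
  shows "equivariantly_isometric F T (rescale c T')"
proof -
  obtain y y' where y: "y \<in> pts T" "y' \<in> pts T'"
    and eq: "\<And>f. f \<in> carrier F \<Longrightarrow> mdist (tree T) y (act T f y) = c * mdist (tree T') y' (act T' f y')"
    using marker_orbits_homothetic[OF c proportional] by blast
  show ?thesis
    unfolding equivariantly_isometric_def rescale_simps[OF c]
    using orbit_isometry_extends[OF c y eq] by blast
qed

text \<open>All statements that bound \<open>T\<close> by \<open>T'\<close> have mirror images, which are obtained by interpreting the locale
  with the trees interchanged.\<close>
lemma swap: "outer_space_pair F X T' T"
  using grp X T T' by unfold_locales

lemma projective_class_eq_of_proportional:
  assumes c: "c > 0" and proportional: "\<And>g. g \<in> carrier F \<Longrightarrow> A.tlen g = c * B.tlen g"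
  shows "projective_class F T = projective_class F T'"
proof
  interpret R: outer_space_pair F X T' T by (rule swap)
  show "projective_class F T \<subseteq> projective_class F T'"
    using projective_class_subset[OF equivariantly_isometric_of_proportional[OF c proportional] c] .
  have "B.tlen g = 1 / c * A.tlen g" if "g \<in> carrier F" for g using proportional[OF that] c by simp
  then show "projective_class F T' \<subseteq> projective_class F T"
    using c by (intro projective_class_subset[OF R.equivariantly_isometric_of_proportional[of "1 / c"]]) auto
qed

lemma entropy_le:
  assumes c: "c > 0" and le: "\<And>g. g \<in> carrier F - {\<one>\<^bsub>F\<^esub>} \<Longrightarrow> translation_length T g \<le> c * translation_length T' g"
    and x: "x \<in> pts T" and x': "x' \<in> pts T'"
  shows "volume_entropy F T' x' \<le> c * volume_entropy F T x"
    and "volume_entropy F T' x' = c * volume_entropy F T x \<Longrightarrow> projective_class F T = projective_class F T'"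
proof -
  interpret R: outer_space_pair F X T' T by (rule swap)
  have le': "A.tlen g \<le> c * B.tlen g" if "g \<in> carrier F" for g
    using le[of g] that A.tlen_one B.tlen_one by (cases "g = \<one>\<^bsub>F\<^esub>") (auto simp: A_tlen B_tlen)
  note cmp = entropy_comparison[OF le' c x x' A_growth_rate(1)[OF x] R.A_growth_rate(1)[OF x']]
  show "volume_entropy F T' x' \<le> c * volume_entropy F T x" by (rule cmp(1))
  assume "volume_entropy F T' x' = c * volume_entropy F T x"
  then show "projective_class F T = projective_class F T'"
    using cmp(2) by (intro projective_class_eq_of_proportional[OF c]) auto
qed

lemma entropy_ratio_le_Sup:
  fixes x x' :: 'a
  defines "s \<equiv> (SUP g\<in>carrier F - {\<one>\<^bsub>F\<^esub>}. translation_length T g / translation_length T' g)"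
    and "r \<equiv> volume_entropy F T' x' / volume_entropy F T x"
  assumes x: "x \<in> pts T" and x': "x' \<in> pts T'"
  shows "r \<le> s" "projective_class F T \<noteq> projective_class F T' \<Longrightarrow> r < s"
proof -
  let ?q = "\<lambda>g. translation_length T g / translation_length T' g"
  have pos: "translation_length T g > 0" "translation_length T' g > 0" if "g \<in> carrier F - {\<one>\<^bsub>F\<^esub>}" for g
    using that A.tlen_pos[of g] B.tlen_pos[of g] by (auto simp: A_tlen B_tlen)
  obtain c where c: "c > 0" "\<And>g. g \<in> carrier F \<Longrightarrow> A.tlen g \<le> c * B.tlen g"
    using translation_lengths_comparable by blast
  have "?q g \<le> c" if "g \<in> carrier F - {\<one>\<^bsub>F\<^esub>}" for g
    using c(2)[of g] pos[OF that] that by (simp add: A_tlen B_tlen divide_le_eq)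
  then have bdd: "bdd_above (?q ` (carrier F - {\<one>\<^bsub>F\<^esub>}))" by (intro bdd_aboveI2)
  have le: "?q g \<le> s" if "g \<in> carrier F - {\<one>\<^bsub>F\<^esub>}" for g
    unfolding s_def by (rule cSUP_upper[OF that bdd])
  obtain g0 where "g0 \<in> carrier F - {\<one>\<^bsub>F\<^esub>}" using A.ex_nontrivial by blast
  then have s0: "s > 0" using le[of g0] pos[of g0] by (smt (verit) divide_pos_pos)
  have "translation_length T g \<le> s * translation_length T' g" if "g \<in> carrier F - {\<one>\<^bsub>F\<^esub>}" for g
    using le[OF that] pos[OF that] by (simp add: divide_le_eq)
  note E = entropy_le[OF s0 this x x']
  have h0: "volume_entropy F T x > 0" using A_growth_rate(2)[OF x] .
  show rs: "r \<le> s" using E(1) h0 by (simp add: r_def divide_le_eq)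
  show "r < s" if "projective_class F T \<noteq> projective_class F T'"
  proof -
    have "r \<noteq> s" using E(2) that h0 by (auto simp: r_def)
    then show ?thesis using rs by simp
  qed
qed

lemma Inf_le_entropy_ratio:
  fixes x x' :: 'a
  defines "s \<equiv> (INF g\<in>carrier F - {\<one>\<^bsub>F\<^esub>}. translation_length T g / translation_length T' g)"
    and "r \<equiv> volume_entropy F T' x' / volume_entropy F T x"
  assumes x: "x \<in> pts T" and x': "x' \<in> pts T'"
  shows "s \<le> r" "projective_class F T \<noteq> projective_class F T' \<Longrightarrow> s < r"
proof -
  interpret R: outer_space_pair F X T' T by (rule swap)
  let ?q = "\<lambda>g. translation_length T g / translation_length T' g"
  have pos: "translation_length T g > 0" "translation_length T' g > 0" if "g \<in> carrier F - {\<one>\<^bsub>F\<^esub>}" for g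
    using that A.tlen_pos[of g] B.tlen_pos[of g] by (auto simp: A_tlen B_tlen)
  have h0: "volume_entropy F T x > 0" "volume_entropy F T' x' > 0"
    using A_growth_rate(2)[OF x] R.A_growth_rate(2)[OF x'] by auto
  then have r0: "r > 0" by (simp add: r_def)
  have bdd: "bdd_below (?q ` (carrier F - {\<one>\<^bsub>F\<^esub>}))"
    using pos by (intro bdd_belowI2[of _ 0]) (simp add: less_imp_le)
  have le: "s \<le> ?q g" if "g \<in> carrier F - {\<one>\<^bsub>F\<^esub>}" for g
    unfolding s_def by (rule cINF_lower[OF bdd that])
  have "s \<le> r \<and> (projective_class F T \<noteq> projective_class F T' \<longrightarrow> s < r)"
  proof (cases "s > 0")
    case False then show ?thesis using r0 by simp
  next
    case True
    have "translation_length T' g \<le> 1 / s * translation_length T g" if "g \<in> carrier F - {\<one>\<^bsub>F\<^esub>}" for g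
      using le[OF that] pos[OF that] True by (simp add: field_simps)
    note E = R.entropy_le[OF _ this x' x]
    have "volume_entropy F T x \<le> 1 / s * volume_entropy F T' x'" using True by (intro E(1)) auto
    then have sr: "s \<le> r" using h0 True by (simp add: r_def field_simps)
    have "projective_class F T' = projective_class F T" if "s = r"
    proof (rule E(2))
      show "volume_entropy F T x = 1 / s * volume_entropy F T' x'" using that h0 by (simp add: r_def)
    qed (use True in auto)
    then show ?thesis using sr by (auto simp: less_le)
  qed
  then show "s \<le> r" "projective_class F T \<noteq> projective_class F T' \<Longrightarrow> s < r" by auto
qed

end

theorem corollary4:
  fixes F :: "('g, 'm) monoid_scheme" and k :: nat
    and T T' :: "('g, 'a) tree_action" and x\<^sub>0 x\<^sub>0' :: 'a
  assumes "free_group_of_rank F k" and "k \<ge> 2"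
    and "T \<in> cv F" and "T' \<in> cv F"
    and "x\<^sub>0 \<in> pts T" and "x\<^sub>0' \<in> pts T'"
  shows "((INF g\<in>carrier F - {\<one>\<^bsub>F\<^esub>}. translation_length T g / translation_length T' g)
            \<le> volume_entropy F T' x\<^sub>0' / volume_entropy F T x\<^sub>0 \<and>
          volume_entropy F T' x\<^sub>0' / volume_entropy F T x\<^sub>0
            \<le> (SUP g\<in>carrier F - {\<one>\<^bsub>F\<^esub>}. translation_length T g / translation_length T' g)) \<and>
         (projective_class F T \<noteq> projective_class F T' \<longrightarrow>
          (INF g\<in>carrier F - {\<one>\<^bsub>F\<^esub>}. translation_length T g / translation_length T' g)
            < volume_entropy F T' x\<^sub>0' / volume_entropy F T x\<^sub>0 \<and>
          volume_entropy F T' x\<^sub>0' / volume_entropy F T x\<^sub>0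
            < (SUP g\<in>carrier F - {\<one>\<^bsub>F\<^esub>}. translation_length T g / translation_length T' g))"
proof -
  obtain X where X: "group F" "free_basis F X" "finite X" "card X = k"
    using assms(1) by (auto simp: free_group_of_rank_def)
  interpret outer_space_pair F X T T'
    using X assms by (intro outer_space_pair.intro) auto
  show ?thesis
    using entropy_ratio_le_Sup[OF assms(5,6)] Inf_le_entropy_ratio[OF assms(5,6)] by blast
qed

end
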